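(* For $p\in(1,\infty)$ let $\theta_p=2\arcsin\big(\frac{2\sqrt{p-1}}p\big)$. Then, for every $p>q>1$ (with $p,q$ finite), every $n,d\in\mathbb{N}$ with $d\in\{1,\ldots,n\}$ and every function $f:\{-1,1\}^n\to\mathbb{C}$ of degree at most $d$, we have $$\|f\|_{L_p(\{-1,1\}^n;\mathbb{C})}\leq\left(\frac{(\sqrt{p-1}+\sqrt{q-1})^{\frac{\pi}{2\pi-\theta_p}}+(\sqrt{p-1}-\sqrt{q-1})^{\frac{\pi}{2\pi-\theta_p}}}{(\sqrt{p-1}+\sqrt{q-1})^{\frac{\pi}{2\pi-\theta_p}}-(\sqrt{p-1}-\sqrt{q-1})^{\frac{\pi}{2\pi-\theta_p}}}\right)^d\|f\|_{L_q(\{-1,1\}^n;\mathbb{C})}.$$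
   Context: $\mathbb{N}=\{1,2,\ldots\}$. For $p\in[1,\infty)$, $\|f\|_{L_p(\{-1,1\}^n;\mathbb{C})}=\big(2^{-n}\sum_{\varepsilon\in\{-1,1\}^n}|f(\varepsilon)|^p\big)^{1/p}$. For $A\subseteq\{1,\ldots,n\}$, the Walsh function is $w_A(\varepsilon)=\prod_{i\in A}\varepsilon_i$. Every $f:\{-1,1\}^n\to\mathbb{C}$ has the expansion $f=\sum_{A}\widehat f(A)w_A$ with $\widehat f(A)=2^{-n}\sum_{\delta\in\{-1,1\}^n}f(\delta)w_A(\delta)$. A function $f$ has degree at most $d$ if $\widehat f(A)=0$ whenever $|A|>d$. *)

theory Defs
  imports "HOL-Analysis.Analysis"
begin

text \<open>
  Points of \<open>{-1,1}\<^sup>n\<close> are the extensional functions on \<open>{1..n}\<close> with values \<open>\<plusminus>1\<close>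
  (and equal to \<open>undefined\<close> outside \<open>{1..n}\<close>), so \<open>cube n\<close> has exactly
  \<open>2 ^ n\<close> elements. Functions on the cube are functions on the ambient type
  \<open>nat \<Rightarrow> real\<close> of which only the values on \<open>cube n\<close> are ever used.
\<close>

definition cube :: "nat \<Rightarrow> (nat \<Rightarrow> real) set" where
  "cube n = {1..n} \<rightarrow>\<^sub>E {-1, 1}"

definition Lp_norm :: "nat \<Rightarrow> real \<Rightarrow> ((nat \<Rightarrow> real) \<Rightarrow> complex) \<Rightarrow> real" where
  "Lp_norm n p f = ((\<Sum>\<epsilon>\<in>cube n. norm (f \<epsilon>) powr p) / 2 ^ n) powr (1 / p)"

definition walsh :: "nat set \<Rightarrow> (nat \<Rightarrow> real) \<Rightarrow> real" where
  "walsh A \<epsilon> = (\<Prod>i\<in>A. \<epsilon> i)"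

definition fourier_coeff :: "nat \<Rightarrow> ((nat \<Rightarrow> real) \<Rightarrow> complex) \<Rightarrow> nat set \<Rightarrow> complex" where
  "fourier_coeff n f A = (\<Sum>\<delta>\<in>cube n. f \<delta> * complex_of_real (walsh A \<delta>)) / 2 ^ n"

definition degree_at_most :: "nat \<Rightarrow> nat \<Rightarrow> ((nat \<Rightarrow> real) \<Rightarrow> complex) \<Rightarrow> bool" where
  "degree_at_most n d f \<longleftrightarrow> (\<forall>A\<subseteq>{1..n}. card A > d \<longrightarrow> fourier_coeff n f A = 0)"

definition theta :: "real \<Rightarrow> real" where
  "theta p = 2 * arcsin (2 * sqrt (p - 1) / p)"

end

theory Submission
  imports Defs "HOL-Complex_Analysis.Complex_Analysis"
begin

text \<open>
  Let \<open>T\<^sub>z\<close> be the multiplier \<open>w\<^sub>A \<mapsto> z\<^bsup>|A|\<^esup> w\<^sub>A\<close> and \<open>r = \<surd>((q - 1) / (p - 1)) < 1\<close>. Three facts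
  give the theorem.

  \<^item> Hypercontractivity for real parameters: \<open>T\<^sub>r\<close> is a contraction from \<open>L\<^sub>q\<close> to \<open>L\<^sub>p\<close>
    (\<open>noise_sum_hypercontractive\<close>).

  \<^item> Contractivity for complex parameters: \<open>T\<^sub>z\<close> is a contraction on \<open>L\<^sub>p\<close> for every \<open>z\<close> in the lens
    \<open>|p - 2| |1 - z\<^sup>2| \<le> p (1 - |z|\<^sup>2)\<close>, whose vertices are \<open>\<plusminus>1\<close> and whose angle is \<open>theta p\<close>
    (\<open>Lp_norm_lens\<close>).

  \<^item> A Bernstein-Walsh estimate: a polynomial of degree at most \<open>d\<close> that is bounded by \<open>M\<close> on the lens is
    bounded by \<open>M |u|\<^bsup>-d\<^esup>\<close> at the exterior point that the conformal map from the unit disc onto the exterior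
    of the lens assigns to \<open>u\<close> (\<open>polynomial_growth_off_lens\<close>).

  For \<open>g = T\<^sub>r f\<close> the function \<open>f\<close> is the value at \<open>z = 1/r\<close> of the polynomial \<open>T\<^sub>z g\<close> in \<open>z\<close>, which has degree at
  most \<open>d\<close>. The second and third facts bound the \<open>L\<^sub>p\<close> norm of \<open>f\<close> by \<open>u\<^bsup>-d\<^esup>\<close> times that of \<open>g\<close>, and the
  first bounds the latter by the \<open>L\<^sub>q\<close> norm of \<open>f\<close>. The exterior map is elementary: with
  \<open>\<gamma> = 2 - theta p / \<pi>\<close>, the power \<open>\<gamma>\<close> of \<open>(1 + u) / (1 - u)\<close> is \<open>(z + 1) / (z - 1)\<close>. Solving for \<open>1/u\<close> at
  \<open>z = 1/r\<close> gives the constant of the theorem.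

  The lens estimate tensorizes coordinate by coordinate, so it reduces to the two-point inequality
  \<open>|a + zb|\<^sup>p + |a - zb|\<^sup>p \<le> |a + b|\<^sup>p + |a - b|\<^sup>p\<close>, and by duality to \<open>p \<ge> 2\<close>. For \<open>p > 2\<close>, \<open>a = 1\<close>, \<open>y = zb\<close> and
  \<open>s = p/2\<close>, the condition on \<open>z\<close> is \<open>|b\<^sup>2 - y\<^sup>2| \<le> s / (s - 1) (|b|\<^sup>2 - |y|\<^sup>2)\<close>: in the coordinates
  \<open>(m, B) = (|b|\<^sup>2, b\<^sup>2)\<close> it describes a convex cone with vertex at the point of \<open>b\<close>, and the claim is that the
  mean of \<open>|1 + b|\<^sup>p\<close> and \<open>|1 - b|\<^sup>p\<close> is monotone with respect to this cone. Monotonicity can be checked by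
  differentiating along segments, but a segment leaves the surface \<open>|B| = m\<close>, so the mean must first be extended
  to \<open>|B| \<le> m\<close>. For \<open>p \<ge> 3\<close> the extension that depends on \<open>m\<close> and \<open>Re B\<close> alone works
  (\<open>two_point_mean_mono_large\<close>). For \<open>2 < p < 3\<close> it fails near the positive axis, and the extension that is
  harmonic in \<open>B\<close> is used instead. In its expansion
  \<open>\<Sum>\<^sub>l A\<^sub>l(m) Re (B\<^sup>l)\<close> the functions \<open>A\<^sub>l\<close>, \<open>l > 0\<close>, are nonnegative and decreasing. Hence the worst case is
  \<open>B = m\<close>, and there the lower bound for the derivative is a power series in \<open>m\<close>, with coefficients in closed form
  (\<open>gbinomial_product_le\<close>). The expansions in \<open>b\<close> and in \<open>1/b\<close> are treated separately and joined at \<open>m = 1\<close>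
  (\<open>two_point_mean_mono_critical\<close>).
\<close>

section \<open>Signs of generalized binomial coefficients\<close>

lemma gbinomial_Suc_factor:
  fixes a :: real
  shows "(a gchoose Suc i) = (a gchoose i) * (a - real i) / real (Suc i)"
proof -
  have "real (Suc i) * (a gchoose Suc i) = (a gchoose i) * (a - real i)"
    using gbinomial_mult_1[of a i] by (simp add: algebra_simps)
  then show ?thesis by (simp add: field_simps)
qed

lemma gbinomial_sign_nonpos:
  fixes a :: real
  assumes "a \<le> 0"
  shows "0 \<le> (-1) ^ i * (a gchoose i)"
proof (induction i)
  case (Suc i)
  have "(-1) ^ Suc i * (a gchoose Suc i) = ((-1) ^ i * (a gchoose i)) * ((real i - a) / real (Suc i))"
    by (simp add: gbinomial_Suc_factor field_simps)
  moreover have "0 \<le> (real i - a) / real (Suc i)" using assms by simp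
  ultimately show ?case using Suc by (simp only: mult_nonneg_nonneg)
qed simp

lemma gbinomial_sign:
  fixes a :: real
  assumes "real k \<le> a" "a \<le> real k + 1" "k < i"
  shows "0 \<le> (-1) ^ (i + k + 1) * (a gchoose i)"
  using assms(3)
proof (induction i)
  case (Suc i)
  show ?case
  proof (cases "i = k")
    case True
    have "0 \<le> (a gchoose Suc k)"
      unfolding gbinomial_prod_rev using assms(1)
      by (intro divide_nonneg_nonneg prod_nonneg) (auto)
    moreover have "(-1 :: real) ^ (Suc i + k + 1) = 1"
      using True by (simp add: power_add)
    ultimately show ?thesis using True by simp
  next
    case False
    then have ki: "k < i" using Suc.prems by simp
    have "(-1) ^ (Suc i + k + 1) * (a gchoose Suc i)
        = ((-1) ^ (i + k + 1) * (a gchoose i)) * ((real i - a) / real (Suc i))"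
      by (simp add: gbinomial_Suc_factor field_simps)
    moreover have "0 \<le> (real i - a) / real (Suc i)" using ki assms(2) by simp
    ultimately show ?thesis using Suc.IH[OF ki] by (simp only: mult_nonneg_nonneg)
  qed
qed simp

text \<open>Partial sums of \<open>\<Sum>(-1)\<^sup>j (a gchoose j)\<close> are binomial coefficients again, and for
  \<open>0 \<le> a \<le> 1\<close> all terms after the first have the same sign.\<close>

lemma sum_abs_gbinomial_le:
  fixes a :: real
  assumes "0 \<le> a" "a \<le> 1"
  shows "(\<Sum>j=1..n. \<bar>a gchoose j\<bar>) \<le> 1"
proof -
  have s: "0 \<le> (-1) ^ (j + 1) * (a gchoose j)" if "1 \<le> j" for j
    using gbinomial_sign[of 0 a j] assms that by simp
  have abs: "\<bar>a gchoose j\<bar> = - ((a gchoose j) * (-1) ^ j)" if "j \<in> {1..n}" for j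
  proof -
    have "\<bar>(-1) ^ (j + 1) * (a gchoose j)\<bar> = (-1) ^ (j + 1) * (a gchoose j)"
      using s[of j] that by simp
    then show ?thesis by (simp add: abs_mult)
  qed
  have "{..n} = insert 0 {1..n}" by auto
  then have "(\<Sum>j\<le>n. (a gchoose j) * (-1) ^ j) = 1 + (\<Sum>j=1..n. (a gchoose j) * (-1) ^ j)"
    by simp
  then have "(\<Sum>j=1..n. \<bar>a gchoose j\<bar>) = 1 - (-1) ^ n * (a - 1 gchoose n)"
    using gbinomial_sum_lower_neg[of a n] abs by (simp add: sum_negf)
  moreover have "0 \<le> (-1) ^ n * (a - 1 gchoose n)"
    using assms gbinomial_sign_nonpos[of "a - 1" n] by simp
  ultimately show ?thesis by simp
qed

lemma summable_abs_gbinomial_unit: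
  fixes a :: real
  assumes "0 \<le> a" "a \<le> 1"
  shows "summable (\<lambda>j. \<bar>a gchoose j\<bar>)"
proof -
  have "summable (\<lambda>j. \<bar>a gchoose Suc j\<bar>)"
  proof (rule summableI_nonneg_bounded[where x = 1])
    fix n
    have "(\<Sum>j<n. \<bar>a gchoose Suc j\<bar>) = (\<Sum>j=1..n. \<bar>a gchoose j\<bar>)"
      by (rule sum_bounds_lt_plus1)
    then show "(\<Sum>j<n. \<bar>a gchoose Suc j\<bar>) \<le> 1"
      using sum_abs_gbinomial_le[OF assms, of n] by simp
  qed simp
  then show ?thesis by (subst (asm) summable_Suc_iff)
qed

lemma summable_abs_gbinomial:
  fixes s :: real
  assumes "1 \<le> s" "s \<le> 2"
  shows "summable (\<lambda>j. \<bar>s gchoose j\<bar>)"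
proof -
  have a: "summable (\<lambda>j. \<bar>s - 1 gchoose j\<bar>)"
    using assms by (intro summable_abs_gbinomial_unit) auto
  have "summable (\<lambda>j. \<bar>s gchoose Suc j\<bar>)"
  proof (rule summable_comparison_test')
    show "summable (\<lambda>j. \<bar>s - 1 gchoose Suc j\<bar> + \<bar>s - 1 gchoose j\<bar>)"
      using a by (intro summable_add) (auto simp: summable_Suc_iff[of "\<lambda>j. \<bar>s - 1 gchoose j\<bar>"])
    show "norm \<bar>s gchoose Suc j\<bar> \<le> \<bar>s - 1 gchoose Suc j\<bar> + \<bar>s - 1 gchoose j\<bar>" for j
      using gbinomial_addition_formula[of s j] by simp
  qed
  then show ?thesis by (subst (asm) summable_Suc_iff)
qed

lemma summable_mult_bounded:
  fixes c g :: "nat \<Rightarrow> real"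
  assumes "summable (\<lambda>j. \<bar>c j\<bar>)" "\<And>j. \<bar>g j\<bar> \<le> M"
  shows "summable (\<lambda>j. \<bar>c j * g j\<bar>)" "summable (\<lambda>j. c j * g j)"
proof -
  show "summable (\<lambda>j. \<bar>c j * g j\<bar>)"
  proof (rule summable_comparison_test')
    show "summable (\<lambda>j. \<bar>c j\<bar> * M)" using assms(1) by (rule summable_mult2)
    show "norm \<bar>c j * g j\<bar> \<le> \<bar>c j\<bar> * M" for j
      using assms(2)[of j] by (simp add: abs_mult mult_left_mono)
  qed
  then show "summable (\<lambda>j. c j * g j)" by (rule summable_rabs_cancel)
qed

text \<open>The term at \<open>j = 0\<close> is \<open>g 0\<close>. The others are nonpositive, and since \<open>g\<close> is decreasing their absolute
  values add up to at most \<open>g 0\<close> times the previous bound.\<close>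

lemma gbinomial_sum_decreasing_nonneg:
  fixes a :: real and g :: "nat \<Rightarrow> real"
  assumes a: "0 \<le> a" "a \<le> 1"
    and g: "\<And>j. 0 \<le> g j" "\<And>j. g (Suc j) \<le> g j" and x: "0 \<le> x" "x \<le> 1"
  shows "summable (\<lambda>j. (a gchoose j) * (-1) ^ j * g j * x ^ j)"
    and "0 \<le> (\<Sum>j. (a gchoose j) * (-1) ^ j * g j * x ^ j)"
proof -
  have le: "g j \<le> g 0" for j
    using g(2) by (simp add: lift_Suc_antimono_le)
  have b: "\<bar>(-1) ^ j * g j * x ^ j\<bar> \<le> g 0" for j
  proof -
    have "g j * x ^ j \<le> g 0 * 1"
      using le[of j] g(1) x by (intro mult_mono) (auto simp: power_le_one)
    then show ?thesis using g(1)[of j] x by (simp add: abs_mult)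
  qed
  show sm: "summable (\<lambda>j. (a gchoose j) * (-1) ^ j * g j * x ^ j)"
    using summable_mult_bounded(2)[OF summable_abs_gbinomial_unit[OF a], of "\<lambda>j. (-1) ^ j * g j * x ^ j", OF b]
    by (simp add: mult_ac)
  have "0 \<le> (\<Sum>j<Suc n. (a gchoose j) * (-1) ^ j * g j * x ^ j)" for n
  proof -
    have split: "{..<Suc n} = insert 0 {1..n}" by auto
    have "\<bar>\<Sum>j=1..n. (a gchoose j) * (-1) ^ j * g j * x ^ j\<bar>
        \<le> (\<Sum>j=1..n. \<bar>a gchoose j\<bar> * g 0)"
    proof (rule order_trans[OF sum_abs], rule sum_mono)
      fix j
      show "\<bar>(a gchoose j) * (-1) ^ j * g j * x ^ j\<bar> \<le> \<bar>a gchoose j\<bar> * g 0"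
        using mult_left_mono[OF b[of j], of "\<bar>a gchoose j\<bar>"] by (simp add: abs_mult mult_ac)
    qed
    also have "\<dots> = (\<Sum>j=1..n. \<bar>a gchoose j\<bar>) * g 0" by (simp add: sum_distrib_right)
    also have "\<dots> \<le> 1 * g 0"
      by (intro mult_right_mono sum_abs_gbinomial_le a g)
    finally show ?thesis unfolding split by simp
  qed
  then have "eventually (\<lambda>n. 0 \<le> (\<Sum>j<n. (a gchoose j) * (-1) ^ j * g j * x ^ j)) sequentially"
    by (intro eventually_sequentiallyI[of 1]) (metis One_nat_def Suc_le_D)
  with summable_LIMSEQ[OF sm] show "0 \<le> (\<Sum>j. (a gchoose j) * (-1) ^ j * g j * x ^ j)"
    by (rule tendsto_lowerbound) simp
qed

text \<open>Convexity of \<open>g\<close> makes \<open>g j - x g (j + 1)\<close> decreasing, and Pascal's rule turns the claim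
  into the previous lemma for this sequence and the exponent \<open>s - 1\<close>.\<close>

lemma gbinomial_sum_convex_nonneg:
  fixes s :: real and g :: "nat \<Rightarrow> real"
  assumes s: "1 \<le> s" "s \<le> 2"
    and g: "\<And>j. 0 \<le> g j" "\<And>j. g (Suc j) \<le> g j"
      "\<And>j. g (Suc j) - g (Suc (Suc j)) \<le> g j - g (Suc j)"
    and x: "0 \<le> x" "x \<le> 1"
  shows "summable (\<lambda>j. (s gchoose j) * (-1) ^ j * g j * x ^ j)"
    and "0 \<le> (\<Sum>j. (s gchoose j) * (-1) ^ j * g j * x ^ j)"
proof -
  have a: "0 \<le> s - 1" "s - 1 \<le> 1" using s by auto
  define h where "h j = g j - x * g (Suc j)" for j
  have h0: "0 \<le> h j" for j
    using g(1)[of "Suc j"] g(2)[of j] x mult_right_mono[of x 1 "g (Suc j)"] by (simp add: h_def)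
  have h1: "h (Suc j) \<le> h j" for j
  proof -
    have "x * (g (Suc j) - g (Suc (Suc j))) \<le> 1 * (g (Suc j) - g (Suc (Suc j)))"
      using g(2)[of "Suc j"] x by (intro mult_right_mono) auto
    then show ?thesis using g(3)[of j] by (simp add: h_def algebra_simps)
  qed
  let ?t = "\<lambda>j. (s - 1 gchoose j) * (-1) ^ j * g j * x ^ j"
  let ?r = "\<lambda>j. (s - 1 gchoose j) * (-1) ^ Suc j * g (Suc j) * x ^ Suc j"
  note T = gbinomial_sum_decreasing_nonneg[where g = g, OF a g(1,2) x]
  have g1: "0 \<le> g (Suc j)" and g2: "g (Suc (Suc j)) \<le> g (Suc j)" for j using g by auto
  have R: "summable ?r"
    using summable_mult[OF gbinomial_sum_decreasing_nonneg(1)[where a = "s - 1" and g = "\<lambda>j. g (Suc j)" and x = x, OF a g1 g2 x], of "-x"]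
    by (simp add: mult_ac)
  have Suc_eq: "(s gchoose Suc j) * (-1) ^ Suc j * g (Suc j) * x ^ Suc j = ?t (Suc j) + ?r j" for j
    by (simp add: gbinomial_addition_formula[of s] algebra_simps)
  have "(\<lambda>j. ?t (Suc j)) sums (suminf ?t - ?t 0)"
    unfolding sums_Suc_iff[of ?t] using summable_sums[OF T(1)] by simp
  then have "(\<lambda>j. ?t (Suc j) + ?r j) sums (suminf ?t - ?t 0 + suminf ?r)"
    using R by (intro sums_add summable_sums)
  then have "(\<lambda>j. (s gchoose Suc j) * (-1) ^ Suc j * g (Suc j) * x ^ Suc j) sums
      (suminf ?t - ?t 0 + suminf ?r)"
    by (simp only: Suc_eq)
  then have S: "(\<lambda>j. (s gchoose j) * (-1) ^ j * g j * x ^ j) sums (suminf ?t + suminf ?r)"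
    by (subst (asm) sums_Suc_iff) simp
  then show "summable (\<lambda>j. (s gchoose j) * (-1) ^ j * g j * x ^ j)" by (rule sums_summable)
  have "suminf ?t + suminf ?r = (\<Sum>j. ?t j + ?r j)"
    by (rule suminf_add[OF T(1) R])
  also have "\<dots> = (\<Sum>j. (s - 1 gchoose j) * (-1) ^ j * h j * x ^ j)"
    by (intro suminf_cong) (simp add: h_def algebra_simps)
  finally have "0 \<le> suminf ?t + suminf ?r"
    using gbinomial_sum_decreasing_nonneg(2)[where g = h, OF a h0 h1 x] by simp
  then show "0 \<le> (\<Sum>j. (s gchoose j) * (-1) ^ j * g j * x ^ j)"
    using sums_unique[OF S] by simp
qed

section \<open>Power series and double series\<close>

lemma abs_coeff_mult_power_le:
  fixes x :: real
  assumes "0 \<le> x" "x \<le> 1"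
  shows "\<bar>b * x ^ j\<bar> \<le> \<bar>b\<bar>"
  using assms by (simp add: abs_mult power_le_one mult_left_le)

lemma powser_continuous_unit:
  fixes b :: "nat \<Rightarrow> real"
  assumes "summable (\<lambda>j. \<bar>b j\<bar>)"
  shows "continuous_on {0..1} (\<lambda>x. \<Sum>j. b j * x ^ j)"
proof (rule uniform_limit_theorem)
  show "\<forall>\<^sub>F n in sequentially. continuous_on {0..1} (\<lambda>x. \<Sum>j<n. b j * x ^ j)"
    by (intro always_eventually allI continuous_intros)
  show "uniform_limit {0..1} (\<lambda>n x. \<Sum>j<n. b j * x ^ j) (\<lambda>x. \<Sum>j. b j * x ^ j) sequentially"
    by (rule Weierstrass_m_test[OF _ assms]) (auto intro!: abs_coeff_mult_power_le)
qed simp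

lemma powser_summable_unit:
  fixes b :: "nat \<Rightarrow> real"
  assumes "summable (\<lambda>j. \<bar>b j\<bar>)" "0 \<le> x" "x \<le> 1"
  shows "summable (\<lambda>j. b j * x ^ j)"
  by (rule summable_comparison_test'[OF assms(1)]) (use abs_coeff_mult_power_le assms in auto)

lemma powser_derivative:
  fixes b :: "nat \<Rightarrow> real"
  assumes b: "summable (\<lambda>j. \<bar>b j\<bar>)" and x: "0 < x" "x < 1"
  shows "((\<lambda>x. \<Sum>j. b j * x ^ j) has_real_derivative (\<Sum>j. real j * b j * x ^ j) / x) (at x)"
    and "summable (\<lambda>j. real j * b j * x ^ j)"
proof -
  have s1: "summable (\<lambda>j. b j * 1 ^ j)" using powser_summable_unit[OF b, of 1] by simp
  have sd: "summable (\<lambda>j. diffs b j * x ^ j)"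
    by (rule termdiff_converges[of _ 1]) (use x powser_inside[OF s1] in auto)
  have "(\<lambda>j. real (Suc j) * b (Suc j) * x ^ Suc j) sums (x * (\<Sum>j. diffs b j * x ^ j))"
    using sums_mult[OF summable_sums[OF sd], of x] by (simp add: diffs_def mult_ac)
  then have S: "(\<lambda>j. real j * b j * x ^ j) sums (x * (\<Sum>j. diffs b j * x ^ j))"
    using sums_Suc_iff[of "\<lambda>j. real j * b j * x ^ j"] by simp
  then show "summable (\<lambda>j. real j * b j * x ^ j)" by (rule sums_summable)
  have "((\<lambda>x. \<Sum>j. b j * x ^ j) has_real_derivative (\<Sum>j. diffs b j * x ^ j)) (at x)"
    by (rule termdiffs_strong[OF s1]) (use x in auto)
  then show "((\<lambda>x. \<Sum>j. b j * x ^ j) has_real_derivative (\<Sum>j. real j * b j * x ^ j) / x) (at x)"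
    unfolding sums_unique[OF S, symmetric] using x by simp
qed

text \<open>In this lemma and in the next one, \<open>x d/dx\<close> acts termwise on \<open>\<Sum> b\<^sub>j x\<^bsup>l+j\<^esup>\<close> and
  \<open>m d/dm\<close> on \<open>\<Sum> b\<^sub>j m\<^bsup>\<beta>-j\<^esup>\<close>.\<close>

lemma power_mult_powser_derivative:
  fixes b :: "nat \<Rightarrow> real"
  assumes b: "summable (\<lambda>j. \<bar>b j\<bar>)" and x: "0 < x" "x < 1"
  shows "((\<lambda>x. x ^ l * (\<Sum>j. b j * x ^ j)) has_real_derivative
      x ^ l * (\<Sum>j. (real l + real j) * b j * x ^ j) / x) (at x)"
proof -
  note D = powser_derivative[OF b x]
  have sm: "summable (\<lambda>j. b j * x ^ j)" using powser_summable_unit[OF b] x by simp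
  have "(\<Sum>j. (real l + real j) * b j * x ^ j)
      = (\<Sum>j. real l * (b j * x ^ j) + real j * b j * x ^ j)"
    by (simp add: algebra_simps)
  also have "\<dots> = real l * (\<Sum>j. b j * x ^ j) + (\<Sum>j. real j * b j * x ^ j)"
    using sm D(2) by (simp add: suminf_add[symmetric] suminf_mult summable_mult)
  finally have eq: "(\<Sum>j. (real l + real j) * b j * x ^ j)
      = real l * (\<Sum>j. b j * x ^ j) + (\<Sum>j. real j * b j * x ^ j)" .
  have lx: "real l * x ^ (l - 1) = real l * x ^ l / x"
    using x by (cases l) auto
  have "x ^ l * ((\<Sum>j. real j * b j * x ^ j) / x) + real l * x ^ (l - 1) * (\<Sum>j. b j * x ^ j)
      = x ^ l * (\<Sum>j. (real l + real j) * b j * x ^ j) / x"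
    unfolding eq lx using x by (simp add: field_simps)
  moreover have "((\<lambda>x. x ^ l * (\<Sum>j. b j * x ^ j)) has_real_derivative
      x ^ l * ((\<Sum>j. real j * b j * x ^ j) / x) + real l * x ^ (l - 1) * (\<Sum>j. b j * x ^ j)) (at x)"
    using DERIV_mult[OF DERIV_pow[of l x] D(1)] by (simp add: mult_ac add_ac)
  ultimately show ?thesis by simp
qed

lemma powr_mult_powser_inverse_derivative:
  fixes b :: "nat \<Rightarrow> real" and \<beta> :: real
  assumes b: "summable (\<lambda>j. \<bar>b j\<bar>)" and m: "1 < m"
  shows "((\<lambda>m. m powr \<beta> * (\<Sum>j. b j * (1 / m) ^ j)) has_real_derivative
      m powr (\<beta> - 1) * (\<Sum>j. (\<beta> - real j) * b j * (1 / m) ^ j)) (at m)"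
proof -
  have x: "0 < 1 / m" "1 / m < 1" using m by auto
  note D = powser_derivative[OF b x]
  let ?P = "\<lambda>x. \<Sum>j. b j * x ^ j" and ?Q = "\<Sum>j. real j * b j * (1 / m) ^ j"
  have sm: "summable (\<lambda>j. b j * (1 / m) ^ j)" using powser_summable_unit[OF b] x by simp
  have "(\<Sum>j. (\<beta> - real j) * b j * (1 / m) ^ j)
      = (\<Sum>j. \<beta> * (b j * (1 / m) ^ j) - real j * b j * (1 / m) ^ j)"
    by (simp add: algebra_simps)
  also have "\<dots> = \<beta> * ?P (1 / m) - ?Q"
    using sm D(2) by (subst suminf_diff[symmetric]) (simp_all add: suminf_mult summable_mult)
  finally have eq: "(\<Sum>j. (\<beta> - real j) * b j * (1 / m) ^ j) = \<beta> * ?P (1 / m) - ?Q" .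
  have inv: "((\<lambda>m. 1 / m) has_real_derivative (- (1 / m) / m)) (at m)"
    using m by (auto intro!: derivative_eq_intros simp: power2_eq_square)
  have "((\<lambda>m. ?P (1 / m)) has_real_derivative (?Q / (1 / m)) * (- (1 / m) / m)) (at m)"
    by (rule DERIV_chain2[OF D(1) inv])
  then have 1: "((\<lambda>m. ?P (1 / m)) has_real_derivative - ?Q / m) (at m)"
    using m by simp
  have 2: "((\<lambda>m. m powr \<beta>) has_real_derivative \<beta> * m powr (\<beta> - 1)) (at m)"
    using m by (intro has_real_derivative_powr) auto
  have "m powr \<beta> = m powr (\<beta> - 1) * m" using m by (simp add: powr_diff)
  then have "\<beta> * m powr (\<beta> - 1) * ?P (1 / m) + (- ?Q / m) * m powr \<beta>
      = m powr (\<beta> - 1) * (\<Sum>j. (\<beta> - real j) * b j * (1 / m) ^ j)"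
    unfolding eq using m by (simp add: field_simps)
  with DERIV_mult[OF 2 1] show ?thesis by simp
qed

lemma powr_mult_powser_inverse_continuous:
  fixes b :: "nat \<Rightarrow> real" and \<beta> :: real
  assumes b: "summable (\<lambda>j. \<bar>b j\<bar>)"
  shows "continuous_on {1..} (\<lambda>m. m powr \<beta> * (\<Sum>j. b j * (1 / m) ^ j))"
proof -
  have "continuous_on {1..} (\<lambda>m. \<Sum>j. b j * (1 / m) ^ j)"
    by (rule continuous_on_compose2[OF powser_continuous_unit[OF b]])
       (auto intro!: continuous_intros)
  then show ?thesis by (intro continuous_intros) auto
qed

text \<open>Absolutely convergent double series may be summed by rows or by antidiagonals.\<close>

lemma double_series_sums:
  fixes F :: "nat \<Rightarrow> nat \<Rightarrow> real"
  assumes u: "summable (\<lambda>l. \<bar>u l\<bar>)" and v: "summable (\<lambda>j. \<bar>v j\<bar>)" and F: "\<And>l j. \<bar>F l j\<bar> \<le> u l * v j"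
  shows "\<And>l. summable (\<lambda>j. \<bar>F l j\<bar>)"
    and "summable (\<lambda>n. \<bar>\<Sum>l\<le>n. F l (n - l)\<bar>)"
    and "(\<lambda>l. \<Sum>j. F l j) sums (\<Sum>n. \<Sum>l\<le>n. F l (n - l))"
proof -
  have abs_uv: "\<bar>F l j\<bar> \<le> \<bar>u l\<bar> * \<bar>v j\<bar>" for l j
    using F[of l j] by (metis abs_ge_self abs_mult order_trans)
  have u': "((\<lambda>l. \<bar>u l\<bar>) has_sum (\<Sum>l. \<bar>u l\<bar>)) UNIV" and v': "((\<lambda>j. \<bar>v j\<bar>) has_sum (\<Sum>j. \<bar>v j\<bar>)) UNIV"
    using u v by (auto intro!: norm_summable_imp_has_sum summable_sums)
  have "(\<lambda>(l, j). \<bar>u l\<bar> * \<bar>v j\<bar>) summable_on UNIV \<times> UNIV"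
  proof (rule summable_on_SigmaI)
    show "((\<lambda>j. case (l, j) of (l, j) \<Rightarrow> \<bar>u l\<bar> * \<bar>v j\<bar>) has_sum (\<bar>u l\<bar> * (\<Sum>j. \<bar>v j\<bar>))) UNIV" for l
      using has_sum_cmult_right[OF v'] by simp
    show "(\<lambda>l. \<bar>u l\<bar> * (\<Sum>j. \<bar>v j\<bar>)) summable_on UNIV"
      using has_sum_cmult_left[OF u'] by (rule has_sum_imp_summable)
  qed auto
  then have abs: "(\<lambda>z. norm (case_prod F z)) summable_on UNIV \<times> UNIV"
    by (rule Infinite_Sum.abs_summable_on_comparison_test') (use abs_uv in auto)
  then obtain S where S: "(case_prod F has_sum S) (UNIV \<times> UNIV)"
    using abs_summable_summable summable_on_def by blast
  show row: "summable (\<lambda>j. \<bar>F l j\<bar>)" for l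
    by (rule summable_comparison_test'[OF summable_mult[OF v, of "\<bar>u l\<bar>"]]) (use abs_uv in auto)
  have "((\<lambda>l. \<Sum>j. F l j) has_sum S) UNIV"
    by (rule has_sum_SigmaD[OF S])
       (use row in \<open>auto intro!: norm_summable_imp_has_sum summable_sums intro: summable_rabs_cancel\<close>)
  then have rows: "(\<lambda>l. \<Sum>j. F l j) sums S" by (rule has_sum_imp_sums)
  have reindex: "(G has_sum T) (UNIV \<times> UNIV) \<longleftrightarrow>
      ((\<lambda>(n, l). G (l, n - l)) has_sum T) (SIGMA n:UNIV. {..n})" for G :: "nat \<times> nat \<Rightarrow> real" and T
    by (rule has_sum_reindex_bij_witness
        [where i = "\<lambda>(n, l). (l, n - l)" and j = "\<lambda>(l, j). (l + j, l)"]) auto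
  have "((\<lambda>n. \<Sum>l\<le>n. F l (n - l)) has_sum S) UNIV"
    by (rule has_sum_SigmaD[OF S[unfolded reindex]]) (auto intro!: has_sum_finiteI)
  then have "(\<lambda>n. \<Sum>l\<le>n. F l (n - l)) sums S" by (rule has_sum_imp_sums)
  with rows show "(\<lambda>l. \<Sum>j. F l j) sums (\<Sum>n. \<Sum>l\<le>n. F l (n - l))"
    by (simp add: sums_iff)
  obtain T where "((\<lambda>z. norm (case_prod F z)) has_sum T) (UNIV \<times> UNIV)"
    using abs summable_on_def by blast
  then have "((\<lambda>n. \<Sum>l\<le>n. \<bar>F l (n - l)\<bar>) has_sum T) UNIV"
    unfolding reindex by (rule has_sum_SigmaD) (auto intro!: has_sum_finiteI)
  then have "summable (\<lambda>n. \<Sum>l\<le>n. \<bar>F l (n - l)\<bar>)"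
    using has_sum_imp_sums sums_summable by blast
  then show "summable (\<lambda>n. \<bar>\<Sum>l\<le>n. F l (n - l)\<bar>)"
    by (rule summable_comparison_test') auto
qed

section \<open>The even part of the two-point function\<close>

text \<open>Put \<open>c\<^sub>i = (s gchoose i)\<close>. The part of even degree of \<open>|1 + b|\<^bsup>2s\<^esup>\<close> is the sum of
  \<open>c\<^sub>i c\<^sub>j b\<^sup>i (cnj b)\<^sup>j\<close> over the pairs with \<open>i + j\<close> even. These are indexed by \<open>l = |i - j| / 2\<close> and
  \<open>j = min i j\<close>. The pairs \<open>(i, j)\<close> and \<open>(j, i)\<close> contribute conjugate terms, so every \<open>l > 0\<close> occurs twice.\<close>

definition fold_weight :: "nat \<Rightarrow> real" where
  "fold_weight l = (if l = 0 then 1 else 2)"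

definition gbin_diag :: "real \<Rightarrow> nat \<Rightarrow> nat \<Rightarrow> real" where
  "gbin_diag s l j = (s gchoose j) * (s gchoose (j + 2 * l))"

lemma sum_symmetric_fold:
  fixes h :: "nat \<Rightarrow> real"
  assumes "\<And>l. l \<le> n \<Longrightarrow> h (n - l) = h (n + l)"
  shows "(\<Sum>i\<le>2 * n. h i) = (\<Sum>l\<le>n. fold_weight l * h (n + l))"
proof -
  have w: "fold_weight l * h (n + l) = 2 * h (n + l) - (if l = 0 then h n else 0)" for l
    by (simp add: fold_weight_def)
  have "(\<Sum>l\<le>n. fold_weight l * h (n + l)) = 2 * (\<Sum>l\<le>n. h (n + l)) - h n"
    by (simp add: w sum_subtractf sum_distrib_left)
  moreover have "(\<Sum>l\<le>n. h (n + l)) = (\<Sum>i\<in>{n..2 * n}. h i)"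
    by (rule sum.reindex_bij_witness[of _ "\<lambda>i. i - n" "\<lambda>l. n + l"]) auto
  moreover have "(\<Sum>l\<le>n. h (n + l)) = (\<Sum>l\<le>n. h (n - l))" using assms by simp
  moreover have "(\<Sum>l\<le>n. h (n - l)) = (\<Sum>i\<le>n. h i)"
    by (rule sum.reindex_bij_witness[of _ "\<lambda>i. n - i" "\<lambda>i. n - i"]) auto
  moreover have "(\<Sum>i\<le>2 * n. h i) = (\<Sum>i\<in>{..<n}. h i) + (\<Sum>i\<in>{n..2 * n}. h i)"
    by (subst sum.union_disjoint[symmetric]) (auto intro!: sum.cong)
  moreover have "(\<Sum>i\<le>n. h i) = (\<Sum>i<n. h i) + h n"
    by (simp add: lessThan_Suc_atMost[symmetric])
  ultimately show ?thesis by linarith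
qed

lemma gbin_diag_antidiagonal:
  assumes "l \<le> n"
  shows "gbin_diag s l (n - l) = (s gchoose (n - l)) * (s gchoose (n + l))"
  using assms by (simp add: gbin_diag_def algebra_simps)

text \<open>Vandermonde's convolution on the antidiagonal \<open>i + j = 2n\<close>, folded at its midpoint.\<close>

lemma sum_gbin_diag:
  "(\<Sum>l\<le>n. fold_weight l * gbin_diag s l (n - l)) = (2 * s gchoose (2 * n))"
proof -
  define h where "h i = (s gchoose i) * (s gchoose (2 * n - i))" for i
  have "h (n - l) = h (n + l)" if "l \<le> n" for l
  proof -
    have "2 * n - (n - l) = n + l" "2 * n - (n + l) = n - l" using that by auto
    then show ?thesis by (simp add: h_def)
  qed
  from sum_symmetric_fold[of n h, OF this]
  have "(\<Sum>i\<le>2 * n. h i) = (\<Sum>l\<le>n. fold_weight l * gbin_diag s l (n - l))"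
    by (auto intro!: sum.cong simp: h_def gbin_diag_antidiagonal algebra_simps)
  then show ?thesis
    using gbinomial_Vandermonde[of s s "2 * n"] by (simp add: h_def atLeast0AtMost)
qed

text \<open>By absorption, \<open>(i - j) c\<^sub>i c\<^sub>j\<close> is a difference of two neighbouring products of binomial
  coefficients of \<open>s - 1\<close>, so its sum over half an antidiagonal telescopes to a single product.\<close>

lemma gbinomial_antisymmetric_step:
  fixes s :: real
  assumes "0 < i"
  shows "(real i - real j) * ((s gchoose j) * (s gchoose i))
     = s * ((s - 1 gchoose (i - 1)) * (s - 1 gchoose j)
        - (if j = 0 then 0 else (s - 1 gchoose (j - 1)) * (s - 1 gchoose i)))"
proof -
  have ab: "real k * (s gchoose k) = s * (s - 1 gchoose (k - 1))" if "0 < k" for k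
    using gbinomial_absorption[of "k - 1" s] that by simp
  have ad: "(s gchoose k) = (s - 1 gchoose k) + (s - 1 gchoose (k - 1))" if "0 < k" for k
    using gbinomial_addition_formula[of s "k - 1"] that by simp
  show ?thesis
  proof (cases "j = 0")
    case True
    then show ?thesis using ab[OF assms] by simp
  next
    case False
    then have j: "0 < j" by simp
    have "(real i - real j) * ((s gchoose j) * (s gchoose i))
      = (real i * (s gchoose i)) * (s gchoose j) - (real j * (s gchoose j)) * (s gchoose i)"
      by (simp add: algebra_simps)
    also have "\<dots> = s * (s - 1 gchoose (i - 1)) * (s gchoose j) - s * (s - 1 gchoose (j - 1)) * (s gchoose i)"
      by (simp only: ab[OF assms] ab[OF j])
    finally show ?thesis using j by (simp add: ad[OF assms] ad[OF j] algebra_simps)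
  qed
qed

lemma sum_index_gbin_diag:
  "(\<Sum>l\<le>Suc n. fold_weight l * real l * gbin_diag s l (Suc n - l))
     = s * (s - 1 gchoose Suc n) * (s - 1 gchoose n)"
proof -
  define N where "N = Suc n"
  define \<tau> where "\<tau> l = (if l \<le> N then (s - 1 gchoose (N + l - 1)) * (s - 1 gchoose (N - l)) else 0)" for l
  have step: "fold_weight (Suc l) * real (Suc l) * gbin_diag s (Suc l) (N - Suc l)
      = s * (\<tau> (Suc l) - \<tau> (Suc (Suc l)))" if "l < N" for l
  proof -
    have e: "gbin_diag s (Suc l) (N - Suc l) = (s gchoose (N - Suc l)) * (s gchoose (N + Suc l))"
      using that by (intro gbin_diag_antidiagonal) simp
    have f: "fold_weight (Suc l) * real (Suc l) = real (N + Suc l) - real (N - Suc l)"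
      using that by (simp add: fold_weight_def of_nat_diff)
    have "fold_weight (Suc l) * real (Suc l) * gbin_diag s (Suc l) (N - Suc l)
       = (real (N + Suc l) - real (N - Suc l)) * ((s gchoose (N - Suc l)) * (s gchoose (N + Suc l)))"
      by (simp only: e f)
    also have "\<dots> = s * (\<tau> (Suc l) - \<tau> (Suc (Suc l)))"
      by (subst gbinomial_antisymmetric_step) (use that in \<open>auto simp: \<tau>_def mult.commute Suc_diff_Suc\<close>)
    finally show ?thesis .
  qed
  have "(\<Sum>l\<le>N. fold_weight l * real l * gbin_diag s l (N - l))
      = (\<Sum>l<N. fold_weight (Suc l) * real (Suc l) * gbin_diag s (Suc l) (N - Suc l))"
    using sum.lessThan_Suc_shift[of "\<lambda>l. fold_weight l * real l * gbin_diag s l (N - l)" N]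
    by (simp only: lessThan_Suc_atMost)
  also have "\<dots> = s * (\<Sum>l<N. \<tau> (Suc l) - \<tau> (Suc (Suc l)))"
    unfolding sum_distrib_left by (intro sum.cong refl step) simp
  also have "(\<Sum>l<N. \<tau> (Suc l) - \<tau> (Suc (Suc l))) = \<tau> (Suc 0) - \<tau> (Suc N)"
    by (rule sum_lessThan_telescope')
  finally show ?thesis by (simp add: N_def \<tau>_def)
qed

text \<open>Both sides of the first inequality are hypergeometric in \<open>n\<close> and agree at \<open>n = 0\<close>, where they are positive. In the step from
  \<open>n\<close> to \<open>n + 1\<close> the left side is multiplied by \<open>\<eta>\<close> and the right side by \<open>\<rho>\<close>. In the first step
  \<open>\<eta> \<le> \<rho>\<close> and \<open>\<eta> \<le> 0\<close>. Later \<open>0 \<le> \<rho> \<le> \<eta>\<close>, but by then the left side is nonpositive, so the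
  inequality persists.\<close>

lemma gbinomial_product_le:
  fixes s :: real
  assumes s: "1 < s" "s < 3 / 2"
  shows "(2 * s - 1) / (s - 1) * s * (s - 1 gchoose Suc n) * (s - 1 gchoose n)
      \<le> real (Suc n) * (2 * s gchoose (2 * Suc n))
    \<and> (0 < n \<longrightarrow> (s - 1 gchoose Suc n) * (s - 1 gchoose n) \<le> 0)"
proof (induction n)
  case 0
  have e: "2 * s gchoose 2 = s * (2 * s - 1)"
    using gbinomial_Suc_factor[of "2 * s" 1] by (simp add: numeral_2_eq_2 field_simps)
  have "(2 * s - 1) / (s - 1) * s * (s - 1) = s * (2 * s - 1)"
    using s by (simp add: field_simps)
  then show ?case using e by simp
next
  case (Suc n)
  define X where "X n = real (Suc n) * (2 * s gchoose (2 * Suc n))" for n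
  define P where "P n = (s - 1 gchoose Suc n) * (s - 1 gchoose n)" for n
  define K where "K = (2 * s - 1) / (s - 1) * s"
  define \<rho> where "\<rho> = (real n + 1 - s) * (2 * real n + 3 - 2 * s) / ((real n + 1) * (2 * real n + 3))"
  define \<eta> where "\<eta> = (real n + 1 - s) * (real n + 2 - s) / ((real n + 1) * (real n + 2))"
  have K: "0 \<le> K" using s by (simp add: K_def)
  have X2: "2 * s gchoose (2 * Suc (Suc n)) = (2 * s gchoose (2 * Suc n)) * (2 * s - real (2 * Suc n))
      / real (Suc (2 * Suc n)) * (2 * s - real (Suc (2 * Suc n))) / real (Suc (Suc (2 * Suc n)))"
    using gbinomial_Suc_factor[of "2 * s" "Suc (2 * Suc n)"] gbinomial_Suc_factor[of "2 * s" "2 * Suc n"]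
    by simp
  have X: "X (Suc n) = \<rho> * X n"
    unfolding X_def \<rho>_def X2
    by (simp add: divide_simps del: mult_Suc_right) (simp add: algebra_simps)
  have P: "P (Suc n) = \<eta> * P n"
    unfolding P_def \<eta>_def by (simp add: gbinomial_Suc_factor divide_simps) (simp add: algebra_simps)
  have diff: "\<eta> - \<rho> = (real n + 1 - s) * (s / ((real n + 1) * (real n + 2) * (2 * real n + 3)))"
    unfolding \<eta>_def \<rho>_def by (simp add: divide_simps) (simp add: algebra_simps)
  have IH: "K * P n \<le> X n" "0 < n \<Longrightarrow> P n \<le> 0"
    using Suc unfolding K_def P_def X_def by (auto simp: mult.assoc)
  have "K * P (Suc n) \<le> X (Suc n) \<and> P (Suc n) \<le> 0"
  proof (cases "n = 0")
    case True
    have "P 0 = s - 1" by (simp add: P_def)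
    moreover have "K * P 0 = X 0"
    proof -
      have "2 * s gchoose 2 = s * (2 * s - 1)"
        using gbinomial_Suc_factor[of "2 * s" 1] by (simp add: numeral_2_eq_2 field_simps)
      then show ?thesis using s by (simp add: K_def P_def X_def)
    qed
    moreover have "\<eta> \<le> \<rho>"
    proof -
      have "(1 - s) * (s / 6) \<le> 0" using s by (intro mult_nonpos_nonneg) auto
      then show ?thesis using diff True by simp
    qed
    moreover have "\<eta> \<le> 0" using s True by (simp add: \<eta>_def mult_nonpos_nonneg)
    moreover have "\<eta> * (s - 1) \<le> 0" "0 \<le> K * (s - 1)"
      using K s \<open>\<eta> \<le> 0\<close> by (simp_all add: mult_nonpos_nonneg)
    ultimately have "P 1 \<le> 0" "K * P 1 = \<eta> * X 0" "X 1 = \<rho> * X 0" "\<eta> * X 0 \<le> \<rho> * X 0"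
      using X P True by (simp_all add: mult_right_mono)
    then show ?thesis using True by simp
  next
    case False
    then have n: "s \<le> real n + 1" using s by linarith
    have "0 \<le> \<rho>" using n s by (auto simp: \<rho>_def intro!: divide_nonneg_nonneg mult_nonneg_nonneg)
    moreover have "\<rho> \<le> \<eta>" using diff n s by (smt (verit) divide_nonneg_nonneg mult_nonneg_nonneg of_nat_0_le_iff)
    moreover have P0: "P n \<le> 0" using IH False by simp
    ultimately have "\<eta> * (K * P n) \<le> \<rho> * (K * P n)" "\<rho> * (K * P n) \<le> \<rho> * X n" "\<eta> * P n \<le> 0"
      using K IH(1) by (auto intro!: mult_right_mono_neg mult_left_mono mult_nonneg_nonpos)
    then show ?thesis by (simp add: X P mult_ac)
  qed
  then show ?case unfolding K_def P_def X_def by (simp add: mult_ac)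
qed

lemma sums_even_part:
  fixes t :: "nat \<Rightarrow> real"
  assumes "t sums S" "(\<lambda>k. (-1) ^ k * t k) sums S'"
  shows "(\<lambda>n. t (2 * n)) sums ((S + S') / 2)"
proof -
  have "(\<lambda>k. (t k + (-1) ^ k * t k) / 2) sums ((S + S') / 2)"
    by (intro sums_divide sums_add assms)
  moreover have "strict_mono (\<lambda>n::nat. 2 * n)" by (simp add: strict_mono_def)
  moreover have "(t k + (-1) ^ k * t k) / 2 = 0" if "k \<notin> range (\<lambda>n. 2 * n)" for k
    using that by (cases "even k") (auto elim!: evenE)
  ultimately have "(\<lambda>n. (t (2 * n) + (-1) ^ (2 * n) * t (2 * n)) / 2) sums ((S + S') / 2)"
    by (subst sums_mono_reindex)
  then show ?thesis by simp
qed

text \<open>The Cauchy product of the binomial series of \<open>(1 + b)\<^sup>s\<close> with its complex conjugate.\<close>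

lemma norm_powr_binomial_sums:
  fixes s :: real and b :: complex
  assumes s: "1 \<le> s" "s \<le> 2" and b: "norm b < 1"
  shows "(\<lambda>k. \<Sum>i\<le>k. (s gchoose i) * (s gchoose (k - i)) * Re (b ^ i * cnj b ^ (k - i)))
      sums (norm (1 + b) powr (2 * s))"
proof -
  define t where "t n = of_real (s gchoose n) * b ^ n" for n
  have of_real: "(of_real s gchoose n :: complex) = of_real (s gchoose n)" for n
    by (simp add: gbinomial_prod_rev)
  have t: "t sums (1 + b) powr of_real s"
    using gen_binomial_complex[OF b, of "of_real s"] by (simp add: t_def[abs_def] of_real)
  have sn: "summable (\<lambda>n. norm (t n))"
  proof (rule summable_comparison_test')
    show "summable (\<lambda>n. \<bar>s gchoose n\<bar>)" using summable_abs_gbinomial[OF s] .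
    show "norm (norm (t n)) \<le> \<bar>s gchoose n\<bar>" for n
      using b by (simp add: t_def norm_mult norm_power power_le_one mult_left_le)
  qed
  have ct: "(\<lambda>n. cnj (t n)) sums cnj ((1 + b) powr of_real s)"
    using t by (simp add: sums_cnj)
  have "(\<lambda>k. \<Sum>i\<le>k. t i * cnj (t (k - i))) sums ((\<Sum>n. t n) * (\<Sum>n. cnj (t n)))"
    by (rule Cauchy_product_sums) (use sn in simp_all)
  also have "(\<Sum>n. t n) * (\<Sum>n. cnj (t n)) = (1 + b) powr of_real s * cnj ((1 + b) powr of_real s)"
    using t ct by (simp add: sums_iff)
  also have "\<dots> = of_real ((norm ((1 + b) powr of_real s))\<^sup>2)"
    by (simp only: complex_norm_square)
  also have "norm ((1 + b) powr of_real s) = norm (1 + b) powr s"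
    by (simp add: norm_powr_real_powr')
  also have "(norm (1 + b) powr s)\<^sup>2 = norm (1 + b) powr (2 * s)"
    by (simp add: power2_eq_square powr_add[symmetric])
  finally have "(\<lambda>k. Re (\<Sum>i\<le>k. t i * cnj (t (k - i)))) sums (norm (1 + b) powr (2 * s))"
    using sums_Re by fastforce
  moreover have "Re (t i * cnj (t j)) = (s gchoose i) * (s gchoose j) * Re (b ^ i * cnj b ^ j)" for i j
  proof -
    have "t i * cnj (t j) = of_real ((s gchoose i) * (s gchoose j)) * (b ^ i * cnj b ^ j)"
      by (simp add: t_def mult_ac)
    then show ?thesis by (simp add: algebra_simps)
  qed
  ultimately show ?thesis by (simp add: Re_sum)
qed

definition two_point_mean :: "real \<Rightarrow> complex \<Rightarrow> real" where
  "two_point_mean s b = (norm (1 + b) powr (2 * s) + norm (1 - b) powr (2 * s)) / 2"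

text \<open>From index \<open>1\<close> on, \<open>|c\<^sub>i|\<close> decreases. Hence \<open>|c\<^sub>j\<^sub>+\<^sub>2\<^sub>l| \<le> |c\<^sub>2\<^sub>l|\<close> for \<open>l > 0\<close>, and the
  double sequence is dominated by a product of two summable sequences.\<close>

lemma gbin_diag_le:
  assumes "1 \<le> s" "s \<le> 2"
  shows "\<bar>gbin_diag s l j\<bar> \<le> (if l = 0 then 2 else \<bar>s gchoose (2 * l)\<bar>) * \<bar>s gchoose j\<bar>"
proof -
  have dec: "\<bar>s gchoose Suc i\<bar> \<le> \<bar>s gchoose i\<bar>" if "1 \<le> i" for i
  proof -
    have "\<bar>s - real i\<bar> \<le> real (Suc i)" using that assms by auto
    then have "\<bar>s gchoose i\<bar> * \<bar>s - real i\<bar> \<le> \<bar>s gchoose i\<bar> * real (Suc i)"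
      by (rule mult_left_mono) simp
    then have "\<bar>s gchoose i\<bar> * \<bar>s - real i\<bar> / real (Suc i) \<le> \<bar>s gchoose i\<bar>"
      by (simp add: divide_le_eq)
    then show ?thesis by (simp add: gbinomial_Suc_factor abs_mult)
  qed
  have mono: "\<bar>s gchoose (i + j)\<bar> \<le> \<bar>s gchoose i\<bar>" if "1 \<le> i" for i j
    using that by (induction j) (auto intro: order_trans[OF dec])
  have "\<bar>s gchoose j\<bar> \<le> 2"
    using assms mono[of 1 "j - 1"] by (cases j) auto
  then show ?thesis
    using mono[of "2 * l" j] by (auto simp: gbin_diag_def abs_mult add.commute mult.commute mult_left_mono)
qed

lemma summable_even_gbinomial:
  assumes "1 \<le> s" "s \<le> (2::real)"
  shows "summable (\<lambda>l. \<bar>c * (if l = 0 then 2 else \<bar>s gchoose (2 * l)\<bar>)\<bar>)"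
proof -
  have "summable (\<lambda>l. \<bar>s gchoose (2 * l)\<bar>)"
  proof -
    have "inj (\<lambda>l::nat. 2 * l)" by (simp add: inj_on_def)
    from summable_reindex[OF summable_abs_gbinomial[OF assms] this] show ?thesis by (simp add: o_def)
  qed
  then have "summable (\<lambda>l. if l = 0 then 2 else \<bar>s gchoose (2 * l)\<bar>)"
    by (rule summable_cong[THEN iffD1, rotated]) (auto intro!: eventually_sequentiallyI[of 1])
  from summable_mult[OF this, of "\<bar>c\<bar>"] show ?thesis by (simp add: abs_mult)
qed

text \<open>All weighted sums over diagonals below have bounded weights, so they converge absolutely and may be
  regrouped by \<open>n = l + j\<close>, half the total degree.\<close>

lemma gbin_diag_double_series:
  fixes G :: "nat \<Rightarrow> nat \<Rightarrow> real"
  assumes s: "1 \<le> s" "s \<le> 2" and G: "\<And>l j. \<bar>G l j\<bar> \<le> C"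
  shows "summable (\<lambda>j. \<bar>gbin_diag s l j * G l j\<bar>)"
    and "summable (\<lambda>n. \<bar>\<Sum>l\<le>n. fold_weight l * (gbin_diag s l (n - l) * G l (n - l))\<bar>)"
    and "(\<lambda>l. fold_weight l * (\<Sum>j. gbin_diag s l j * G l j)) sums
      (\<Sum>n. \<Sum>l\<le>n. fold_weight l * (gbin_diag s l (n - l) * G l (n - l)))"
proof -
  let ?F = "\<lambda>l j. fold_weight l * (gbin_diag s l j * G l j)"
  let ?u = "\<lambda>l. 2 * C * (if l = 0 then 2 else \<bar>s gchoose (2 * l)\<bar>)"
  have C: "0 \<le> C" using G[of 0 0] by linarith
  have bound: "\<bar>?F l j\<bar> \<le> ?u l * \<bar>s gchoose j\<bar>" for l j
  proof -
    have "\<bar>?F l j\<bar> = fold_weight l * (\<bar>gbin_diag s l j\<bar> * \<bar>G l j\<bar>)"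
      by (simp add: abs_mult fold_weight_def)
    also have "\<dots> \<le> 2 * (((if l = 0 then 2 else \<bar>s gchoose (2 * l)\<bar>) * \<bar>s gchoose j\<bar>) * C)"
      by (rule mult_mono[OF _ mult_mono[OF gbin_diag_le[OF s] G]]) (auto simp: fold_weight_def)
    finally show ?thesis by (simp add: mult_ac)
  qed
  note D = double_series_sums[OF summable_even_gbinomial[OF s] _ bound]
  have v: "summable (\<lambda>j. \<bar>\<bar>s gchoose j\<bar>\<bar>)" using summable_abs_gbinomial[OF s] by simp
  show row: "summable (\<lambda>j. \<bar>gbin_diag s l j * G l j\<bar>)" for l
    using D(1)[OF v, of l] by (cases "l = 0") (simp_all add: fold_weight_def abs_mult)
  show "summable (\<lambda>n. \<bar>\<Sum>l\<le>n. fold_weight l * (gbin_diag s l (n - l) * G l (n - l))\<bar>)"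
    by (rule D(2)[OF v])
  have "(\<Sum>j. ?F l j) = fold_weight l * (\<Sum>j. gbin_diag s l j * G l j)" for l
    by (rule suminf_mult) (rule summable_rabs_cancel[OF row])
  then show "(\<lambda>l. fold_weight l * (\<Sum>j. gbin_diag s l j * G l j)) sums
      (\<Sum>n. \<Sum>l\<le>n. fold_weight l * (gbin_diag s l (n - l) * G l (n - l)))"
    using D(3)[OF v] by simp
qed

text \<open>Averaging the previous expansion over \<open>b\<close> and \<open>-b\<close> keeps the even degrees; each of them is then folded.\<close>

lemma two_point_mean_antidiagonal_sums:
  assumes s: "1 \<le> s" "s \<le> 2" and b: "norm b < 1"
  shows "(\<lambda>n. \<Sum>l\<le>n. fold_weight l * (gbin_diag s l (n - l) * ((norm b)\<^sup>2 ^ (n - l) * Re ((b\<^sup>2) ^ l))))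
    sums two_point_mean s b"
proof -
  define t where "t k = (\<Sum>i\<le>k. (s gchoose i) * (s gchoose (k - i)) * Re (b ^ i * cnj b ^ (k - i)))" for k
  have t: "t sums (norm (1 + b) powr (2 * s))"
    unfolding t_def using norm_powr_binomial_sums[OF s b] .
  have "(-1) ^ k * t k = (\<Sum>i\<le>k. (s gchoose i) * (s gchoose (k - i)) * Re ((- b) ^ i * cnj (- b) ^ (k - i)))" for k
  proof -
    have "Re ((- b) ^ i * cnj (- b) ^ (k - i)) = (-1) ^ k * Re (b ^ i * cnj b ^ (k - i))" if "i \<le> k" for i
    proof -
      have "(- b) ^ i * cnj (- b) ^ (k - i) = (-1) ^ (i + (k - i)) * (b ^ i * cnj b ^ (k - i))"
        unfolding power_add by (subst (1 2) power_minus) (simp add: mult_ac power_minus[of "cnj b"])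
      also have "\<dots> = of_real ((-1) ^ k) * (b ^ i * cnj b ^ (k - i))" using that by simp
      finally show ?thesis by simp
    qed
    then show ?thesis by (auto simp: t_def sum_distrib_left intro!: sum.cong)
  qed
  then have "(\<lambda>k. (-1) ^ k * t k) sums (norm (1 - b) powr (2 * s))"
    using norm_powr_binomial_sums[OF s, of "- b"] b by simp
  with t have "(\<lambda>n. t (2 * n)) sums two_point_mean s b"
    unfolding two_point_mean_def by (rule sums_even_part)
  moreover have "t (2 * n) = (\<Sum>l\<le>n. fold_weight l *
      (gbin_diag s l (n - l) * ((norm b)\<^sup>2 ^ (n - l) * Re ((b\<^sup>2) ^ l))))" for n
  proof -
    define h where "h i = (s gchoose i) * (s gchoose (2 * n - i)) * Re (b ^ i * cnj b ^ (2 * n - i))" for i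
    have "h (n - l) = h (n + l)" if "l \<le> n" for l
    proof -
      have e: "2 * n - (n - l) = n + l" "2 * n - (n + l) = n - l" using that by auto
      have "Re (b ^ (n - l) * cnj b ^ (n + l)) = Re (cnj (b ^ (n - l) * cnj b ^ (n + l)))" by (simp only: cnj.sel)
      also have "\<dots> = Re (b ^ (n + l) * cnj b ^ (n - l))" by (simp only: complex_cnj_mult complex_cnj_power complex_cnj_cnj mult.commute)
      finally show ?thesis by (simp add: h_def e)
    qed
    from sum_symmetric_fold[of n h, OF this]
    have "t (2 * n) = (\<Sum>l\<le>n. fold_weight l * h (n + l))" by (simp add: t_def h_def)
    moreover have "h (n + l) = gbin_diag s l (n - l) * ((norm b)\<^sup>2 ^ (n - l) * Re ((b\<^sup>2) ^ l))" if "l \<le> n" for l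
    proof -
      have "b ^ (n + l) * cnj b ^ (n - l) = (b * cnj b) ^ (n - l) * (b\<^sup>2) ^ l"
      proof -
        have "b ^ (n + l) = b ^ (n - l) * (b\<^sup>2) ^ l"
          using that by (simp add: power_mult[symmetric] power_add[symmetric] add.commute)
        then show ?thesis by (simp add: power_mult_distrib mult_ac)
      qed
      also have "\<dots> = of_real ((norm b)\<^sup>2 ^ (n - l)) * (b\<^sup>2) ^ l"
        by (simp only: complex_norm_square[symmetric] of_real_power)
      finally have "Re (b ^ (n + l) * cnj b ^ (n - l)) = (norm b)\<^sup>2 ^ (n - l) * Re ((b\<^sup>2) ^ l)"
        by simp
      moreover have "2 * n - (n + l) = n - l" using that by simp
      ultimately show ?thesis using that by (simp add: h_def gbin_diag_antidiagonal)
    qed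
    ultimately show ?thesis by (auto intro!: sum.cong)
  qed
  ultimately show ?thesis by simp
qed

section \<open>Monotonicity on the cone\<close>

text \<open>Pascal's rule writes the first and second differences of the alternating sequence as binomial
  coefficients of \<open>r + 1\<close> and \<open>r + 2\<close>, whose signs are known beyond the index \<open>i > k\<close>.\<close>

lemma gbinomial_tail_convex:
  fixes r :: real and i k :: nat
  defines "g \<equiv> \<lambda>j. (-1) ^ (j + i + k + 1) * (r gchoose (j + i))"
  assumes r: "real k \<le> r" "r \<le> real k + 1" and i: "k < i"
  shows "0 \<le> g j" and "g (Suc j) \<le> g j" and "g (Suc j) - g (Suc (Suc j)) \<le> g j - g (Suc j)"
proof -
  have p: "(r + 1 gchoose Suc m) = (r gchoose m) + (r gchoose Suc m)" for m and r :: real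
    by (rule gbinomial_Suc_Suc)
  show "0 \<le> g j" for j
    unfolding g_def using gbinomial_sign[OF r, of "j + i"] i by simp
  have d1: "g j - g (Suc j) = (-1) ^ (j + i + k + 1) * (r + 1 gchoose (Suc (j + i)))" for j
    unfolding p g_def by (simp add: algebra_simps)
  show "g (Suc j) \<le> g j" for j
    using gbinomial_sign[of "Suc k" "r + 1" "Suc (j + i)"] r i d1[of j] by simp
  have "(g j - g (Suc j)) - (g (Suc j) - g (Suc (Suc j)))
      = (-1) ^ (j + i + k + 1) * (r + 1 + 1 gchoose (Suc (Suc (j + i))))"
    unfolding p[of "r + 1"] d1 by (simp add: algebra_simps)
  moreover have "0 \<le> (-1) ^ (j + i + k + 1) * (r + 1 + 1 gchoose (Suc (Suc (j + i))))"
    using gbinomial_sign[of "Suc (Suc k)" "r + 1 + 1" "Suc (Suc (j + i))"] r i by simp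
  ultimately show "g (Suc j) - g (Suc (Suc j)) \<le> g j - g (Suc j)" by linarith
qed

lemma minus_one_power_square: "(-1 :: real) ^ j * ((-1) ^ j * y) = y"
  by (simp add: mult.assoc[symmetric] power_add[symmetric] flip: mult_2)

text \<open>For \<open>l > 0\<close> the coefficient functions \<open>A(m) = \<Sum>\<^sub>j c\<^sub>j c\<^sub>j\<^sub>+\<^sub>2\<^sub>l m\<^sup>j\<close> on \<open>[0, 1]\<close> and
  \<open>A(m) = \<Sum>\<^sub>j c\<^sub>j c\<^sub>j\<^sub>+\<^sub>2\<^sub>l m\<^bsup>s-2l-j\<^esup>\<close> on \<open>[1, \<infinity>)\<close> are nonnegative and decreasing; this is the content of
  the next three lemmas. Neither fact is visible from the individual terms, since \<open>c\<^sub>1 c\<^sub>1\<^sub>+\<^sub>2\<^sub>l < 0\<close>.\<close>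

lemma gbin_diag_series_nonneg:
  assumes s: "1 \<le> s" "s \<le> 2" and l: "0 < l" and x: "0 \<le> x" "x \<le> 1"
  shows "0 \<le> (\<Sum>j. gbin_diag s l j * x ^ j)"
proof -
  define g where "g j = (-1) ^ (j + 2 * l + 1 + 1) * (s gchoose (j + 2 * l))" for j
  have g: "0 \<le> g j" "g (Suc j) \<le> g j" "g (Suc j) - g (Suc (Suc j)) \<le> g j - g (Suc j)" for j
    unfolding g_def using gbinomial_tail_convex[of 1 s "2 * l" j] s l by auto
  have "gbin_diag s l j = (s gchoose j) * (-1) ^ j * g j" for j
    by (simp add: gbin_diag_def g_def power_add minus_one_power_square)
  then show ?thesis using gbinomial_sum_convex_nonneg(2)[OF s, of g x] g x by simp
qed

text \<open>Absorption turns \<open>j c\<^sub>j\<close> into a multiple of \<open>(s - 1 gchoose (j - 1))\<close>, an exponent in the unit interval.\<close>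

lemma gbin_diag_derivative_series_nonpos:
  assumes s: "1 \<le> s" "s \<le> 2" and l: "0 < l" and x: "0 \<le> x" "x \<le> 1"
    and sm: "summable (\<lambda>j. real j * gbin_diag s l j * x ^ j)"
  shows "(\<Sum>j. real j * gbin_diag s l j * x ^ j) \<le> 0"
proof -
  define g where "g j = (-1) ^ (j + (2 * l + 1) + 1 + 1) * (s gchoose (j + (2 * l + 1)))" for j
  have g: "0 \<le> g j" "g (Suc j) \<le> g j" for j
    unfolding g_def using gbinomial_tail_convex[of 1 s "2 * l + 1" j] s l by auto
  have a: "0 \<le> s - 1" "s - 1 \<le> 1" using s by auto
  let ?t = "\<lambda>j. (s - 1 gchoose j) * (-1) ^ j * g j * x ^ j"
  note K = gbinomial_sum_decreasing_nonneg[where g = g, OF a g x]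
  have "real (Suc j) * gbin_diag s l (Suc j) * x ^ Suc j = (- s * x) * ?t j" for j
  proof -
    have "real (Suc j) * (s gchoose Suc j) = s * (s - 1 gchoose j)"
      by (rule gbinomial_absorption)
    then have "real (Suc j) * gbin_diag s l (Suc j) = s * (s - 1 gchoose j) * (s gchoose (j + (2 * l + 1)))"
      by (simp add: gbin_diag_def mult.assoc[symmetric])
    moreover have "(s gchoose (j + (2 * l + 1))) = - ((-1) ^ j * g j)"
      by (simp add: g_def power_add minus_one_power_square)
    ultimately show ?thesis by (simp add: algebra_simps)
  qed
  then have "(\<lambda>j. real (Suc j) * gbin_diag s l (Suc j) * x ^ Suc j) sums ((- s * x) * suminf ?t)"
    by (simp only:) (intro sums_mult summable_sums K)
  then have "(\<lambda>j. real j * gbin_diag s l j * x ^ j) sums ((- s * x) * suminf ?t)"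
    using sums_Suc_iff[of "\<lambda>j. real j * gbin_diag s l j * x ^ j"] by simp
  then have "(\<Sum>j. real j * gbin_diag s l j * x ^ j) = - (s * x * suminf ?t)"
    by (simp add: sums_iff)
  then show ?thesis using s x K(2) by simp
qed

text \<open>Here absorption acts on the other factor: \<open>(s - i) c\<^sub>i = s (s - 1 gchoose i)\<close> with \<open>i = j + 2l\<close>.\<close>

lemma gbin_diag_reciprocal_series_nonpos:
  assumes s: "1 \<le> s" "s \<le> 2" and l: "0 < l" and x: "0 \<le> x" "x \<le> 1"
  shows "(\<Sum>j. (s - 2 * real l - real j) * gbin_diag s l j * x ^ j) \<le> 0"
proof -
  define g where "g j = (-1) ^ (j + 2 * l + 0 + 1) * (s - 1 gchoose (j + 2 * l))" for j
  have g: "0 \<le> g j" "g (Suc j) \<le> g j" "g (Suc j) - g (Suc (Suc j)) \<le> g j - g (Suc j)" for j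
    unfolding g_def using gbinomial_tail_convex[of 0 "s - 1" "2 * l" j] s l by auto
  let ?t = "\<lambda>j. (s gchoose j) * (-1) ^ j * g j * x ^ j"
  have "(s - 2 * real l - real j) * gbin_diag s l j * x ^ j = - s * ?t j" for j
  proof -
    have "(s - real (j + 2 * l)) * (s gchoose (j + 2 * l)) = s * (s - 1 gchoose (j + 2 * l))"
      by (rule gbinomial_absorb_comp)
    moreover have "(s - 1 gchoose (j + 2 * l)) = - ((-1) ^ j * g j)"
      by (simp add: g_def power_add minus_one_power_square)
    ultimately have "(s - 2 * real l - real j) * (s gchoose (j + 2 * l)) = - s * ((-1) ^ j * g j)"
      by (simp add: algebra_simps)
    then have "(s gchoose j) * x ^ j * ((s - 2 * real l - real j) * (s gchoose (j + 2 * l)))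
        = (s gchoose j) * x ^ j * (- s * ((-1) ^ j * g j))" by (simp only:)
    then show ?thesis by (simp add: gbin_diag_def mult_ac)
  qed
  then have "(\<Sum>j. (s - 2 * real l - real j) * gbin_diag s l j * x ^ j) = - s * suminf ?t"
    by (simp only:) (rule suminf_mult[OF gbinomial_sum_convex_nonneg(1)[OF s, of g x]], use g x in auto)
  then show ?thesis using gbinomial_sum_convex_nonneg(2)[OF s, of g x] g x s by simp
qed

text \<open>Move from \<open>(m1, B1)\<close> to \<open>(m2, B2)\<close> along a segment, so that \<open>B\<close> moves at most \<open>\<kappa>\<close> times as fast as \<open>m\<close>.
  Because \<open>A' \<le> 0 \<le> A\<close> and \<open>|B| \<le> m\<close>, the derivative of \<open>A(m) Re(B\<^sup>l)\<close> is smallest when \<open>B = m\<close> and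
  \<open>B\<close> moves against \<open>m\<close> at full speed. The right-hand side in the hypothesis on \<open>\<psi>\<close> is this smallest value.\<close>

lemma cone_increment_le:
  fixes A A' \<psi> :: "real \<Rightarrow> real" and B1 B2 :: complex
  assumes m: "m1 \<le> m2" and \<kappa>: "0 \<le> \<kappa>"
    and B: "norm B1 \<le> m1" "norm B2 \<le> m2" "norm (B2 - B1) \<le> \<kappa> * (m2 - m1)"
    and cont: "continuous_on {m1..m2} A" "continuous_on {m1..m2} \<psi>"
    and A: "\<And>m. m1 < m \<Longrightarrow> m < m2 \<Longrightarrow> (A has_real_derivative A' m) (at m)"
      "\<And>m. m1 < m \<Longrightarrow> m < m2 \<Longrightarrow> 0 \<le> A m" "\<And>m. m1 < m \<Longrightarrow> m < m2 \<Longrightarrow> A' m \<le> 0"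
    and \<psi>: "\<And>m. m1 < m \<Longrightarrow> m < m2 \<Longrightarrow>
      (\<psi> has_real_derivative A' m * m ^ l - \<kappa> * real l * A m * m ^ (l - 1)) (at m)"
  shows "\<psi> m2 - \<psi> m1 \<le> A m2 * Re (B2 ^ l) - A m1 * Re (B1 ^ l)"
proof (cases "m1 = m2")
  case True
  then show ?thesis using B by simp
next
  case False
  then have lt: "m1 < m2" using m by simp
  define \<mu> where "\<mu> t = m1 + t * (m2 - m1)" for t
  define \<beta> where "\<beta> t = B1 + of_real t * (B2 - B1)" for t
  define D where "D t = A (\<mu> t) * Re (\<beta> t ^ l) - \<psi> (\<mu> t)" for t
  have \<mu>r: "m1 \<le> \<mu> t \<and> \<mu> t \<le> m2" if "0 \<le> t" "t \<le> 1" for t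
  proof -
    have "t * (m2 - m1) \<le> 1 * (m2 - m1)" using that lt by (intro mult_right_mono) auto
    then have "\<mu> t \<le> m2" unfolding \<mu>_def by (simp add: algebra_simps)
    then show ?thesis using that lt by (simp add: \<mu>_def)
  qed
  have "D 0 \<le> D 1"
  proof (rule DERIV_nonneg_imp_increasing_open[of 0 1 D])
    have c\<mu>: "continuous_on {0..1} \<mu>" unfolding \<mu>_def by (intro continuous_intros)
    have "\<mu> ` {0..1} \<subseteq> {m1..m2}" using \<mu>r by auto
    then have cA: "continuous_on {0..1} (\<lambda>t. A (\<mu> t))" and c\<psi>: "continuous_on {0..1} (\<lambda>t. \<psi> (\<mu> t))"
      using continuous_on_compose2[OF cont(1) c\<mu>] continuous_on_compose2[OF cont(2) c\<mu>] by blast+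
    have cR: "continuous_on {0..1} (\<lambda>t. Re (\<beta> t ^ l))"
      unfolding \<beta>_def by (intro continuous_intros)
    show "continuous_on {0..1} D"
      unfolding D_def by (rule continuous_on_diff[OF continuous_on_mult[OF cA cR] c\<psi>])
  next
    fix t :: real assume t: "0 < t" "t < 1"
    have "t * (m2 - m1) < 1 * (m2 - m1)" using t lt by (intro mult_strict_right_mono) auto
    then have mt: "m1 < \<mu> t" "\<mu> t < m2"
      using t lt unfolding \<mu>_def by (simp, simp add: algebra_simps)
    let ?m = "\<mu> t" and ?\<delta> = "m2 - m1"
    have d\<mu>: "(\<mu> has_real_derivative ?\<delta>) (at t)"
      unfolding \<mu>_def by (auto intro!: derivative_eq_intros)
    have d\<beta>: "(\<beta> has_vector_derivative (B2 - B1)) (at t)"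
      unfolding \<beta>_def by (auto intro!: derivative_eq_intros simp: has_vector_derivative_def scaleR_conv_of_real)
    have dp: "((\<lambda>t. \<beta> t ^ l) has_vector_derivative ((B2 - B1) * (of_nat l * \<beta> t ^ (l - 1)))) (at t)"
    proof -
      have "((\<lambda>z. z ^ l) has_field_derivative of_nat l * \<beta> t ^ (l - 1)) (at (\<beta> t))"
        by (auto intro!: derivative_eq_intros)
      from field_vector_diff_chain_at[OF d\<beta> this] show ?thesis by (simp add: o_def)
    qed
    have dR: "((\<lambda>t. Re (\<beta> t ^ l)) has_real_derivative Re ((B2 - B1) * (of_nat l * \<beta> t ^ (l - 1)))) (at t)"
      using bounded_linear.has_vector_derivative[OF bounded_linear_Re dp] by (simp add: has_real_derivative_iff_has_vector_derivative)
    have dA: "((\<lambda>t. A (\<mu> t)) has_real_derivative A' ?m * ?\<delta>) (at t)"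
      by (rule DERIV_chain2[OF A(1)[OF mt] d\<mu>])
    have d\<psi>: "((\<lambda>t. \<psi> (\<mu> t)) has_real_derivative
        (A' ?m * ?m ^ l - \<kappa> * real l * A ?m * ?m ^ (l - 1)) * ?\<delta>) (at t)"
      by (rule DERIV_chain2[OF \<psi>[OF mt] d\<mu>])
    let ?d = "A' ?m * ?\<delta> * Re (\<beta> t ^ l) + Re ((B2 - B1) * (of_nat l * \<beta> t ^ (l - 1))) * A ?m
      - (A' ?m * ?m ^ l - \<kappa> * real l * A ?m * ?m ^ (l - 1)) * ?\<delta>"
    have "(D has_real_derivative ?d) (at t)"
      unfolding D_def by (rule DERIV_diff[OF DERIV_mult[OF dA dR] d\<psi>])
    moreover have "0 \<le> ?d"
    proof -
      have "norm (\<beta> t) \<le> ?m"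
      proof -
        have "\<beta> t = of_real (1 - t) * B1 + of_real t * B2" by (simp add: \<beta>_def algebra_simps)
        then have "norm (\<beta> t) \<le> norm (of_real (1 - t) * B1) + norm (of_real t * B2)"
          by (simp only: norm_triangle_ineq)
        also have "\<dots> = (1 - t) * norm B1 + t * norm B2"
          using t by (simp add: norm_mult del: of_real_diff)
        also have "\<dots> \<le> (1 - t) * m1 + t * m2"
          using t B by (intro add_mono mult_left_mono) auto
        finally show ?thesis by (simp add: \<mu>_def algebra_simps)
      qed
      then have \<beta>l: "norm (\<beta> t ^ k) \<le> ?m ^ k" for k
        by (simp add: norm_power power_mono)
      have "Re (\<beta> t ^ l) \<le> ?m ^ l" using \<beta>l[of l] complex_Re_le_cmod order_trans by blast
      then have 1: "0 \<le> A' ?m * ?\<delta> * (Re (\<beta> t ^ l) - ?m ^ l)"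
        using A(3)[OF mt] lt by (intro mult_nonpos_nonpos) (auto simp: mult_nonpos_nonneg)
      have "\<bar>Re ((B2 - B1) * (of_nat l * \<beta> t ^ (l - 1)))\<bar>
          \<le> norm (B2 - B1) * (real l * norm (\<beta> t ^ (l - 1)))"
        by (rule order_trans[OF abs_Re_le_cmod]) (simp add: norm_mult)
      also have "\<dots> \<le> (\<kappa> * ?\<delta>) * (real l * ?m ^ (l - 1))"
        using B(3) \<beta>l \<kappa> lt by (intro mult_mono) auto
      finally have "0 \<le> Re ((B2 - B1) * (of_nat l * \<beta> t ^ (l - 1))) + (\<kappa> * ?\<delta>) * (real l * ?m ^ (l - 1))"
        by linarith
      then have 2: "0 \<le> A ?m * (Re ((B2 - B1) * (of_nat l * \<beta> t ^ (l - 1))) + (\<kappa> * ?\<delta>) * (real l * ?m ^ (l - 1)))"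
        using A(2)[OF mt] by (rule mult_nonneg_nonneg[rotated])
      define R where "R = Re ((B2 - B1) * (of_nat l * \<beta> t ^ (l - 1)))"
      show ?thesis using 1 2 unfolding R_def[symmetric] by (simp add: algebra_simps)
    qed
    ultimately show "\<exists>y. (D has_real_derivative y) (at t) \<and> 0 \<le> y" by blast
  qed simp
  then show ?thesis by (simp add: D_def \<mu>_def \<beta>_def)
qed

text \<open>The weights that turn the coefficients of \<open>A(m) = \<Sum>\<^sub>j c\<^sub>j c\<^sub>j\<^sub>+\<^sub>2\<^sub>l m\<^sup>j\<close> into those of the primitive
  \<open>\<psi>(m) = \<Sum>\<^sub>j (\<dots>) m\<^bsup>j+l\<^esup>\<close> of \<open>A'(m) m\<^sup>l - \<kappa> l A(m) m\<^bsup>l-1\<^esup>\<close>. For \<open>l = 0\<close> the primitive is \<open>A\<close> itself.\<close>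

definition low_weight :: "real \<Rightarrow> nat \<Rightarrow> nat \<Rightarrow> real" where
  "low_weight \<kappa> l j = (if l = 0 then 1 else (real j - \<kappa> * real l) / (real j + real l))"

text \<open>The same for \<open>A(m) = \<Sum>\<^sub>j c\<^sub>j c\<^sub>j\<^sub>+\<^sub>2\<^sub>l m\<^bsup>s-2l-j\<^esup>\<close>, with exponent \<open>s - j - l\<close> in the primitive. The
  denominator never vanishes because \<open>1 < s < 3/2\<close> is not an integer.\<close>

definition high_weight :: "real \<Rightarrow> real \<Rightarrow> nat \<Rightarrow> nat \<Rightarrow> real" where
  "high_weight s \<kappa> l j = (if l = 0 then 1 else
     (s - real j - 2 * real l - \<kappa> * real l) / (s - real j - real l))"

lemma low_weight_bounded:
  assumes "0 \<le> \<kappa>"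
  shows "\<bar>low_weight \<kappa> l j\<bar> \<le> 1 + \<kappa>"
proof (cases "l = 0")
  case False
  have "\<bar>real j - \<kappa> * real l\<bar> \<le> real j + \<kappa> * real l" using assms by (auto simp: abs_le_iff)
  also have "\<dots> \<le> (1 + \<kappa>) * (real j + real l)" using assms by (simp add: algebra_simps)
  finally show ?thesis using False by (simp add: low_weight_def abs_divide divide_le_eq)
qed (use assms in \<open>simp add: low_weight_def\<close>)

lemma between_one_and_two_not_nat:
  assumes "1 < s" "s < 2"
  shows "s \<noteq> real n"
proof
  assume "s = real n"
  then have "real 1 < real n" "real n < real 2" using assms by auto
  then show False unfolding of_nat_less_iff by simp
qed

text \<open>With \<open>n = j + l\<close> the weight is \<open>1 - (1 + \<kappa>) l / (s - n)\<close>, and \<open>n / |s - n|\<close> is \<open>1 / (s - 1)\<close> for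
  \<open>n = 1\<close> and at most \<open>4\<close> for \<open>n \<ge> 2\<close>.\<close>

lemma high_weight_bounded:
  assumes s: "1 < s" "s < 3 / 2" and \<kappa>: "0 \<le> \<kappa>"
  shows "\<bar>high_weight s \<kappa> l j\<bar> \<le> 1 + (1 + \<kappa>) * (4 + 1 / (s - 1))"
proof (cases "l = 0")
  case True
  then show ?thesis using assms by (simp add: high_weight_def)
next
  case False
  define n where "n = j + l"
  have ln: "1 \<le> n" "real l \<le> real n" using False by (auto simp: n_def)
  have ratio: "real n / \<bar>s - real n\<bar> \<le> 4 + 1 / (s - 1)"
  proof (cases "n = 1")
    case True
    then show ?thesis using s by simp
  next
    case False
    then have n2: "2 \<le> real n" using ln by simp
    have "real n \<le> 4 * (real n - s)" "\<bar>s - real n\<bar> = real n - s" using s n2 by (simp_all add: algebra_simps)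
    then have "real n / \<bar>s - real n\<bar> \<le> 4" using s n2 by (simp add: divide_le_eq)
    then show ?thesis using s by (smt (verit) divide_pos_pos)
  qed
  have ne: "s - real n \<noteq> 0" using between_one_and_two_not_nat[of s n] s by simp
  have "high_weight s \<kappa> l j = ((s - real n) - (1 + \<kappa>) * real l) / (s - real n)"
    using False by (simp add: high_weight_def n_def algebra_simps)
  also have "\<dots> = 1 - (1 + \<kappa>) * (real l / (s - real n))"
    using ne by (simp add: field_simps)
  finally have "\<bar>high_weight s \<kappa> l j\<bar> \<le> 1 + \<bar>(1 + \<kappa>) * (real l / (s - real n))\<bar>" by linarith
  also have "\<bar>(1 + \<kappa>) * (real l / (s - real n))\<bar> = (1 + \<kappa>) * (real l / \<bar>s - real n\<bar>)"
    using \<kappa> by (simp add: abs_mult)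
  also have "\<dots> \<le> (1 + \<kappa>) * (real n / \<bar>s - real n\<bar>)"
    using \<kappa> ln by (intro mult_left_mono divide_right_mono) auto
  also have "\<dots> \<le> (1 + \<kappa>) * (4 + 1 / (s - 1))"
    using \<kappa> ratio by (intro mult_left_mono) auto
  finally show ?thesis by simp
qed

lemma summable_gbin_diag:
  assumes "1 \<le> s" "s \<le> 2"
  shows "summable (\<lambda>j. \<bar>gbin_diag s l j\<bar>)"
  using gbin_diag_double_series(1)[OF assms, of "\<lambda>_ _. 1" 1] by simp

definition low_term :: "real \<Rightarrow> nat \<Rightarrow> real \<Rightarrow> complex \<Rightarrow> real" where
  "low_term s l m B = (\<Sum>j. gbin_diag s l j * (m ^ j * Re (B ^ l)))"

definition low_primitive :: "real \<Rightarrow> real \<Rightarrow> nat \<Rightarrow> real \<Rightarrow> real" where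
  "low_primitive s \<kappa> l m = (\<Sum>j. gbin_diag s l j * (low_weight \<kappa> l j * m ^ (j + l)))"

text \<open>For \<open>m = |b|\<^sup>2\<close> and \<open>B = b\<^sup>2\<close> this is the double series of \<open>two_point_mean s b\<close>. It makes sense on the
  solid cone \<open>|B| \<le> m \<le> 1\<close>, and for fixed \<open>m\<close> it is the harmonic extension in \<open>B\<close> from the circle
  \<open>|B| = m\<close>.\<close>

definition low_extension :: "real \<Rightarrow> real \<Rightarrow> complex \<Rightarrow> real" where
  "low_extension s m B = (\<Sum>l. fold_weight l * low_term s l m B)"

definition high_term :: "real \<Rightarrow> nat \<Rightarrow> real \<Rightarrow> complex \<Rightarrow> real" where
  "high_term s l m B = (\<Sum>j. gbin_diag s l j * (m powr (s - 2 * real l) * (1 / m) ^ j * Re (B ^ l)))"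

definition high_primitive :: "real \<Rightarrow> real \<Rightarrow> nat \<Rightarrow> real \<Rightarrow> real" where
  "high_primitive s \<kappa> l m =
    (\<Sum>j. gbin_diag s l j * (high_weight s \<kappa> l j * (m powr (s - real l) * (1 / m) ^ j)))"

text \<open>The corresponding extension for \<open>m \<ge> 1\<close>, from the expansion in powers of \<open>1/b\<close>.\<close>

definition high_extension :: "real \<Rightarrow> real \<Rightarrow> complex \<Rightarrow> real" where
  "high_extension s m B = (\<Sum>l. fold_weight l * high_term s l m B)"

lemma low_term_increment_le:
  assumes s: "1 < s" "s < 3 / 2" and \<kappa>: "0 \<le> \<kappa>"
    and m: "0 \<le> m1" "m1 \<le> m2" "m2 \<le> 1"
    and B: "norm B1 \<le> m1" "norm B2 \<le> m2" "norm (B2 - B1) \<le> \<kappa> * (m2 - m1)"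
  shows "low_primitive s \<kappa> l m2 - low_primitive s \<kappa> l m1 \<le> low_term s l m2 B2 - low_term s l m1 B1"
proof (cases "l = 0")
  case True
  then show ?thesis by (simp add: low_primitive_def low_term_def low_weight_def)
next
  case False
  have s': "1 \<le> s" "s \<le> 2" using s by auto
  let ?b = "\<lambda>j. gbin_diag s l j * low_weight \<kappa> l j"
  have sa: "summable (\<lambda>j. \<bar>gbin_diag s l j\<bar>)" by (rule summable_gbin_diag[OF s'])
  have sb: "summable (\<lambda>j. \<bar>?b j\<bar>)"
    using gbin_diag_double_series(1)[OF s' low_weight_bounded[OF \<kappa>]] .
  define A where "A m = (\<Sum>j. gbin_diag s l j * m ^ j)" for m
  define A' where "A' m = (\<Sum>j. real j * gbin_diag s l j * m ^ j) / m" for m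
  define \<psi> where "\<psi> m = m ^ l * (\<Sum>j. ?b j * m ^ j)" for m
  have sub: "{m1..m2} \<subseteq> {0..1}" using m by auto
  have "\<psi> m2 - \<psi> m1 \<le> A m2 * Re (B2 ^ l) - A m1 * Re (B1 ^ l)"
  proof (rule cone_increment_le[OF m(2) \<kappa> B, where A' = A'])
    show "continuous_on {m1..m2} A"
      unfolding A_def by (rule continuous_on_subset[OF powser_continuous_unit[OF sa] sub])
    show "continuous_on {m1..m2} \<psi>"
      unfolding \<psi>_def
      by (intro continuous_intros continuous_on_subset[OF powser_continuous_unit[OF sb] sub])
    fix m assume mm: "m1 < m" "m < m2"
    then have m01: "0 < m" "m < 1" using m by auto
    note DA = powser_derivative[OF sa m01]
    show "(A has_real_derivative A' m) (at m)"
      unfolding A_def A'_def by (rule DA(1))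
    show "0 \<le> A m" unfolding A_def using False m01 by (intro gbin_diag_series_nonneg s') auto
    show "A' m \<le> 0"
      unfolding A'_def using gbin_diag_derivative_series_nonpos[OF s' _ _ _ DA(2)] False m01
      by (simp add: divide_nonpos_pos)
    have "(\<Sum>j. (real l + real j) * ?b j * m ^ j)
        = (\<Sum>j. real j * gbin_diag s l j * m ^ j - \<kappa> * real l * (gbin_diag s l j * m ^ j))"
    proof (rule suminf_cong)
      fix j
      have "(real l + real j) * low_weight \<kappa> l j = real j - \<kappa> * real l"
        using False by (simp add: low_weight_def add.commute[of "real l"])
      then have "gbin_diag s l j * m ^ j * ((real l + real j) * low_weight \<kappa> l j)
          = gbin_diag s l j * m ^ j * (real j - \<kappa> * real l)" by (simp only:)
      then show "(real l + real j) * ?b j * m ^ j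
          = real j * gbin_diag s l j * m ^ j - \<kappa> * real l * (gbin_diag s l j * m ^ j)"
        by (simp add: algebra_simps)
    qed
    also have "\<dots> = (\<Sum>j. real j * gbin_diag s l j * m ^ j) - \<kappa> * real l * A m"
      unfolding A_def
      by (subst suminf_diff[symmetric])
         (use DA(2) powser_summable_unit[OF sa, of m] m01 in \<open>simp_all add: suminf_mult summable_mult\<close>)
    finally have e: "(\<Sum>j. (real l + real j) * ?b j * m ^ j)
        = (\<Sum>j. real j * gbin_diag s l j * m ^ j) - \<kappa> * real l * A m" .
    have "m ^ l = m * m ^ (l - 1)" using False by (cases l) auto
    then have "m ^ l * (\<Sum>j. (real l + real j) * ?b j * m ^ j) / m
        = A' m * m ^ l - \<kappa> * real l * A m * m ^ (l - 1)"
      unfolding e A'_def using m01 by (simp add: field_simps)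
    with power_mult_powser_derivative[OF sb m01, of l]
    show "(\<psi> has_real_derivative A' m * m ^ l - \<kappa> * real l * A m * m ^ (l - 1)) (at m)"
      unfolding \<psi>_def by simp
  qed
  moreover have "\<psi> m = low_primitive s \<kappa> l m" if "0 \<le> m" "m \<le> 1" for m
    unfolding \<psi>_def low_primitive_def using suminf_mult[OF powser_summable_unit[OF sb that], of "m ^ l"]
    by (simp add: power_add mult_ac)
  moreover have "A m * Re (B ^ l) = low_term s l m B" if "0 \<le> m" "m \<le> 1" for m B
    unfolding A_def low_term_def using suminf_mult2[OF powser_summable_unit[OF sa that], of "Re (B ^ l)"]
    by (simp add: mult_ac)
  ultimately show ?thesis using m by simp
qed

lemma high_term_increment_le:
  assumes s: "1 < s" "s < 3 / 2" and \<kappa>: "0 \<le> \<kappa>"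
    and m: "1 \<le> m1" "m1 \<le> m2"
    and B: "norm B1 \<le> m1" "norm B2 \<le> m2" "norm (B2 - B1) \<le> \<kappa> * (m2 - m1)"
  shows "high_primitive s \<kappa> l m2 - high_primitive s \<kappa> l m1 \<le> high_term s l m2 B2 - high_term s l m1 B1"
proof (cases "l = 0")
  case True
  then show ?thesis by (simp add: high_primitive_def high_term_def high_weight_def)
next
  case False
  have s': "1 \<le> s" "s \<le> 2" using s by auto
  let ?b = "\<lambda>j. gbin_diag s l j * high_weight s \<kappa> l j"
  have sa: "summable (\<lambda>j. \<bar>gbin_diag s l j\<bar>)" by (rule summable_gbin_diag[OF s'])
  have sb: "summable (\<lambda>j. \<bar>?b j\<bar>)"
    using gbin_diag_double_series(1)[OF s' high_weight_bounded[OF s \<kappa>]] .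
  define A where "A m = m powr (s - 2 * real l) * (\<Sum>j. gbin_diag s l j * (1 / m) ^ j)" for m
  define A' where "A' m = m powr (s - 2 * real l - 1) *
      (\<Sum>j. (s - 2 * real l - real j) * gbin_diag s l j * (1 / m) ^ j)" for m
  define \<psi> where "\<psi> m = m powr (s - real l) * (\<Sum>j. ?b j * (1 / m) ^ j)" for m
  have sub: "{m1..m2} \<subseteq> {1..}" using m by auto
  have "\<psi> m2 - \<psi> m1 \<le> A m2 * Re (B2 ^ l) - A m1 * Re (B1 ^ l)"
  proof (rule cone_increment_le[OF m(2) \<kappa> B, where A' = A'])
    show "continuous_on {m1..m2} A"
      unfolding A_def by (rule continuous_on_subset[OF powr_mult_powser_inverse_continuous[OF sa] sub])
    show "continuous_on {m1..m2} \<psi>"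
      unfolding \<psi>_def by (rule continuous_on_subset[OF powr_mult_powser_inverse_continuous[OF sb] sub])
    fix m assume mm: "m1 < m" "m < m2"
    then have m1: "1 < m" using m by auto
    then have x: "0 < 1 / m" "1 / m < 1" "0 \<le> 1 / m" "1 / m \<le> 1" by auto
    show "(A has_real_derivative A' m) (at m)"
      unfolding A_def A'_def by (rule powr_mult_powser_inverse_derivative[OF sa m1])
    show "0 \<le> A m" unfolding A_def using False x gbin_diag_series_nonneg[OF s', of l "1 / m"] by simp
    show "A' m \<le> 0"
      unfolding A'_def using gbin_diag_reciprocal_series_nonpos[OF s', of l "1 / m"] False x
      by (simp add: mult_nonneg_nonpos)
    have smj: "summable (\<lambda>j. real j * gbin_diag s l j * (1 / m) ^ j)"
      using powser_derivative(2)[OF sa] x by simp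
    have sm0: "summable (\<lambda>j. gbin_diag s l j * (1 / m) ^ j)"
      using powser_summable_unit[OF sa] x by simp
    have sm: "summable (\<lambda>j. (s - 2 * real l - real j) * gbin_diag s l j * (1 / m) ^ j)"
      using summable_diff[OF summable_mult[OF sm0, of "s - 2 * real l"] smj] by (simp add: algebra_simps)
    have "(\<Sum>j. (s - real l - real j) * ?b j * (1 / m) ^ j)
        = (\<Sum>j. (s - 2 * real l - real j) * gbin_diag s l j * (1 / m) ^ j
            - \<kappa> * real l * (gbin_diag s l j * (1 / m) ^ j))"
    proof (rule suminf_cong)
      fix j
      have "s - real j - real l \<noteq> 0" using between_one_and_two_not_nat[of s "j + l"] s by simp
      then have "(s - real l - real j) * high_weight s \<kappa> l j = s - 2 * real l - real j - \<kappa> * real l"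
        using False by (simp add: high_weight_def field_simps)
      then have "gbin_diag s l j * (1 / m) ^ j * ((s - real l - real j) * high_weight s \<kappa> l j)
          = gbin_diag s l j * (1 / m) ^ j * (s - 2 * real l - real j - \<kappa> * real l)" by (simp only:)
      then show "(s - real l - real j) * ?b j * (1 / m) ^ j
          = (s - 2 * real l - real j) * gbin_diag s l j * (1 / m) ^ j
            - \<kappa> * real l * (gbin_diag s l j * (1 / m) ^ j)"
        by (simp add: algebra_simps)
    qed
    also have "\<dots> = (\<Sum>j. (s - 2 * real l - real j) * gbin_diag s l j * (1 / m) ^ j)
        - \<kappa> * real l * (\<Sum>j. gbin_diag s l j * (1 / m) ^ j)"
      by (subst suminf_diff[symmetric]) (use sm sm0 in \<open>simp_all add: suminf_mult summable_mult\<close>)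
    finally have e: "(\<Sum>j. (s - real l - real j) * ?b j * (1 / m) ^ j)
        = (\<Sum>j. (s - 2 * real l - real j) * gbin_diag s l j * (1 / m) ^ j)
        - \<kappa> * real l * (\<Sum>j. gbin_diag s l j * (1 / m) ^ j)" .
    have "0 < m" using m1 by simp
    note powr_realpow = powr_realpow[OF this]
    have p1: "m powr (s - 2 * real l - 1) * m ^ l = m powr (s - real l - 1)"
    proof -
      have "m powr (s - 2 * real l - 1) * m ^ l = m powr (s - 2 * real l - 1 + real l)"
        using m1 by (simp only: powr_add powr_realpow)
      also have "s - 2 * real l - 1 + real l = s - real l - 1" by simp
      finally show ?thesis .
    qed
    have p2: "m powr (s - 2 * real l) * m ^ (l - 1) = m powr (s - real l - 1)"
    proof -
      have "m powr (s - 2 * real l) * m ^ (l - 1) = m powr (s - 2 * real l + real (l - 1))"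
        using m1 by (simp only: powr_add powr_realpow)
      also have "s - 2 * real l + real (l - 1) = s - real l - 1" using False by (simp add: of_nat_diff)
      finally show ?thesis .
    qed
    have "m powr (s - real l - 1) * (\<Sum>j. (s - real l - real j) * ?b j * (1 / m) ^ j)
        = A' m * m ^ l - \<kappa> * real l * A m * m ^ (l - 1)"
    proof -
      define X where "X = (\<Sum>j. (s - 2 * real l - real j) * gbin_diag s l j * (1 / m) ^ j)"
      define Y where "Y = (\<Sum>j. gbin_diag s l j * (1 / m) ^ j)"
      have "A' m * m ^ l - \<kappa> * real l * A m * m ^ (l - 1)
        = (m powr (s - 2 * real l - 1) * m ^ l) * X
          - \<kappa> * real l * (m powr (s - 2 * real l) * m ^ (l - 1)) * Y"
        unfolding A'_def A_def X_def Y_def by (simp only: mult_ac)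
      then show ?thesis unfolding e p1 p2 X_def Y_def by (simp only: algebra_simps)
    qed
    with powr_mult_powser_inverse_derivative[OF sb m1, of "s - real l"]
    show "(\<psi> has_real_derivative A' m * m ^ l - \<kappa> * real l * A m * m ^ (l - 1)) (at m)"
      unfolding \<psi>_def by simp
  qed
  moreover have "\<psi> m = high_primitive s \<kappa> l m" if "1 \<le> m" for m
    unfolding \<psi>_def high_primitive_def using suminf_mult[OF powser_summable_unit[OF sb, of "1 / m"], of "m powr (s - real l)"] that
    by (simp add: mult_ac)
  moreover have "A m * Re (B ^ l) = high_term s l m B" if "1 \<le> m" for m B
    unfolding A_def high_term_def using suminf_mult[OF powser_summable_unit[OF sa, of "1 / m"], of "m powr (s - 2 * real l) * Re (B ^ l)"] that
    by (simp add: mult_ac)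
  ultimately show ?thesis using m by simp
qed

text \<open>On the antidiagonal \<open>l + j = n\<close> the low weight is \<open>1 - (\<kappa> + 1) l / n\<close> and the high weight is
  \<open>1 - (\<kappa> + 1) l / (s - n)\<close>. So both weighted sums reduce to the two closed forms found above.\<close>

lemma sum_low_weights:
  assumes n: "0 < n"
  shows "real n * (\<Sum>l\<le>n. fold_weight l * (gbin_diag s l (n - l) * low_weight \<kappa> l (n - l)))
    = real n * (2 * s gchoose (2 * n))
      - (\<kappa> + 1) * (\<Sum>l\<le>n. fold_weight l * real l * gbin_diag s l (n - l))"
proof -
  have "real n * low_weight \<kappa> l (n - l) = real n - (\<kappa> + 1) * real l" if "l \<le> n" for l
  proof -
    have e: "real (n - l) + real l = real n" using that by simp
    have "real (n - l) - \<kappa> * real l = real n - (\<kappa> + 1) * real l"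
      using that by (simp add: of_nat_diff algebra_simps)
    then show ?thesis unfolding low_weight_def e using n by simp
  qed
  then have "real n * (fold_weight l * (gbin_diag s l (n - l) * low_weight \<kappa> l (n - l)))
      = real n * (fold_weight l * gbin_diag s l (n - l))
        - (\<kappa> + 1) * (fold_weight l * real l * gbin_diag s l (n - l))" if "l \<le> n" for l
  proof -
    have "real n * (fold_weight l * (gbin_diag s l (n - l) * low_weight \<kappa> l (n - l)))
      = fold_weight l * gbin_diag s l (n - l) * (real n * low_weight \<kappa> l (n - l))" by (simp only: mult_ac)
    also have "\<dots> = fold_weight l * gbin_diag s l (n - l) * (real n - (\<kappa> + 1) * real l)"
      using \<open>\<And>l. l \<le> n \<Longrightarrow> real n * low_weight \<kappa> l (n - l) = real n - (\<kappa> + 1) * real l\<close> that by simp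
    finally show ?thesis by (simp add: algebra_simps)
  qed
  then show ?thesis
    by (simp add: sum_distrib_left sum_subtractf flip: sum_gbin_diag)
qed

lemma sum_high_weights:
  assumes s: "1 < s" "s < 3 / 2"
  shows "(s - real n) * (\<Sum>l\<le>n. fold_weight l * (gbin_diag s l (n - l) * high_weight s \<kappa> l (n - l)))
    = (s - real n) * (2 * s gchoose (2 * n))
      - (\<kappa> + 1) * (\<Sum>l\<le>n. fold_weight l * real l * gbin_diag s l (n - l))"
proof -
  have ne: "s - real n \<noteq> 0" using between_one_and_two_not_nat[of s n] s by simp
  have h: "(s - real n) * high_weight s \<kappa> l (n - l) = (s - real n) - (\<kappa> + 1) * real l" if "l \<le> n" for l
  proof -
    have e: "s - real (n - l) - real l = s - real n" using that by simp
    have "s - real (n - l) - 2 * real l - \<kappa> * real l = (s - real n) - (\<kappa> + 1) * real l"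
      using that by (simp add: of_nat_diff algebra_simps)
    then show ?thesis unfolding high_weight_def e using ne by simp
  qed
  have "(s - real n) * (fold_weight l * (gbin_diag s l (n - l) * high_weight s \<kappa> l (n - l)))
      = (s - real n) * (fold_weight l * gbin_diag s l (n - l))
        - (\<kappa> + 1) * (fold_weight l * real l * gbin_diag s l (n - l))" if "l \<le> n" for l
  proof -
    have "(s - real n) * (fold_weight l * (gbin_diag s l (n - l) * high_weight s \<kappa> l (n - l)))
      = fold_weight l * gbin_diag s l (n - l) * ((s - real n) * high_weight s \<kappa> l (n - l))" by (simp only: mult_ac)
    also have "\<dots> = fold_weight l * gbin_diag s l (n - l) * ((s - real n) - (\<kappa> + 1) * real l)"
      using h[OF that] by (simp only:)
    finally show ?thesis by (simp add: algebra_simps)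
  qed
  then show ?thesis
    by (simp add: sum_distrib_left sum_subtractf flip: sum_gbin_diag)
qed

lemma sum_index_gbin_diag_le:
  assumes s: "1 < s" "s < 3 / 2" and \<kappa>: "\<kappa> = s / (s - 1)"
  shows "(\<kappa> + 1) * (\<Sum>l\<le>n. fold_weight l * real l * gbin_diag s l (n - l))
    \<le> real n * (2 * s gchoose (2 * n))"
proof (cases n)
  case (Suc k)
  have "\<kappa> + 1 = (2 * s - 1) / (s - 1)" using s by (simp add: \<kappa> field_simps)
  then show ?thesis
    using gbinomial_product_le[OF s, of k] sum_index_gbin_diag[of s k] Suc by (simp add: mult_ac)
qed simp

lemma weighted_sums_mono:
  fixes w :: "nat \<Rightarrow> real"
  assumes "(\<lambda>l. w l * t1 l) sums E1" "(\<lambda>l. w l * t2 l) sums E2"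
    and "(\<lambda>l. w l * q1 l) sums P1" "(\<lambda>l. w l * q2 l) sums P2"
    and le: "\<And>l. 0 \<le> w l" "\<And>l. q2 l - q1 l \<le> t2 l - t1 l" "P1 \<le> P2"
  shows "E1 \<le> E2"
proof -
  have "w l * q2 l - w l * q1 l \<le> w l * t2 l - w l * t1 l" for l
    unfolding right_diff_distrib[symmetric] by (intro mult_left_mono le)
  from sums_le[OF this sums_diff[OF assms(4,3)] sums_diff[OF assms(2,1)]]
  have "P2 - P1 \<le> E2 - E1" .
  then show ?thesis using le(3) by simp
qed

text \<open>Summed over \<open>l\<close>, the lower bounds for the increments regroup by total degree to
  \<open>\<Sum>\<^sub>n e\<^sub>n (m2\<^sup>n - m1\<^sup>n)\<close>, and \<open>e\<^sub>n \<ge> 0\<close> for \<open>n > 0\<close> is the inequality between binomial products.\<close>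

lemma low_extension_mono:
  assumes s: "1 < s" "s < 3 / 2" and \<kappa>: "\<kappa> = s / (s - 1)"
    and m: "0 \<le> m1" "m1 \<le> m2" "m2 \<le> 1"
    and B: "norm B1 \<le> m1" "norm B2 \<le> m2" "norm (B2 - B1) \<le> \<kappa> * (m2 - m1)"
  shows "low_extension s m1 B1 \<le> low_extension s m2 B2"
proof -
  have s': "1 \<le> s" "s \<le> 2" using s by auto
  have \<kappa>0: "0 \<le> \<kappa>" using s by (simp add: \<kappa>)
  have E: "(\<lambda>l. fold_weight l * low_term s l m B) sums low_extension s m B"
    if "norm B \<le> m" "m \<le> 1" for m B
  proof -
    have "0 \<le> m" using that norm_ge_zero order_trans by blast
    have "\<bar>m ^ j * Re (B ^ l)\<bar> \<le> 1" for l j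
    proof -
      have "\<bar>Re (B ^ l)\<bar> \<le> norm B ^ l" using abs_Re_le_cmod[of "B ^ l"] by (simp add: norm_power)
      also have "\<dots> \<le> 1" using that by (intro power_le_one) auto
      finally show ?thesis using \<open>0 \<le> m\<close> that mult_mono[of "m ^ j" 1 "\<bar>Re (B ^ l)\<bar>" 1]
        by (simp add: abs_mult power_le_one)
    qed
    from sums_summable[OF gbin_diag_double_series(3)[OF s' this]]
    show ?thesis unfolding low_extension_def low_term_def by (rule summable_sums)
  qed
  define e where "e n = (\<Sum>l\<le>n. fold_weight l * (gbin_diag s l (n - l) * low_weight \<kappa> l (n - l)))" for n
  define P where "P m = (\<Sum>n. e n * m ^ n)" for m
  have P: "(\<lambda>l. fold_weight l * low_primitive s \<kappa> l m) sums P m"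
    and Ps: "summable (\<lambda>n. e n * m ^ n)" if "0 \<le> m" "m \<le> 1" for m
  proof -
    have b: "\<bar>low_weight \<kappa> l j * m ^ (j + l)\<bar> \<le> (1 + \<kappa>) * 1" for l j
      unfolding abs_mult using that \<kappa>0 by (intro mult_mono low_weight_bounded) (auto simp: power_le_one)
    have e: "(\<Sum>l\<le>n. fold_weight l * (gbin_diag s l (n - l) * (low_weight \<kappa> l (n - l) * m ^ (n - l + l)))) = e n * m ^ n" for n
      unfolding e_def sum_distrib_right by (intro sum.cong refl) (simp add: mult_ac)
    show "(\<lambda>l. fold_weight l * low_primitive s \<kappa> l m) sums P m"
      unfolding low_primitive_def using gbin_diag_double_series(3)[where G = "\<lambda>l j. low_weight \<kappa> l j * m ^ (j + l)", OF s' b] unfolding e P_def .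
    show "summable (\<lambda>n. e n * m ^ n)"
      using summable_rabs_cancel[OF gbin_diag_double_series(2)[where G = "\<lambda>l j. low_weight \<kappa> l j * m ^ (j + l)", OF s' b]] unfolding e .
  qed
  have "0 \<le> P m2 - P m1"
  proof -
    have "0 \<le> e n * m2 ^ n - e n * m1 ^ n" for n
    proof (cases "n = 0")
      case False
      have "0 \<le> real n * e n"
        using sum_index_gbin_diag_le[OF s \<kappa>, of n] sum_low_weights[of n s \<kappa>] False by (simp add: e_def)
      then have "0 \<le> e n" using False by (simp add: zero_le_mult_iff)
      then show ?thesis using m by (simp add: mult_left_mono power_mono)
    qed simp
    moreover have "summable (\<lambda>n. e n * m2 ^ n - e n * m1 ^ n)"
      using m by (intro summable_diff Ps) auto
    ultimately have "0 \<le> (\<Sum>n. e n * m2 ^ n - e n * m1 ^ n)" by (simp add: suminf_nonneg)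
    then show ?thesis using m by (subst (asm) suminf_diff[symmetric]) (auto simp: P_def intro!: Ps)
  qed
  then have "P m1 \<le> P m2" by simp
  then show ?thesis
    using m B by (intro weighted_sums_mono[OF E E P P _ low_term_increment_le[OF s \<kappa>0 m B]])
      (auto simp: fold_weight_def)
qed

text \<open>Both \<open>k (2s gchoose k)\<close> and \<open>(2s - k) (2s gchoose k)\<close> are multiples of binomial coefficients of \<open>2s - 1\<close>;
  half their difference is \<open>(s - k) (2s gchoose k)\<close>.\<close>

lemma gbinomial_half_index_sums:
  fixes s \<beta> :: real
  assumes "\<bar>\<beta>\<bar> < 1"
  shows "(\<lambda>k. (s - real k) * (2 * s gchoose k) * \<beta> ^ k) sums (s * (1 + \<beta>) powr (2 * s - 1) * (1 - \<beta>))"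
proof -
  let ?v = "\<lambda>k. (2 * s - 1 gchoose k) * \<beta> ^ k"
  let ?w = "\<lambda>k. if k = 0 then 0 else (2 * s - 1 gchoose (k - 1)) * \<beta> ^ k"
  have v: "?v sums (1 + \<beta>) powr (2 * s - 1)" by (rule gen_binomial_real[OF assms])
  have "(\<lambda>k. ?w (Suc k)) sums (\<beta> * (1 + \<beta>) powr (2 * s - 1))"
    using sums_mult[OF v, of \<beta>] by (simp add: mult_ac)
  then have w: "?w sums (\<beta> * (1 + \<beta>) powr (2 * s - 1))"
    by (subst (asm) sums_Suc_iff) simp
  have "s * (?v k - ?w k) = (s - real k) * (2 * s gchoose k) * \<beta> ^ k" for k
  proof (cases k)
    case (Suc i)
    have "real k * (2 * s gchoose k) = 2 * s * (2 * s - 1 gchoose i)"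
      unfolding Suc by (rule gbinomial_absorption)
    moreover have "(2 * s - real k) * (2 * s gchoose k) = 2 * s * (2 * s - 1 gchoose k)"
      by (rule gbinomial_absorb_comp)
    ultimately have "(s - real k) * (2 * s gchoose k) = s * ((2 * s - 1 gchoose k) - (2 * s - 1 gchoose i))"
      by (simp add: algebra_simps)
    then have "(s - real k) * (2 * s gchoose k) * \<beta> ^ k
        = s * ((2 * s - 1 gchoose k) - (2 * s - 1 gchoose i)) * \<beta> ^ k" by (simp only:)
    then show ?thesis using Suc by (simp add: algebra_simps)
  qed simp
  with sums_mult[OF sums_diff[OF v w], of s]
  have "(\<lambda>k. (s - real k) * (2 * s gchoose k) * \<beta> ^ k) sums
      (s * ((1 + \<beta>) powr (2 * s - 1) - \<beta> * (1 + \<beta>) powr (2 * s - 1)))"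
    by (simp only:)
  moreover have "s * ((1 + \<beta>) powr (2 * s - 1) - \<beta> * (1 + \<beta>) powr (2 * s - 1))
      = s * (1 + \<beta>) powr (2 * s - 1) * (1 - \<beta>)"
    by (simp add: algebra_simps)
  ultimately show ?thesis by (simp only:)
qed

lemma gbinomial_even_index_sum_nonneg:
  fixes s x :: real
  assumes s: "0 \<le> s" and x: "0 \<le> x" "x < 1"
  shows "summable (\<lambda>n. (s - 2 * real n) * (2 * s gchoose (2 * n)) * x ^ n)"
    and "0 \<le> (\<Sum>n. (s - 2 * real n) * (2 * s gchoose (2 * n)) * x ^ n)"
proof -
  define \<beta> where "\<beta> = sqrt x"
  have \<beta>: "0 \<le> \<beta>" "\<beta> < 1" "\<beta>\<^sup>2 = x" using x by (auto simp: \<beta>_def)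
  define t where "t k = (s - real k) * (2 * s gchoose k) * \<beta> ^ k" for k
  have "t sums (s * (1 + \<beta>) powr (2 * s - 1) * (1 - \<beta>))"
    unfolding t_def using \<beta> by (intro gbinomial_half_index_sums) auto
  moreover have "(-1) ^ k * t k = (s - real k) * (2 * s gchoose k) * (- \<beta>) ^ k" for k
    unfolding t_def power_minus[of \<beta>] by (simp only: mult_ac)
  then have "(\<lambda>k. (-1) ^ k * t k) sums (s * (1 - \<beta>) powr (2 * s - 1) * (1 + \<beta>))"
    using gbinomial_half_index_sums[of "- \<beta>" s] \<beta> by simp
  ultimately have "(\<lambda>n. t (2 * n)) sums
      ((s * (1 + \<beta>) powr (2 * s - 1) * (1 - \<beta>) + s * (1 - \<beta>) powr (2 * s - 1) * (1 + \<beta>)) / 2)"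
    by (rule sums_even_part)
  moreover have "t (2 * n) = (s - 2 * real n) * (2 * s gchoose (2 * n)) * x ^ n" for n
    unfolding t_def power_mult \<beta>(3) by simp
  ultimately have S: "(\<lambda>n. (s - 2 * real n) * (2 * s gchoose (2 * n)) * x ^ n) sums
      ((s * (1 + \<beta>) powr (2 * s - 1) * (1 - \<beta>) + s * (1 - \<beta>) powr (2 * s - 1) * (1 + \<beta>)) / 2)"
    by simp
  from S show "summable (\<lambda>n. (s - 2 * real n) * (2 * s gchoose (2 * n)) * x ^ n)" by (rule sums_summable)
  show "0 \<le> (\<Sum>n. (s - 2 * real n) * (2 * s gchoose (2 * n)) * x ^ n)"
    unfolding sums_unique[OF S, symmetric] using s \<beta> by simp
qed

text \<open>The regrouped lower bound is now \<open>P(m) = \<Sum>\<^sub>n e\<^sub>n m\<^bsup>s-n\<^esup>\<close>, whose coefficients have no fixed sign. Its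
  derivative is bounded below, coefficient by coefficient, by a series with a nonnegative closed form.\<close>

lemma high_extension_mono:
  assumes s: "1 < s" "s < 3 / 2" and \<kappa>: "\<kappa> = s / (s - 1)"
    and m: "1 \<le> m1" "m1 \<le> m2"
    and B: "norm B1 \<le> m1" "norm B2 \<le> m2" "norm (B2 - B1) \<le> \<kappa> * (m2 - m1)"
  shows "high_extension s m1 B1 \<le> high_extension s m2 B2"
proof -
  have s': "1 \<le> s" "s \<le> 2" using s by auto
  have \<kappa>0: "0 \<le> \<kappa>" using s by (simp add: \<kappa>)
  have pw: "m powr (s - 2 * real l) * m ^ l \<le> m powr s" if "1 \<le> m" for m l
  proof -
    have "m powr (s - 2 * real l) * m ^ l = m powr (s - real l)"
      using that by (simp add: powr_realpow[symmetric] powr_add[symmetric])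
    also have "\<dots> \<le> m powr s" using that by (intro powr_mono) auto
    finally show ?thesis .
  qed
  have E: "(\<lambda>l. fold_weight l * high_term s l m B) sums high_extension s m B"
    if "norm B \<le> m" "1 \<le> m" for m B
  proof -
    have "\<bar>m powr (s - 2 * real l) * (1 / m) ^ j * Re (B ^ l)\<bar> \<le> m powr s" for l j
    proof -
      have "\<bar>Re (B ^ l)\<bar> \<le> norm B ^ l" using abs_Re_le_cmod[of "B ^ l"] by (simp add: norm_power)
      also have "\<dots> \<le> m ^ l" using that by (intro power_mono) auto
      finally have 1: "\<bar>Re (B ^ l)\<bar> \<le> m ^ l" .
      have 2: "(1 / m) ^ j \<le> 1" "0 \<le> (1 / m) ^ j" using that by (auto intro!: power_le_one)
      have "\<bar>m powr (s - 2 * real l) * (1 / m) ^ j * Re (B ^ l)\<bar>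
          = m powr (s - 2 * real l) * ((1 / m) ^ j * \<bar>Re (B ^ l)\<bar>)"
        using 2 by (simp add: abs_mult)
      also have "\<dots> \<le> m powr (s - 2 * real l) * (1 * m ^ l)"
        using 1 2 by (intro mult_left_mono mult_mono) auto
      finally show ?thesis using pw[OF that(2), of l] by simp
    qed
    from sums_summable[OF gbin_diag_double_series(3)[OF s' this]]
    show ?thesis unfolding high_extension_def high_term_def by (rule summable_sums)
  qed
  define e where "e n = (\<Sum>l\<le>n. fold_weight l * (gbin_diag s l (n - l) * high_weight s \<kappa> l (n - l)))" for n
  have es: "summable (\<lambda>n. \<bar>e n\<bar>)"
    using gbin_diag_double_series(2)[OF s' high_weight_bounded[OF s \<kappa>0]] by (simp add: e_def)
  define P where "P m = m powr s * (\<Sum>n. e n * (1 / m) ^ n)" for m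
  have P: "(\<lambda>l. fold_weight l * high_primitive s \<kappa> l m) sums P m" if "1 \<le> m" for m
  proof -
    let ?C = "1 + (1 + \<kappa>) * (4 + 1 / (s - 1))"
    have b: "\<bar>high_weight s \<kappa> l j * (m powr (s - real l) * (1 / m) ^ j)\<bar> \<le> ?C * (m powr s * 1)" for l j
      unfolding abs_mult using that \<kappa>0 s
      by (intro mult_mono high_weight_bounded) (auto intro!: power_le_one powr_mono simp: power_abs)
    have "(\<Sum>l\<le>n. fold_weight l * (gbin_diag s l (n - l) * (high_weight s \<kappa> l (n - l) *
        (m powr (s - real l) * (1 / m) ^ (n - l))))) = m powr s * (e n * (1 / m) ^ n)" for n
    proof -
      have "m powr (s - real l) * (1 / m) ^ (n - l) = m powr s * (1 / m) ^ n" if "l \<le> n" for l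
      proof -
        have "m powr (s - real l) = m powr s * (1 / m) ^ l"
          using \<open>1 \<le> m\<close> by (simp add: powr_diff powr_realpow power_divide)
        moreover have "(1 / m) ^ l * (1 / m) ^ (n - l) = (1 / m) ^ n"
          using that by (simp add: power_add[symmetric])
        ultimately show ?thesis by (simp add: mult.assoc)
      qed
      then show ?thesis by (auto simp: e_def sum_distrib_left sum_distrib_right mult_ac intro!: sum.cong)
    qed
    note e = this
    have "(\<Sum>n. m powr s * (e n * (1 / m) ^ n)) = P m"
      unfolding P_def using that by (intro suminf_mult powser_summable_unit[OF es]) auto
    with gbin_diag_double_series(3)[where G = "\<lambda>l j. high_weight s \<kappa> l j * (m powr (s - real l) * (1 / m) ^ j)", OF s' b]
    show ?thesis unfolding e high_primitive_def by simp
  qed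
  have "P m1 \<le> P m2"
  proof (rule DERIV_nonneg_imp_increasing_open[OF m(2)])
    show "continuous_on {m1..m2} P"
      unfolding P_def by (rule continuous_on_subset[OF powr_mult_powser_inverse_continuous[OF es]]) (use m in auto)
    fix m assume mm: "m1 < m" "m < m2"
    then have m1: "1 < m" using m by auto
    then have x: "0 < 1 / m" "1 / m < 1" "0 \<le> 1 / m" "1 / m \<le> 1" by auto
    have sm: "summable (\<lambda>n. (s - real n) * e n * (1 / m) ^ n)"
      using summable_diff[OF summable_mult[OF powser_summable_unit[OF es, of "1 / m"], of s] powser_derivative(2)[OF es, of "1 / m"]] x
      by (simp add: algebra_simps)
    have "0 \<le> (\<Sum>n. (s - 2 * real n) * (2 * s gchoose (2 * n)) * (1 / m) ^ n)"
      using gbinomial_even_index_sum_nonneg(2)[of s "1 / m"] s x by simp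
    also have "\<dots> \<le> (\<Sum>n. (s - real n) * e n * (1 / m) ^ n)"
    proof (rule suminf_le)
      show "summable (\<lambda>n. (s - 2 * real n) * (2 * s gchoose (2 * n)) * (1 / m) ^ n)"
        using gbinomial_even_index_sum_nonneg(1)[of s "1 / m"] s x by simp
      show "(s - 2 * real n) * (2 * s gchoose (2 * n)) * (1 / m) ^ n \<le> (s - real n) * e n * (1 / m) ^ n" for n
      proof (rule mult_right_mono)
        show "(s - 2 * real n) * (2 * s gchoose (2 * n)) \<le> (s - real n) * e n"
          unfolding e_def sum_high_weights[OF s]
          using sum_index_gbin_diag_le[OF s \<kappa>, of n] by (simp add: algebra_simps)
      qed (use x in simp)
    qed (rule sm)
    finally have "0 \<le> m powr (s - 1) * (\<Sum>n. (s - real n) * e n * (1 / m) ^ n)" by simp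
    then show "\<exists>y. (P has_real_derivative y) (at m) \<and> 0 \<le> y"
      using powr_mult_powser_inverse_derivative[OF es m1, of s] unfolding P_def by blast
  qed
  then show ?thesis
    using m B by (intro weighted_sums_mono[OF E E P P _ high_term_increment_le[OF s \<kappa>0 m B]])
      (auto simp: fold_weight_def)
qed

section \<open>The two-point inequality for exponents between two and three\<close>

lemma abs_power_Re_power_le_one:
  fixes b :: complex
  assumes "norm b \<le> 1"
  shows "\<bar>(norm b)\<^sup>2 ^ j * Re ((b\<^sup>2) ^ l)\<bar> \<le> 1"
proof -
  have "\<bar>Re ((b\<^sup>2) ^ l)\<bar> \<le> norm b ^ (2 * l)"
    using abs_Re_le_cmod[of "(b\<^sup>2) ^ l"] by (simp add: norm_power power_mult)
  also have "\<dots> \<le> 1" using assms by (intro power_le_one) auto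
  finally have "(norm b)\<^sup>2 ^ j * \<bar>Re ((b\<^sup>2) ^ l)\<bar> \<le> 1 * 1"
    using assms by (intro mult_mono) (auto intro!: power_le_one)
  then show ?thesis by (simp add: abs_mult)
qed

lemma two_point_mean_eq_low_extension:
  assumes s: "1 \<le> s" "s \<le> 2" and b: "norm b < 1"
  shows "two_point_mean s b = low_extension s ((norm b)\<^sup>2) (b\<^sup>2)"
proof -
  have "low_extension s ((norm b)\<^sup>2) (b\<^sup>2) = (\<Sum>n. \<Sum>l\<le>n. fold_weight l *
      (gbin_diag s l (n - l) * ((norm b)\<^sup>2 ^ (n - l) * Re ((b\<^sup>2) ^ l))))"
    unfolding low_extension_def low_term_def
    using sums_unique[OF gbin_diag_double_series(3)[where G = "\<lambda>l j. (norm b)\<^sup>2 ^ j * Re ((b\<^sup>2) ^ l)", OF s abs_power_Re_power_le_one]] b by simp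
  then show ?thesis
    using sums_unique[OF two_point_mean_antidiagonal_sums[OF s b]] by simp
qed

text \<open>Since \<open>|1 \<plusminus> b| = |b| |1 \<plusminus> 1/b|\<close>, the mean at \<open>b\<close> is \<open>|b|\<^bsup>2s\<^esup>\<close> times the mean at \<open>1/b\<close>.\<close>

lemma two_point_mean_eq_high_extension:
  assumes s: "1 \<le> s" "s \<le> 2" and b: "1 < norm b"
  shows "two_point_mean s b = high_extension s ((norm b)\<^sup>2) (b\<^sup>2)"
proof -
  define m where "m = (norm b)\<^sup>2"
  have m: "1 < m" using b by (simp add: m_def power_strict_mono one_less_power)
  have b0: "b \<noteq> 0" using b by auto
  have ib: "norm (1 / b) < 1" using b by (auto simp: norm_divide divide_less_eq_1)
  have scale: "norm (1 + c) powr (2 * s) = m powr s * norm (1 + 1 / c) powr (2 * s)"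
    if "norm c = norm b" for c :: complex
  proof -
    have "c \<noteq> 0" using that b0 by auto
    then have "1 + c = c * (1 + 1 / c)" by (simp add: field_simps)
    then have "norm (1 + c) = norm b * norm (1 + 1 / c)" by (metis norm_mult that)
    moreover have "m powr s = norm b powr (2 * s)"
      using b by (simp add: m_def powr_powr[symmetric] powr_numeral[symmetric] del: powr_numeral)
    ultimately show ?thesis by (simp add: powr_mult)
  qed
  have mean: "two_point_mean s b = m powr s * two_point_mean s (1 / b)"
    unfolding two_point_mean_def using scale[of b] scale[of "- b"] by (simp add: algebra_simps)
  have low: "low_extension s ((norm (1 / b))\<^sup>2) ((1 / b)\<^sup>2) = two_point_mean s (1 / b)"
    using two_point_mean_eq_low_extension[OF s ib] by simp
  have Re: "Re (((1 / b)\<^sup>2) ^ l) = Re ((b\<^sup>2) ^ l) / m ^ (2 * l)" for l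
  proof -
    have "1 / b = cnj b / of_real m"
      using b0 complex_norm_square[of b] by (simp add: m_def field_simps)
    then have "((1 / b)\<^sup>2) ^ l = cnj ((b\<^sup>2) ^ l) / of_real (m ^ (2 * l))"
      by (simp add: power_divide power_mult)
    then show ?thesis by (simp only: Re_divide_of_real cnj.sel)
  qed
  have summand: "m powr s * (((norm (1 / b))\<^sup>2) ^ j * Re (((1 / b)\<^sup>2) ^ l))
      = m powr (s - 2 * real l) * (1 / m) ^ j * Re ((b\<^sup>2) ^ l)" for l j
  proof -
    have "m powr (s - 2 * real l) = m powr s / m ^ (2 * l)"
      using m by (simp add: powr_diff powr_realpow[symmetric])
    moreover have "(norm (1 / b))\<^sup>2 = 1 / m" by (simp add: m_def norm_divide power_divide)
    ultimately show ?thesis unfolding Re by simp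
  qed
  note D = gbin_diag_double_series[where G = "\<lambda>l j. ((norm (1 / b))\<^sup>2) ^ j * Re (((1 / b)\<^sup>2) ^ l)", OF s
      abs_power_Re_power_le_one[OF less_imp_le[OF ib]]]
  define t where "t l = low_term s l ((norm (1 / b))\<^sup>2) ((1 / b)\<^sup>2)" for l
  have inner: "m powr s * t l = high_term s l m (b\<^sup>2)" for l
  proof -
    have "m powr s * t l = (\<Sum>j. m powr s * (gbin_diag s l j * (((norm (1 / b))\<^sup>2) ^ j * Re (((1 / b)\<^sup>2) ^ l))))"
      unfolding t_def low_term_def by (rule suminf_mult[symmetric]) (rule summable_rabs_cancel[OF D(1)])
    also have "\<dots> = (\<Sum>j. gbin_diag s l j * (m powr s * (((norm (1 / b))\<^sup>2) ^ j * Re (((1 / b)\<^sup>2) ^ l))))"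
      by (simp only: mult.left_commute)
    finally show ?thesis unfolding summand high_term_def .
  qed
  have sm: "summable (\<lambda>l. fold_weight l * t l)"
    using sums_summable[OF D(3)] unfolding t_def low_term_def .
  have "m powr s * low_extension s ((norm (1 / b))\<^sup>2) ((1 / b)\<^sup>2) = (\<Sum>l. m powr s * (fold_weight l * t l))"
    unfolding low_extension_def t_def[symmetric] by (rule suminf_mult[symmetric, OF sm])
  also have "\<dots> = (\<Sum>l. fold_weight l * (m powr s * t l))" by (simp only: mult.left_commute)
  also have "\<dots> = high_extension s m (b\<^sup>2)" unfolding inner high_extension_def ..
  finally show ?thesis using mean low by (simp add: m_def)
qed

lemma extensions_agree: "low_extension s 1 B = high_extension s 1 B"
  by (simp add: low_extension_def high_extension_def low_term_def high_term_def)

text \<open>The segment from \<open>(|y|\<^sup>2, y\<^sup>2)\<close> to \<open>(|b|\<^sup>2, b\<^sup>2)\<close> stays in the solid cone \<open>|B| \<le> m\<close>. If it crosses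
  \<open>m = 1\<close>, it does so at an interior point of the cone in general, which is why the mean had to be extended
  to the whole cone.\<close>

lemma two_point_mean_mono_off_circle:
  fixes b y :: complex
  assumes s: "1 < s" "s < 3 / 2"
    and ne: "norm b \<noteq> 1" "norm y \<noteq> 1"
    and le: "norm (b\<^sup>2 - y\<^sup>2) \<le> s / (s - 1) * ((norm b)\<^sup>2 - (norm y)\<^sup>2)"
  shows "two_point_mean s y \<le> two_point_mean s b"
proof -
  define \<kappa> where "\<kappa> = s / (s - 1)"
  have \<kappa>0: "0 < \<kappa>" using s by (simp add: \<kappa>_def)
  have s': "1 \<le> s" "s \<le> 2" using s by auto
  define m1 m2 where "m1 = (norm y)\<^sup>2" and "m2 = (norm b)\<^sup>2"
  have B: "norm (b\<^sup>2 - y\<^sup>2) \<le> \<kappa> * (m2 - m1)" using le by (simp add: \<kappa>_def m1_def m2_def)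
  then have "0 \<le> \<kappa> * (m2 - m1)" using norm_ge_zero order_trans by blast
  then have m: "m1 \<le> m2" using \<kappa>0 by (simp add: zero_le_mult_iff)
  have nB: "norm (y\<^sup>2) \<le> m1" "norm (b\<^sup>2) \<le> m2" by (auto simp: m1_def m2_def norm_power)
  have m0: "0 \<le> m1" by (simp add: m1_def)
  have lt1: "(norm x)\<^sup>2 < 1 \<longleftrightarrow> norm x < 1" and gt1: "1 < (norm x)\<^sup>2 \<longleftrightarrow> 1 < norm x" for x :: complex
    using abs_square_less_1[of "norm x"] abs_square_le_1[of "norm x"] by auto
  consider "norm b < 1" | "1 < norm y" | "norm y < 1" "1 < norm b"
    using ne by linarith
  then show ?thesis
  proof cases
    case 1
    then have "m2 < 1" using lt1 by (simp add: m2_def)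
    moreover from this have "norm y < 1" using m lt1[of y] by (simp add: m1_def)
    ultimately show ?thesis
      using low_extension_mono[OF s \<kappa>_def m0 m _ nB B] 1
      by (simp add: two_point_mean_eq_low_extension[OF s'] m1_def m2_def)
  next
    case 2
    then have m1: "1 < m1" using gt1 by (simp add: m1_def)
    then have "1 < norm b" using m gt1[of b] by (simp add: m2_def)
    then show ?thesis
      using high_extension_mono[OF s \<kappa>_def _ m nB B] m1 2
      by (simp add: two_point_mean_eq_high_extension[OF s'] m1_def m2_def)
  next
    case 3
    have m1: "m1 < 1" and m2: "1 < m2" using 3 lt1 gt1 by (auto simp: m1_def m2_def)
    define t where "t = (1 - m1) / (m2 - m1)"
    have t: "0 \<le> t" "t \<le> 1" "m1 + t * (m2 - m1) = 1" using m1 m2 by (auto simp: t_def field_simps)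
    have t': "(1 - t) * (m2 - m1) = m2 - 1" using t(3) by (simp add: algebra_simps)
    \<comment> \<open>The second coordinate of the point where the segment crosses \<open>m = 1\<close>.\<close>
    define C where "C = y\<^sup>2 + of_real t * (b\<^sup>2 - y\<^sup>2)"
    have "C = of_real (1 - t) * y\<^sup>2 + of_real t * b\<^sup>2" by (simp add: C_def algebra_simps)
    then have "norm C \<le> norm (of_real (1 - t) * y\<^sup>2) + norm (of_real t * b\<^sup>2)"
      by (simp only: norm_triangle_ineq)
    also have "\<dots> = (1 - t) * m1 + t * m2"
      using t unfolding norm_mult norm_of_real m1_def m2_def norm_power by simp
    also have "\<dots> = 1" using t(3) by (simp add: algebra_simps)
    finally have C: "norm C \<le> 1" .
    have C1: "norm (C - y\<^sup>2) \<le> \<kappa> * (1 - m1)"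
    proof -
      have "norm (C - y\<^sup>2) = t * norm (b\<^sup>2 - y\<^sup>2)"
        using t by (simp add: C_def norm_mult)
      also have "\<dots> \<le> t * (\<kappa> * (m2 - m1))" using B t by (intro mult_left_mono) auto
      also have "\<dots> = \<kappa> * (t * (m2 - m1))" by simp
      also have "t * (m2 - m1) = 1 - m1" using t(3) by simp
      finally show ?thesis .
    qed
    have C2: "norm (b\<^sup>2 - C) \<le> \<kappa> * (m2 - 1)"
    proof -
      have "b\<^sup>2 - C = of_real (1 - t) * (b\<^sup>2 - y\<^sup>2)" by (simp add: C_def algebra_simps)
      then have "norm (b\<^sup>2 - C) = (1 - t) * norm (b\<^sup>2 - y\<^sup>2)"
        using t by (simp add: norm_mult del: of_real_diff)
      also have "\<dots> \<le> (1 - t) * (\<kappa> * (m2 - m1))" using B t by (intro mult_left_mono) auto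
      also have "\<dots> = \<kappa> * ((1 - t) * (m2 - m1))" by simp
      finally show ?thesis unfolding t' .
    qed
    have "low_extension s m1 (y\<^sup>2) \<le> low_extension s 1 C"
      using low_extension_mono[OF s \<kappa>_def m0 _ _ nB(1) C C1] m1 by simp
    also have "\<dots> = high_extension s 1 C" by (rule extensions_agree)
    also have "\<dots> \<le> high_extension s m2 (b\<^sup>2)"
      using high_extension_mono[OF s \<kappa>_def _ _ C nB(2) C2] m2 by simp
    finally show ?thesis
      using 3 by (simp add: two_point_mean_eq_low_extension[OF s'] two_point_mean_eq_high_extension[OF s'] m1_def m2_def)
  qed
qed

lemma two_point_mean_continuous:
  assumes "0 < s"
  shows "isCont (\<lambda>b. two_point_mean s b) b"
  unfolding two_point_mean_def using assms by (intro continuous_intros) auto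

text \<open>The hypothesis is homogeneous, so \<open>b\<close> and \<open>y\<close> can be scaled off the unit circle.\<close>

lemma two_point_mean_mono_critical:
  fixes b y :: complex
  assumes s: "1 < s" "s < 3 / 2"
    and le: "norm (b\<^sup>2 - y\<^sup>2) \<le> s / (s - 1) * ((norm b)\<^sup>2 - (norm y)\<^sup>2)"
  shows "two_point_mean s y \<le> two_point_mean s b"
proof (rule tendsto_le)
  have lim: "((\<lambda>t. two_point_mean s (of_real t * x)) \<longlongrightarrow> two_point_mean s x) (at_left 1)" for x
  proof -
    have "((\<lambda>t::real. of_real t * x) \<longlongrightarrow> of_real 1 * x) (at_left 1)" by (intro tendsto_intros)
    then show ?thesis
      using isCont_tendsto_compose[OF two_point_mean_continuous[of s "of_real 1 * x"]] s by simp
  qed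
  show "((\<lambda>t. two_point_mean s (of_real t * b)) \<longlongrightarrow> two_point_mean s b) (at_left 1)"
    and "((\<lambda>t. two_point_mean s (of_real t * y)) \<longlongrightarrow> two_point_mean s y) (at_left 1)"
    by (rule lim)+
  have ne: "eventually (\<lambda>t. norm (of_real t * x) \<noteq> 1) (at_left (1::real))" for x :: complex
  proof (cases "norm x \<le> 1")
    case True
    have "eventually (\<lambda>t. t \<in> {0<..<1}) (at_left (1::real))"
      by (rule eventually_at_left_real) simp
    then show ?thesis
    proof eventually_elim
      case (elim t)
      have "t * norm x \<le> t * 1" using True elim by (intro mult_left_mono) auto
      also have "t * 1 < 1" using elim by simp
      finally show ?case using elim by (simp add: norm_mult)
    qed
  next
    case False
    then have "1 / norm x < 1" by (auto simp: divide_less_eq_1)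
    then have "eventually (\<lambda>t. t \<in> {1 / norm x<..<1}) (at_left (1::real))"
      by (rule eventually_at_left_real)
    then show ?thesis
    proof eventually_elim
      case (elim t)
      have "0 < norm x" using False by linarith
      then have "1 < t * norm x" using elim by (simp add: divide_less_eq)
      moreover have "0 < t" using elim \<open>0 < norm x\<close> by (meson divide_pos_pos greaterThanLessThan_iff less_trans zero_less_one)
      ultimately show ?case by (simp add: norm_mult)
    qed
  qed
  show "eventually (\<lambda>t. two_point_mean s (of_real t * y) \<le> two_point_mean s (of_real t * b)) (at_left (1::real))"
    using ne[of b] ne[of y]
  proof eventually_elim
    case (elim t)
    have "(of_real t * b)\<^sup>2 - (of_real t * y)\<^sup>2 = of_real (t\<^sup>2) * (b\<^sup>2 - y\<^sup>2)"
      by (simp add: power_mult_distrib algebra_simps)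
    then have "norm ((of_real t * b)\<^sup>2 - (of_real t * y)\<^sup>2) = t\<^sup>2 * norm (b\<^sup>2 - y\<^sup>2)"
      by (simp only: norm_mult norm_of_real) simp
    also have "\<dots> \<le> t\<^sup>2 * (s / (s - 1) * ((norm b)\<^sup>2 - (norm y)\<^sup>2))"
      using le by (intro mult_left_mono) auto
    also have "\<dots> = s / (s - 1) * ((norm (of_real t * b))\<^sup>2 - (norm (of_real t * y))\<^sup>2)"
      by (simp add: norm_mult power_mult_distrib algebra_simps)
    finally show ?case using elim by (intro two_point_mean_mono_off_circle[OF s]) auto
  qed
qed simp

section \<open>The two-point inequality for exponents at least three\<close>

lemma has_real_derivative_abs_powr:
  fixes x r :: real
  assumes "1 < r"
  shows "((\<lambda>x. \<bar>x\<bar> powr r) has_real_derivative (r * \<bar>x\<bar> powr (r - 1) * sgn x)) (at x)"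
proof (cases "x = 0")
  case True
  have "((\<lambda>h. \<bar>h\<bar> powr (r - 1) * sgn h) \<longlongrightarrow> 0) (at (0::real))"
  proof (rule tendsto_rabs_zero_cancel)
    have "((\<lambda>h::real. \<bar>h\<bar> powr (r - 1)) \<longlongrightarrow> \<bar>0\<bar> powr (r - 1)) (at 0)"
      using assms by (intro tendsto_intros) auto
    then have "((\<lambda>h::real. \<bar>h\<bar> powr (r - 1)) \<longlongrightarrow> 0) (at 0)" using assms by simp
    then show "((\<lambda>h::real. \<bar>\<bar>h\<bar> powr (r - 1) * sgn h\<bar>) \<longlongrightarrow> 0) (at 0)"
      by (rule Lim_transform_eventually) (simp add: abs_mult eventually_at_filter abs_sgn_eq)
  qed
  moreover have "\<bar>h\<bar> powr (r - 1) * sgn h = (\<bar>0 + h\<bar> powr r - \<bar>0\<bar> powr r) / h" if "h \<noteq> 0" for h :: real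
    using that assms by (auto simp: powr_diff sgn_if abs_if)
  then have "eventually (\<lambda>h. \<bar>h\<bar> powr (r - 1) * sgn h = (\<bar>0 + h\<bar> powr r - \<bar>0\<bar> powr r) / h) (at (0::real))"
    by (simp add: eventually_at_filter)
  ultimately have "((\<lambda>h. (\<bar>0 + h\<bar> powr r - \<bar>0\<bar> powr r) / h) \<longlongrightarrow> 0) (at (0::real))"
    by (rule Lim_transform_eventually)
  then show ?thesis using True assms by (simp add: DERIV_def)
next
  case False
  have "(abs has_real_derivative sgn x) (at x)"
  proof (cases "0 < x")
    case True
    then have "((\<lambda>x. x) has_real_derivative sgn x) (at x)" by (auto intro!: derivative_eq_intros)
    then show ?thesis
      by (rule has_field_derivative_transform_within_open[where S = "{0<..}"]) (use True in auto)
  next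
    case 2: False
    then have "((\<lambda>x. - x) has_real_derivative sgn x) (at x)"
      using False by (auto intro!: derivative_eq_intros)
    then show ?thesis
      by (rule has_field_derivative_transform_within_open[where S = "{..<0}"]) (use False 2 in auto)
  qed
  moreover have "((\<lambda>x. x powr r) has_real_derivative r * \<bar>x\<bar> powr (r - 1)) (at \<bar>x\<bar>)"
    using False by (intro has_real_derivative_powr) auto
  ultimately show ?thesis by (rule DERIV_chain2[rotated])
qed

text \<open>The right side minus the left side vanishes at \<open>x = 1\<close> and decreases in \<open>x\<close>: up to the factor \<open>K + 1\<close> its
  derivative is \<open>K x\<^bsup>K-1\<^esup> - (K - 1) x\<^sup>K - 1\<close>, which is at most \<open>0\<close> by Young's inequality.\<close>

lemma trapezoid_powr:
  fixes x K :: real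
  assumes K: "1 \<le> K" and x: "0 \<le> x" "x \<le> 1"
  shows "(1 + x) * (1 - x powr K) \<le> K * (1 - x) * (1 + x powr K)"
proof (cases "K = 1")
  case True
  then show ?thesis using x by (simp add: mult.commute)
next
  case False
  then have K1: "1 < K" using K by simp
  define \<phi> where "\<phi> x = K * (1 - x) * (1 + x powr K) - (1 + x) * (1 - x powr K)" for x
  have "\<phi> 1 \<le> \<phi> x"
  proof (rule DERIV_nonpos_imp_decreasing_open[OF x(2)])
    show "continuous_on {x..1} \<phi>"
      unfolding \<phi>_def using x K
      by (intro continuous_on_powr' continuous_on_mult continuous_on_diff continuous_on_add
          continuous_on_const continuous_on_id) auto
    fix y assume y: "x < y" "y < 1"
    then have y0: "0 < y" using x by simp
    have "(\<phi> has_real_derivative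
        K * (1 - y) * (K * y powr (K - 1)) - K * (1 + y powr K)
          - ((1 - y powr K) - (1 + y) * (K * y powr (K - 1)))) (at y)"
      unfolding \<phi>_def using y0 by (auto intro!: derivative_eq_intros)
    moreover have "K * (1 - y) * (K * y powr (K - 1)) - K * (1 + y powr K)
          - ((1 - y powr K) - (1 + y) * (K * y powr (K - 1))) \<le> 0"
    proof -
      have yK: "y * y powr (K - 1) = y powr K" using y0 by (simp add: powr_diff)
      have "(y powr K) powr ((K - 1) / K) * 1 powr (1 / K) \<le> (K - 1) / K * y powr K + 1 / K * 1"
        by (rule Youngs_inequality_0) (use K1 y0 in \<open>auto simp: field_simps\<close>)
      then have "y powr (K - 1) \<le> (K - 1) / K * y powr K + 1 / K"
        using K1 by (simp add: powr_powr)
      then have "K * y powr (K - 1) \<le> K * ((K - 1) / K * y powr K + 1 / K)"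
        using K1 by (intro mult_left_mono) auto
      also have "\<dots> = (K - 1) * y powr K + 1" using K1 by (simp add: field_simps)
      finally have "K * y powr (K - 1) - (K - 1) * y powr K - 1 \<le> 0" by simp
      then have "(K + 1) * (K * y powr (K - 1) - (K - 1) * y powr K - 1) \<le> 0"
        using K1 by (simp add: mult_nonneg_nonpos)
      moreover have "K * (1 - y) * (K * y powr (K - 1)) - K * (1 + y powr K)
          - ((1 - y powr K) - (1 + y) * (K * y powr (K - 1)))
         = (K + 1) * (K * y powr (K - 1) - (K - 1) * y powr K - 1)"
        unfolding yK[symmetric] by (simp add: algebra_simps)
      ultimately show ?thesis by simp
    qed
    ultimately show "\<exists>d. (\<phi> has_real_derivative d) (at y) \<and> d \<le> 0" by blast
  qed
  then show ?thesis by (simp add: \<phi>_def)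
qed

text \<open>The homogeneous inequality \<open>(\<alpha> + \<beta>) (\<alpha>\<^sup>K - \<beta>\<^sup>K) \<le> K (\<alpha> - \<beta>) (\<alpha>\<^sup>K + \<beta>\<^sup>K)\<close> multiplied by
  \<open>\<alpha> + \<beta>\<close>; the normalization enters through \<open>(\<alpha> + \<beta>)\<^sup>2 \<ge> 4\<close>.\<close>

lemma powr_difference_le:
  fixes \<alpha> \<beta> K :: real
  assumes K: "1 \<le> K" and ab: "0 \<le> \<beta>" "\<beta> \<le> \<alpha>" "2 \<le> \<alpha> + \<beta>"
  shows "\<alpha> powr K - \<beta> powr K \<le> K / 4 * (\<alpha>\<^sup>2 - \<beta>\<^sup>2) * (\<alpha> powr K + \<beta> powr K)"
proof -
  have a0: "0 < \<alpha>" using ab by linarith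
  define x where "x = \<beta> / \<alpha>"
  have x: "0 \<le> x" "x \<le> 1" using ab a0 by (auto simp: x_def)
  have b: "\<beta> = x * \<alpha>" using a0 by (simp add: x_def)
  have bK: "\<beta> powr K = x powr K * \<alpha> powr K" using x a0 by (simp add: b powr_mult)
  have "(\<alpha> + \<beta>) * (\<alpha> powr K - \<beta> powr K) = \<alpha> * \<alpha> powr K * ((1 + x) * (1 - x powr K))"
    unfolding bK unfolding b by (simp add: algebra_simps)
  also have "\<dots> \<le> \<alpha> * \<alpha> powr K * (K * (1 - x) * (1 + x powr K))"
    using a0 trapezoid_powr[OF K x] by (intro mult_left_mono) auto
  also have "\<dots> = K * (\<alpha> - \<beta>) * (\<alpha> powr K + \<beta> powr K)"
    unfolding bK unfolding b by (simp add: algebra_simps)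
  finally have 1: "(\<alpha> + \<beta>) * (\<alpha> powr K - \<beta> powr K) \<le> K * (\<alpha> - \<beta>) * (\<alpha> powr K + \<beta> powr K)" .
  have d: "0 \<le> \<alpha> powr K - \<beta> powr K" using ab K by (simp add: powr_mono2)
  have "4 * (\<alpha> powr K - \<beta> powr K) \<le> (\<alpha> + \<beta>)\<^sup>2 * (\<alpha> powr K - \<beta> powr K)"
    using d ab power_mono[of 2 "\<alpha> + \<beta>" 2] by (intro mult_right_mono) auto
  also have "\<dots> = (\<alpha> + \<beta>) * ((\<alpha> + \<beta>) * (\<alpha> powr K - \<beta> powr K))" by (simp add: power2_eq_square)
  also have "\<dots> \<le> (\<alpha> + \<beta>) * (K * (\<alpha> - \<beta>) * (\<alpha> powr K + \<beta> powr K))"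
    using 1 ab by (intro mult_left_mono) auto
  also have "\<dots> = K * (\<alpha>\<^sup>2 - \<beta>\<^sup>2) * (\<alpha> powr K + \<beta> powr K)"
    by (simp add: power2_eq_square algebra_simps)
  finally show ?thesis by simp
qed

text \<open>Since \<open>|1 \<plusminus> b|\<^sup>2 = 1 + |b|\<^sup>2 \<plusminus> 2 Re b\<close> and \<open>(2 Re b)\<^sup>2 = 2 (|b|\<^sup>2 + Re b\<^sup>2)\<close>, the mean depends only on
  \<open>m = |b|\<^sup>2\<close> and \<open>h = Re b\<^sup>2\<close>, through \<open>S = 1 + m\<close> and \<open>q = 2 (m + h)\<close>.\<close>

definition split_mean :: "real \<Rightarrow> real \<Rightarrow> real \<Rightarrow> real" where
  "split_mean s S q = (\<bar>S + sqrt q\<bar> powr s + \<bar>S - sqrt q\<bar> powr s) / 2"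

lemma two_point_mean_eq_split_mean:
  "two_point_mean s b = split_mean s (1 + (norm b)\<^sup>2) (2 * ((norm b)\<^sup>2 + Re (b\<^sup>2)))"
proof -
  define S c where "S = 1 + (norm b)\<^sup>2" and "c = 2 * Re b"
  have nb: "(norm b)\<^sup>2 = (Re b)\<^sup>2 + (Im b)\<^sup>2" by (rule cmod_power2)
  have A: "(norm (1 + b))\<^sup>2 = S + c" "(norm (1 - b))\<^sup>2 = S - c"
    by (simp_all add: S_def c_def cmod_power2) (simp_all add: power2_eq_square algebra_simps)
  have p: "norm z powr (2 * s) = (norm z)\<^sup>2 powr s" for z :: complex
    by (cases "z = 0") (simp_all add: powr_powr[symmetric] powr_numeral)
  have "2 * ((norm b)\<^sup>2 + Re (b\<^sup>2)) = c\<^sup>2"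
    unfolding nb by (simp add: c_def power2_eq_square algebra_simps)
  then have q: "sqrt (2 * ((norm b)\<^sup>2 + Re (b\<^sup>2))) = \<bar>c\<bar>" by simp
  have "two_point_mean s b = (\<bar>S + c\<bar> powr s + \<bar>S - c\<bar> powr s) / 2"
    unfolding two_point_mean_def p A by (simp flip: A)
  also have "\<dots> = split_mean s S (2 * ((norm b)\<^sup>2 + Re (b\<^sup>2)))"
    unfolding split_mean_def q by (cases "0 \<le> c") (simp_all add: add.commute)
  finally show ?thesis by (simp add: S_def)
qed

text \<open>For \<open>s \<ge> 3/2\<close> the real part of the hypothesis suffices. On the segment between the two points \<open>(m, h)\<close>
  the derivative of the mean is nonnegative by the bound on \<open>A\<^sup>k - B\<^sup>k\<close>, applied to the square roots of
  \<open>A = S + \<surd>q\<close> and \<open>B = S - \<surd>q\<close>; these square roots have sum at least \<open>2\<close> because \<open>|h| \<le> m\<close>.\<close>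

lemma two_point_mean_mono_large:
  fixes b y :: complex
  assumes s: "3 / 2 \<le> s"
    and le: "norm (b\<^sup>2 - y\<^sup>2) \<le> s / (s - 1) * ((norm b)\<^sup>2 - (norm y)\<^sup>2)"
  shows "two_point_mean s y \<le> two_point_mean s b"
proof -
  define m1 m2 h1 h2 where "m1 = (norm y)\<^sup>2" and "m2 = (norm b)\<^sup>2" and "h1 = Re (y\<^sup>2)" and "h2 = Re (b\<^sup>2)"
  define k where "k = s - 1"
  have k: "1 / 2 \<le> k" using s by (simp add: k_def)
  have \<kappa>: "s / (s - 1) = 1 + 1 / k" using s by (simp add: k_def field_simps)
  have le': "norm (b\<^sup>2 - y\<^sup>2) \<le> (1 + 1 / k) * (m2 - m1)" using le by (simp add: \<kappa> m1_def m2_def)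
  then have "0 \<le> (1 + 1 / k) * (m2 - m1)" using norm_ge_zero order_trans by blast
  moreover have "0 < 1 + 1 / k" using k by (simp add: add_pos_pos)
  ultimately have m: "m1 \<le> m2" by (simp add: zero_le_mult_iff)
  have h: "h1 - h2 \<le> (1 + 1 / k) * (m2 - m1)"
  proof -
    have "h1 - h2 \<le> \<bar>Re (b\<^sup>2 - y\<^sup>2)\<bar>" by (simp add: h1_def h2_def)
    also have "\<dots> \<le> norm (b\<^sup>2 - y\<^sup>2)" by (rule abs_Re_le_cmod)
    finally show ?thesis using le' by simp
  qed
  have r1: "\<bar>h1\<bar> \<le> m1" and r2: "\<bar>h2\<bar> \<le> m2"
    using abs_Re_le_cmod[of "y\<^sup>2"] abs_Re_le_cmod[of "b\<^sup>2"] by (auto simp: m1_def m2_def h1_def h2_def norm_power)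
  have m0: "0 \<le> m1" by (simp add: m1_def)
  define \<mu> \<eta> where "\<mu> t = m1 + t * (m2 - m1)" and "\<eta> t = h1 + t * (h2 - h1)" for t
  define q where "q t = 2 * (\<mu> t + \<eta> t)" for t
  define V where "V t = split_mean s (1 + \<mu> t) (q t)" for t
  have "V 0 \<le> V 1"
  proof (cases "q 0 = 0 \<and> q 1 = 0")
    case True
    then show ?thesis
      using m m0 s by (simp add: V_def split_mean_def \<mu>_def powr_mono2)
  next
    case False
    have conv: "\<mu> t = (1 - t) * m1 + t * m2" "\<eta> t = (1 - t) * h1 + t * h2" for t
      by (auto simp: \<mu>_def \<eta>_def algebra_simps)
    have qc: "q t = (1 - t) * q 0 + t * q 1" for t
      by (simp add: q_def \<mu>_def \<eta>_def algebra_simps)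
    have q01: "0 \<le> q 0" "0 \<le> q 1" using r1 r2 by (auto simp: q_def \<mu>_def \<eta>_def)
    show ?thesis
    proof (rule DERIV_nonneg_imp_increasing_open[of 0 1 V])
      show "continuous_on {0..1} V"
        unfolding V_def split_mean_def q_def \<mu>_def \<eta>_def using s
        by (intro continuous_on_powr' continuous_on_mult continuous_on_diff continuous_on_add
            continuous_on_divide continuous_on_rabs continuous_on_real_sqrt
            continuous_on_const continuous_on_id) auto
    next
      fix t :: real assume t: "0 < t" "t < 1"
      have qt: "0 < q t"
      proof -
        have "0 \<le> (1 - t) * q 0" "0 \<le> t * q 1" using t q01 by auto
        moreover have "0 < (1 - t) * q 0 \<or> 0 < t * q 1" using False t q01 by auto
        ultimately show ?thesis unfolding qc[of t] by linarith
      qed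
      have \<mu>t: "\<bar>\<eta> t\<bar> \<le> \<mu> t" "0 \<le> \<mu> t"
      proof -
        have "\<bar>\<eta> t\<bar> \<le> (1 - t) * \<bar>h1\<bar> + t * \<bar>h2\<bar>"
          unfolding conv using t by (intro order_trans[OF abs_triangle_ineq]) (simp add: abs_mult)
        also have "\<dots> \<le> (1 - t) * m1 + t * m2"
          using t r1 r2 by (intro add_mono mult_left_mono) auto
        finally show "\<bar>\<eta> t\<bar> \<le> \<mu> t" by (simp add: conv)
        then show "0 \<le> \<mu> t" by linarith
      qed
      define c A B where "c = sqrt (q t)" and "A = 1 + \<mu> t + c" and "B = 1 + \<mu> t - c"
      have c: "0 < c" "c\<^sup>2 = q t" using qt by (auto simp: c_def)
      have AB: "A * B = 1 + (\<mu> t)\<^sup>2 - 2 * \<eta> t"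
      proof -
        have "A * B = (1 + \<mu> t)\<^sup>2 - c\<^sup>2" by (simp add: A_def B_def power2_eq_square algebra_simps)
        then show ?thesis unfolding c q_def by (simp add: power2_eq_square algebra_simps)
      qed
      have ABge: "(1 - \<mu> t)\<^sup>2 \<le> A * B"
        using \<mu>t unfolding AB by (simp add: power2_eq_square algebra_simps)
      have A0: "0 < A" using \<mu>t c by (simp add: A_def)
      have B0: "0 \<le> B"
      proof -
        have "0 \<le> A * B" using ABge zero_le_power2 order_trans by blast
        then show ?thesis using A0 by (simp add: zero_le_mult_iff)
      qed
      have key: "A powr k - B powr k \<le> k * c * (A powr k + B powr k)"
      proof -
        define \<alpha> \<beta> where "\<alpha> = sqrt A" and "\<beta> = sqrt B"
        have ab: "0 \<le> \<beta>" "\<beta> \<le> \<alpha>" "\<alpha>\<^sup>2 = A" "\<beta>\<^sup>2 = B"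
          using A0 B0 c by (auto simp: \<alpha>_def \<beta>_def A_def B_def)
        have "(1 - \<mu> t)\<^sup>2 \<le> (\<alpha> * \<beta>)\<^sup>2" using ABge ab by (simp add: power_mult_distrib)
        then have "\<bar>1 - \<mu> t\<bar> \<le> \<alpha> * \<beta>"
          using ab by (metis abs_le_square_iff abs_of_nonneg mult_nonneg_nonneg order_trans)
        moreover have "(\<alpha> + \<beta>)\<^sup>2 = 2 + 2 * \<mu> t + 2 * (\<alpha> * \<beta>)"
          using ab by (simp add: power2_sum A_def B_def)
        ultimately have "2\<^sup>2 \<le> (\<alpha> + \<beta>)\<^sup>2" by (simp add: abs_le_iff)
        then have "2 \<le> \<alpha> + \<beta>" by (rule power2_le_imp_le) (use ab in auto)
        then have "\<alpha> powr (2 * k) - \<beta> powr (2 * k)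
            \<le> (2 * k) / 4 * (\<alpha>\<^sup>2 - \<beta>\<^sup>2) * (\<alpha> powr (2 * k) + \<beta> powr (2 * k))"
          using k ab by (intro powr_difference_le) auto
        moreover have "\<alpha> powr (2 * k) = A powr k" "\<beta> powr (2 * k) = B powr k"
          using A0 B0 by (auto simp: \<alpha>_def \<beta>_def powr_half_sqrt[symmetric] powr_powr)
        moreover have "\<alpha>\<^sup>2 - \<beta>\<^sup>2 = 2 * c" using ab by (simp add: A_def B_def)
        ultimately show ?thesis by simp
      qed
      define \<Delta> \<rho> where "\<Delta> = m2 - m1" and "\<rho> = (\<Delta> + (h2 - h1)) / c"
      have d\<mu>: "(\<mu> has_real_derivative \<Delta>) (at t)"
        unfolding \<mu>_def \<Delta>_def by (auto intro!: derivative_eq_intros)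
      have dq: "(q has_real_derivative 2 * (\<Delta> + (h2 - h1))) (at t)"
        unfolding q_def \<mu>_def \<eta>_def \<Delta>_def by (auto intro!: derivative_eq_intros)
      have dc: "((\<lambda>t. sqrt (q t)) has_real_derivative \<rho>) (at t)"
      proof -
        have "inverse (sqrt (q t)) / 2 * (2 * (\<Delta> + (h2 - h1))) = \<rho>"
          using c(1) by (simp add: \<rho>_def c_def field_simps)
        then show ?thesis using DERIV_chain2[OF DERIV_real_sqrt[OF qt] dq] by (simp only:)
      qed
      have dA: "((\<lambda>t. 1 + \<mu> t + sqrt (q t)) has_real_derivative (\<Delta> + \<rho>)) (at t)"
        and dB: "((\<lambda>t. 1 + \<mu> t - sqrt (q t)) has_real_derivative (\<Delta> - \<rho>)) (at t)"
        using DERIV_add[OF DERIV_add[OF DERIV_const d\<mu>] dc] DERIV_diff[OF DERIV_add[OF DERIV_const d\<mu>] dc]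
        by simp_all
      have s1: "1 < s" using s by simp
      have absd: "s * \<bar>x\<bar> powr (s - 1) * sgn x = s * x powr k" if "0 \<le> x" for x
        using that k by (cases "x = 0") (auto simp: k_def)
      have "((\<lambda>t. \<bar>1 + \<mu> t + sqrt (q t)\<bar> powr s) has_real_derivative (s * A powr k) * (\<Delta> + \<rho>)) (at t)"
        using DERIV_chain2[OF has_real_derivative_abs_powr[OF s1] dA]
        unfolding c_def[symmetric] A_def[symmetric] absd[OF less_imp_le[OF A0]] .
      moreover have "((\<lambda>t. \<bar>1 + \<mu> t - sqrt (q t)\<bar> powr s) has_real_derivative (s * B powr k) * (\<Delta> - \<rho>)) (at t)"
        using DERIV_chain2[OF has_real_derivative_abs_powr[OF s1] dB]
        unfolding c_def[symmetric] B_def[symmetric] absd[OF B0] .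
      ultimately have dV: "(V has_real_derivative
          ((s * A powr k) * (\<Delta> + \<rho>) + (s * B powr k) * (\<Delta> - \<rho>)) / 2) (at t)"
        unfolding V_def split_mean_def by (intro DERIV_cdivide DERIV_add)
      have "0 \<le> (A powr k + B powr k) * \<Delta> + \<rho> * (A powr k - B powr k)"
      proof -
        have D0: "0 \<le> \<Delta>" using m by (simp add: \<Delta>_def)
        have d0: "0 \<le> A powr k - B powr k" using B0 c k by (simp add: A_def B_def powr_mono2)
        have "- (\<Delta> / k) \<le> \<Delta> + (h2 - h1)" using h by (simp add: \<Delta>_def algebra_simps)
        then have "- (\<Delta> / k) / c \<le> \<rho>" unfolding \<rho>_def using c by (intro divide_right_mono) auto
        then have "- (\<Delta> / (k * c)) * (A powr k - B powr k) \<le> \<rho> * (A powr k - B powr k)"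
          using d0 by (intro mult_right_mono) (auto simp: field_simps)
        moreover have "\<Delta> / (k * c) * (A powr k - B powr k) \<le> \<Delta> / (k * c) * (k * c * (A powr k + B powr k))"
          using key D0 k c by (intro mult_left_mono) auto
        moreover have "\<Delta> / (k * c) * (k * c * (A powr k + B powr k)) = \<Delta> * (A powr k + B powr k)"
          using k c by simp
        ultimately show ?thesis by (simp add: algebra_simps)
      qed
      then have "0 \<le> s * ((A powr k + B powr k) * \<Delta> + \<rho> * (A powr k - B powr k))" using s by simp
      then have "0 \<le> ((s * A powr k) * (\<Delta> + \<rho>) + (s * B powr k) * (\<Delta> - \<rho>)) / 2"
        by (simp add: algebra_simps)
      with dV show "\<exists>d. (V has_real_derivative d) (at t) \<and> 0 \<le> d" by blast
    qed simp
  qed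
  then show ?thesis
    unfolding two_point_mean_eq_split_mean by (simp add: V_def q_def \<mu>_def \<eta>_def m1_def m2_def h1_def h2_def)
qed

section \<open>The lens of complex contractions\<close>

lemma Holder_inequality_sum:
  fixes a b :: "'a \<Rightarrow> real"
  assumes I: "finite I" and p: "1 < p" "1 < q" "1 / p + 1 / q = 1"
    and a: "\<And>i. i \<in> I \<Longrightarrow> 0 \<le> a i" and b: "\<And>i. i \<in> I \<Longrightarrow> 0 \<le> b i"
  shows "(\<Sum>i\<in>I. a i * b i) \<le> (\<Sum>i\<in>I. a i powr p) powr (1 / p) * (\<Sum>i\<in>I. b i powr q) powr (1 / q)"
proof -
  define A B where "A = (\<Sum>i\<in>I. a i powr p)" and "B = (\<Sum>i\<in>I. b i powr q)"
  have A0: "0 \<le> A" and B0: "0 \<le> B" by (auto simp: A_def B_def intro: sum_nonneg)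
  show ?thesis
  proof (cases "A = 0 \<or> B = 0")
    case True
    then have "(\<forall>i\<in>I. a i = 0) \<or> (\<forall>i\<in>I. b i = 0)"
      using I by (auto simp: A_def B_def sum_nonneg_eq_0_iff)
    then have "(\<Sum>i\<in>I. a i * b i) = 0" by (intro sum.neutral) auto
    then show ?thesis by simp
  next
    case False
    then have pos: "0 < A" "0 < B" using A0 B0 by auto
    define \<alpha> \<beta> where "\<alpha> = A powr (1 / p)" and "\<beta> = B powr (1 / q)"
    have ab: "0 < \<alpha>" "0 < \<beta>" "\<alpha> powr p = A" "\<beta> powr q = B"
      using pos p by (auto simp: \<alpha>_def \<beta>_def powr_powr)
    have "(\<Sum>i\<in>I. a i * b i) / (\<alpha> * \<beta>) = (\<Sum>i\<in>I. (a i / \<alpha>) * (b i / \<beta>))"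
      by (simp add: sum_divide_distrib)
    also have "\<dots> \<le> (\<Sum>i\<in>I. (a i / \<alpha>) powr p / p + (b i / \<beta>) powr q / q)"
      by (intro sum_mono Youngs_inequality p divide_nonneg_pos a b ab)
    also have "\<dots> = (\<Sum>i\<in>I. a i powr p) / A / p + (\<Sum>i\<in>I. b i powr q) / B / q"
    proof -
      have "(\<Sum>i\<in>I. (a i / \<alpha>) powr p / p + (b i / \<beta>) powr q / q)
          = (\<Sum>i\<in>I. a i powr p / A / p + b i powr q / B / q)"
        by (intro sum.cong refl) (use ab a b in \<open>simp add: powr_divide\<close>)
      then show ?thesis by (simp add: sum.distrib sum_divide_distrib)
    qed
    also have "\<dots> = 1" using pos p by (simp add: A_def[symmetric] B_def[symmetric])
    finally show ?thesis using ab by (simp add: divide_le_eq \<alpha>_def \<beta>_def A_def B_def)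
  qed
qed

text \<open>The function \<open>w \<mapsto> |w|\<^sup>p / w\<close>, continued by \<open>0\<close>; composing it with \<open>f\<close> gives the functional that
  norms \<open>f\<close> in \<open>L\<^sub>p\<close>, up to a factor.\<close>

definition norming :: "real \<Rightarrow> complex \<Rightarrow> complex" where
  "norming p w = cnj w * of_real (norm w powr (p - 2))"

lemma norm_norming: "norm (norming p w) = norm w powr (p - 1)"
proof (cases "w = 0")
  case False
  have "norm (norming p w) = norm w powr 1 * norm w powr (p - 2)" by (simp add: norming_def norm_mult)
  also have "\<dots> = norm w powr (1 + (p - 2))" by (rule powr_add[symmetric])
  finally show ?thesis by simp
qed (simp add: norming_def)

lemma mult_norming:
  assumes "0 < p"
  shows "w * norming p w = of_real (norm w powr p)"
proof (cases "w = 0")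
  case False
  have "w * norming p w = (w * cnj w) * of_real (norm w powr (p - 2))" by (simp add: norming_def)
  also have "\<dots> = of_real ((norm w)\<^sup>2 * norm w powr (p - 2))"
    by (simp only: complex_norm_square[symmetric] of_real_mult)
  also have "(norm w)\<^sup>2 * norm w powr (p - 2) = norm w powr p"
    using False by (simp add: powr_diff powr_numeral)
  finally show ?thesis .
qed (use assms in \<open>simp add: norming_def\<close>)

text \<open>For \<open>p \<noteq> 2\<close> this region is bounded by two circular arcs through \<open>-1\<close> and \<open>1\<close> that enclose the angle
  \<open>theta p\<close>; for \<open>p = 2\<close> it is the unit disc.\<close>

definition contraction_lens :: "real \<Rightarrow> complex set" where
  "contraction_lens p = {z. \<bar>p - 2\<bar> * norm (1 - z\<^sup>2) \<le> p * (1 - (norm z)\<^sup>2)}"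

text \<open>With \<open>a = 1\<close>, membership of \<open>z\<close> in the lens is the hypothesis
  \<open>|b\<^sup>2 - y\<^sup>2| \<le> s / (s - 1) (|b|\<^sup>2 - |y|\<^sup>2)\<close> for \<open>y = zb\<close> and \<open>s = p / 2\<close>.\<close>

lemma two_point_lens_gt_two:
  assumes p: "2 < p" and z: "z \<in> contraction_lens p"
  shows "norm (a + z * b) powr p + norm (a - z * b) powr p \<le> norm (a + b) powr p + norm (a - b) powr p"
proof (cases "a = 0")
  case True
  have "0 \<le> p * (1 - (norm z)\<^sup>2)"
    using z by (auto simp: contraction_lens_def intro: order_trans[rotated])
  then have "(norm z)\<^sup>2 \<le> 1" using p by (simp add: zero_le_mult_iff)
  then have "norm z \<le> 1" using abs_square_le_1[of "norm z"] by simp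
  then have "norm (z * b) \<le> norm b" by (simp add: norm_mult mult_left_le_one_le)
  then have "norm (z * b) powr p \<le> norm b powr p" using p by (intro powr_mono2) auto
  then show ?thesis using True by simp
next
  case False
  define s \<beta> where "s = p / 2" and "\<beta> = b / a"
  have s: "1 < s" and sp: "2 * s = p" using p by (auto simp: s_def)
  have scale: "norm (a + c) powr p + norm (a - c) powr p = norm a powr p * (2 * two_point_mean s (c / a))" for c
  proof -
    have "a + c = a * (1 + c / a)" "a - c = a * (1 - c / a)" using False by (auto simp: field_simps)
    then have "norm (a + c) = norm a * norm (1 + c / a)" "norm (a - c) = norm a * norm (1 - c / a)"
      by (metis norm_mult)+
    then show ?thesis unfolding two_point_mean_def sp by (simp add: powr_mult algebra_simps)
  qed
  have "two_point_mean s (z * \<beta>) \<le> two_point_mean s \<beta>"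
  proof -
    have "(p - 2) * norm (1 - z\<^sup>2) \<le> p * (1 - (norm z)\<^sup>2)"
      using z p by (simp add: contraction_lens_def)
    then have "norm (1 - z\<^sup>2) \<le> p / (p - 2) * (1 - (norm z)\<^sup>2)"
      using p by (simp add: field_simps)
    moreover have "p / (p - 2) = s / (s - 1)" using p by (simp add: s_def field_simps)
    ultimately have "norm (1 - z\<^sup>2) \<le> s / (s - 1) * (1 - (norm z)\<^sup>2)" by simp
    then have "(norm \<beta>)\<^sup>2 * norm (1 - z\<^sup>2) \<le> (norm \<beta>)\<^sup>2 * (s / (s - 1) * (1 - (norm z)\<^sup>2))"
      by (rule mult_left_mono) simp
    moreover have "(norm \<beta>)\<^sup>2 * norm (1 - z\<^sup>2) = norm (\<beta>\<^sup>2 - (z * \<beta>)\<^sup>2)"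
      unfolding norm_power[symmetric] norm_mult[symmetric] by (simp add: algebra_simps power_mult_distrib)
    ultimately have "norm (\<beta>\<^sup>2 - (z * \<beta>)\<^sup>2) \<le> s / (s - 1) * ((norm \<beta>)\<^sup>2 - (norm (z * \<beta>))\<^sup>2)"
      by (simp add: norm_mult power_mult_distrib algebra_simps)
    then show ?thesis
      using two_point_mean_mono_critical[of s \<beta> "z * \<beta>"] two_point_mean_mono_large[of s \<beta> "z * \<beta>"] s
      by (cases "s < 3 / 2") auto
  qed
  then have "norm a powr p * (2 * two_point_mean s (z * \<beta>)) \<le> norm a powr p * (2 * two_point_mean s \<beta>)"
    by (intro mult_left_mono) auto
  then show ?thesis unfolding scale by (simp add: \<beta>_def)
qed

text \<open>Duality: the adjoint of \<open>(a + b, a - b) \<mapsto> (a + zb, a - zb)\<close> is the same map for the conjugate of \<open>z\<close>, and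
  conjugate exponents have the same lens. The vector with entries \<open>\<xi> x\<close> and \<open>\<xi> y\<close> below norms the image vector.\<close>

lemma two_point_lens_lt_two:
  assumes p: "1 < p" "p < 2" and z: "z \<in> contraction_lens p"
  shows "norm (a + z * b) powr p + norm (a - z * b) powr p \<le> norm (a + b) powr p + norm (a - b) powr p"
proof -
  define p' where "p' = p / (p - 1)"
  have p': "2 < p'" "1 / p + 1 / p' = 1" "(p - 1) * p' = p" "1 < p'"
    using p by (auto simp: p'_def field_simps)
  have "cnj z \<in> contraction_lens p'"
  proof -
    have "norm (1 - (cnj z)\<^sup>2) = norm (cnj (1 - z\<^sup>2))" by simp
    then have n: "norm (1 - (cnj z)\<^sup>2) = norm (1 - z\<^sup>2)" by (simp only: complex_mod_cnj)
    have "\<bar>p' - 2\<bar> = \<bar>p - 2\<bar> * (p' / p)" using p p' by (simp add: p'_def field_simps)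
    then have "\<bar>p' - 2\<bar> * norm (1 - (cnj z)\<^sup>2) = (p' / p) * (\<bar>p - 2\<bar> * norm (1 - z\<^sup>2))"
      by (simp add: n)
    also have "\<dots> \<le> (p' / p) * (p * (1 - (norm z)\<^sup>2))"
      using z p p' by (intro mult_left_mono) (auto simp: contraction_lens_def)
    also have "\<dots> = p' * (1 - (norm (cnj z))\<^sup>2)" using p by simp
    finally show ?thesis by (simp add: contraction_lens_def)
  qed
  note dual = two_point_lens_gt_two[OF p'(1) this]
  define x y where "x = a + z * b" and "y = a - z * b"
  define \<xi> where "\<xi> w = cnj (norming p w)" for w
  have \<xi>n: "norm (\<xi> w) powr p' = norm w powr p" for w
    using p' by (simp add: \<xi>_def norm_norming powr_powr)
  have \<xi>m: "w * cnj (\<xi> w) = of_real (norm w powr p)" for w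
    using p by (simp add: \<xi>_def mult_norming)
  define \<alpha> \<beta> where "\<alpha> = (\<xi> x + \<xi> y) / 2" and "\<beta> = (\<xi> x - \<xi> y) / 2"
  have \<xi>xy: "\<xi> x = \<alpha> + \<beta>" "\<xi> y = \<alpha> - \<beta>" by (auto simp: \<alpha>_def \<beta>_def field_simps)
  define X U where "X = norm x powr p + norm y powr p" and "U = norm (a + b) powr p + norm (a - b) powr p"
  have X0: "0 \<le> X" and U0: "0 \<le> U" by (auto simp: X_def U_def)
  have "of_real X = x * cnj (\<xi> x) + y * cnj (\<xi> y)" by (simp add: X_def \<xi>m)
  also have "\<dots> = (a + b) * cnj (\<alpha> + cnj z * \<beta>) + (a - b) * cnj (\<alpha> - cnj z * \<beta>)"
    unfolding \<xi>xy unfolding x_def y_def by (simp add: algebra_simps)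
  finally have "X = norm ((a + b) * cnj (\<alpha> + cnj z * \<beta>) + (a - b) * cnj (\<alpha> - cnj z * \<beta>))"
    using X0 by (metis abs_of_nonneg norm_of_real)
  also have "\<dots> \<le> norm (a + b) * norm (\<alpha> + cnj z * \<beta>) + norm (a - b) * norm (\<alpha> - cnj z * \<beta>)"
    by (rule order_trans[OF norm_triangle_ineq]) (simp only: norm_mult complex_mod_cnj order_refl)
  also have "\<dots> = (\<Sum>t\<in>UNIV. (if t then norm (a + b) else norm (a - b)) *
      (if t then norm (\<alpha> + cnj z * \<beta>) else norm (\<alpha> - cnj z * \<beta>)))"
    by (simp add: UNIV_bool)
  also have "\<dots> \<le> (\<Sum>t\<in>UNIV. (if t then norm (a + b) else norm (a - b)) powr p) powr (1 / p)
      * (\<Sum>t\<in>UNIV. (if t then norm (\<alpha> + cnj z * \<beta>) else norm (\<alpha> - cnj z * \<beta>)) powr p') powr (1 / p')"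
    by (rule Holder_inequality_sum) (use p p' in auto)
  also have "\<dots> = U powr (1 / p) * (norm (\<alpha> + cnj z * \<beta>) powr p' + norm (\<alpha> - cnj z * \<beta>) powr p') powr (1 / p')"
    by (simp add: UNIV_bool U_def add.commute)
  also have "\<dots> \<le> U powr (1 / p) * X powr (1 / p')"
  proof -
    have "norm (\<alpha> + cnj z * \<beta>) powr p' + norm (\<alpha> - cnj z * \<beta>) powr p' \<le> X"
      using dual[of \<alpha> \<beta>] by (simp add: \<xi>xy[symmetric] \<xi>n X_def)
    then show ?thesis using p' by (intro mult_left_mono powr_mono2) auto
  qed
  finally have le: "X \<le> U powr (1 / p) * X powr (1 / p')" .
  have "X \<le> U"
  proof (cases "X = 0")
    case False
    then have Xp: "0 < X" using X0 by simp
    have "X = X powr (1 / p) * X powr (1 / p')"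
      using Xp p'(2) by (simp add: powr_add[symmetric])
    then have "X powr (1 / p) * X powr (1 / p') \<le> U powr (1 / p) * X powr (1 / p')" using le by simp
    then have "X powr (1 / p) \<le> U powr (1 / p)" using Xp by simp
    then have "(X powr (1 / p)) powr p \<le> (U powr (1 / p)) powr p" by (rule powr_mono2[rotated 2]) (use p in auto)
    then show ?thesis using p X0 U0 by (simp add: powr_powr)
  qed (use U0 in simp)
  then show ?thesis by (simp add: X_def U_def x_def y_def)
qed

theorem two_point_lens:
  assumes p: "1 < p" and z: "z \<in> contraction_lens p"
  shows "norm (a + z * b) powr p + norm (a - z * b) powr p \<le> norm (a + b) powr p + norm (a - b) powr p"
proof -
  consider "p < 2" | "p = 2" | "2 < p" by linarith
  then show ?thesis
  proof cases
    case 2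
    have par: "(norm (a + c))\<^sup>2 + (norm (a - c))\<^sup>2 = 2 * ((norm a)\<^sup>2 + (norm c)\<^sup>2)" for c
      by (simp add: cmod_power2) (simp add: power2_eq_square algebra_simps)
    have "(norm z)\<^sup>2 \<le> 1" using z by (simp add: contraction_lens_def 2)
    then have "(norm (z * b))\<^sup>2 \<le> (norm b)\<^sup>2"
      by (simp add: norm_mult power_mult_distrib mult_left_le_one_le)
    then show ?thesis using par[of b] par[of "z * b"] by (simp add: 2 powr_numeral)
  qed (use two_point_lens_lt_two two_point_lens_gt_two p z in auto)
qed

section \<open>Two-point hypercontractivity\<close>

text \<open>The factors of \<open>(p gchoose (2k))\<close> beyond the first two are \<open>p - j\<close> with \<open>j \<ge> 2 \<ge> p\<close>, and \<open>|p - j|\<close>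
  decreases in \<open>p\<close>.\<close>

lemma gbinomial_even_compare:
  fixes p q :: real
  assumes q: "1 < q" "q < p" "p \<le> 2" and k: "0 < k"
  shows "q * (q - 1) * (p gchoose (2 * k)) \<le> p * (p - 1) * (q gchoose (2 * k))"
    and "0 \<le> (p gchoose (2 * k))"
proof -
  have step: "(a gchoose (2 * Suc k)) = (a gchoose (2 * k)) * ((2 * real k - a) * (2 * real k + 1 - a)
      / ((2 * real k + 1) * (2 * real k + 2)))" for a :: real and k
    using gbinomial_Suc_factor[of a "Suc (2 * k)"] gbinomial_Suc_factor[of a "2 * k"]
    by (simp add: divide_simps) (simp add: algebra_simps)
  have two: "(a gchoose 2) = a * (a - 1) / 2" for a :: real
    using gbinomial_Suc_factor[of a 1] by (simp add: numeral_2_eq_2)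
  have "q * (q - 1) * (p gchoose (2 * k)) \<le> p * (p - 1) * (q gchoose (2 * k)) \<and> 0 \<le> (p gchoose (2 * k))"
    using k
  proof (induction k rule: nat_induct_non_zero)
    case 1
    show ?case using q by (simp add: two mult_ac)
  next
    case (Suc k)
    define c where "c a = (2 * real k - a) * (2 * real k + 1 - a) / ((2 * real k + 1) * (2 * real k + 2))" for a
    have k1: "1 \<le> real k" using Suc by simp
    have c: "0 \<le> c p" "c p \<le> c q"
      unfolding c_def using k1 q by (auto intro!: divide_nonneg_nonneg divide_right_mono mult_mono)
    have e: "(a gchoose (2 * Suc k)) = (a gchoose (2 * k)) * c a" for a unfolding c_def by (rule step)
    have q0: "0 \<le> p * (p - 1) * (q gchoose (2 * k))"
    proof -
      have "0 \<le> q * (q - 1) * (p gchoose (2 * k))" using Suc q by (intro mult_nonneg_nonneg) auto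
      then show ?thesis using Suc by linarith
    qed
    have "q * (q - 1) * (p gchoose (2 * k)) * c p \<le> p * (p - 1) * (q gchoose (2 * k)) * c q"
      by (rule mult_mono[OF conjunct1[OF Suc.IH] c(2) q0 c(1)])
    then show ?case using Suc c unfolding e by (simp add: mult_ac)
  qed
  then show "q * (q - 1) * (p gchoose (2 * k)) \<le> p * (p - 1) * (q gchoose (2 * k))"
    and "0 \<le> (p gchoose (2 * k))" by auto
qed

lemma even_binomial_sums:
  fixes a x :: real
  assumes "\<bar>x\<bar> < 1"
  shows "(\<lambda>k. (a gchoose (2 * k)) * x ^ (2 * k)) sums (((1 + x) powr a + (1 - x) powr a) / 2)"
proof -
  have e: "(-1) ^ k * ((a gchoose k) * x ^ k) = (a gchoose k) * (- x) ^ k" for k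
    unfolding power_minus[of x] by (simp only: mult_ac)
  have "(\<lambda>k. (-1) ^ k * ((a gchoose k) * x ^ k)) sums (1 - x) powr a"
    unfolding e using gen_binomial_real[of "- x" a] assms by simp
  with gen_binomial_real[OF assms] show ?thesis by (rule sums_even_part)
qed

text \<open>The norm of \<open>(u, v)\<close> for nonnegative \<open>u\<close>, \<open>v\<close> in \<open>L\<^sub>p\<close> of the uniform probability measure on two points.\<close>

definition two_point_norm :: "real \<Rightarrow> real \<Rightarrow> real \<Rightarrow> real" where
  "two_point_norm p u v = ((u powr p + v powr p) / 2) powr (1 / p)"

definition noise :: "real \<Rightarrow> real \<Rightarrow> real \<Rightarrow> real" where
  "noise r u v = (1 + r) / 2 * u + (1 - r) / 2 * v"

text \<open>Expand both sides in even powers of \<open>x\<close>. The exponent \<open>q / p\<close> is removed from the left side by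
  \<open>y\<^bsup>q/p\<^esup> \<le> 1 + (q / p) (y - 1)\<close>, and then the coefficients are compared one by one: the first factor
  \<open>r\<^sup>2\<close> compensates the ratio \<open>(p - 1) / (q - 1)\<close>.\<close>

lemma two_point_hypercontractive_normalized:
  fixes p q r x :: real
  assumes q: "1 < q" "q < p" "p \<le> 2" and r: "r = sqrt ((q - 1) / (p - 1))" and x: "0 \<le> x" "x < 1"
  shows "two_point_norm p (1 + r * x) (1 - r * x) \<le> two_point_norm q (1 + x) (1 - x)"
proof -
  have r2: "r\<^sup>2 = (q - 1) / (p - 1)" and r01: "0 \<le> r" "r \<le> 1" using q by (auto simp: r)
  have rx: "0 \<le> r * x" "r * x < 1"
    using r01 x mult_mono[of r 1 x x] by auto
  define Sp Sq where "Sp = ((1 + r * x) powr p + (1 - r * x) powr p) / 2"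
    and "Sq = ((1 + x) powr q + (1 - x) powr q) / 2"
  have sp: "(\<lambda>k. (p gchoose (2 * k)) * (r * x) ^ (2 * k)) sums Sp"
    and sq: "(\<lambda>k. (q gchoose (2 * k)) * x ^ (2 * k)) sums Sq"
    unfolding Sp_def Sq_def using rx x by (auto intro!: even_binomial_sums)
  have "1 \<le> Sp"
  proof -
    have "(\<Sum>k<1. (p gchoose (2 * k)) * (r * x) ^ (2 * k)) \<le> Sp"
      unfolding sums_unique[OF sp]
      by (rule sum_le_suminf) (use sp gbinomial_even_compare(2)[OF q] rx in \<open>auto simp: sums_iff intro!: mult_nonneg_nonneg\<close>)
    then show ?thesis by simp
  qed
  have coeff: "q / p * ((p gchoose (2 * k)) * (r * x) ^ (2 * k)) - (if k = 0 then q / p - 1 else 0)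
      \<le> (q gchoose (2 * k)) * x ^ (2 * k)" for k
  proof (cases "k = 0")
    case False
    then have k: "0 < k" by simp
    note C = gbinomial_even_compare[OF q k]
    have Cq: "0 \<le> (q gchoose (2 * k))"
    proof -
      have "0 \<le> q * (q - 1) * (p gchoose (2 * k))" using C q by (intro mult_nonneg_nonneg) auto
      then have "0 \<le> p * (p - 1) * (q gchoose (2 * k))" using C by linarith
      moreover have "0 < p * (p - 1)" using q by simp
      ultimately show ?thesis by (simp add: zero_le_mult_iff)
    qed
    have "r ^ (2 * k) \<le> r\<^sup>2" using r01 k by (intro power_decreasing) auto
    then have rk: "r ^ (2 * k) \<le> (q - 1) / (p - 1)" by (simp add: r2)
    have "q / p * (p gchoose (2 * k)) \<le> (p - 1) / (q - 1) * (q gchoose (2 * k))"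
      using C q by (simp add: field_simps)
    then have "q / p * (p gchoose (2 * k)) * r ^ (2 * k) \<le> (p - 1) / (q - 1) * (q gchoose (2 * k)) * ((q - 1) / (p - 1))"
      by (rule mult_mono[OF _ rk]) (use Cq q r01 in auto)
    also have "\<dots> = (q gchoose (2 * k))" using q by simp
    finally have "q / p * (p gchoose (2 * k)) * r ^ (2 * k) * x ^ (2 * k) \<le> (q gchoose (2 * k)) * x ^ (2 * k)"
      using x by (intro mult_right_mono) auto
    then show ?thesis using False by (simp add: power_mult_distrib mult_ac)
  qed simp
  have "(\<lambda>k. q / p * ((p gchoose (2 * k)) * (r * x) ^ (2 * k)) - (if k = 0 then q / p - 1 else 0))
      sums (q / p * Sp - (q / p - 1))"
    by (intro sums_diff sums_mult sp) (use sums_single[of 0 "\<lambda>_. q / p - 1"] in simp)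
  from sums_le[OF coeff this sq] have lin: "q / p * Sp + (1 - q / p) \<le> Sq" by simp
  have "Sp powr (q / p) * 1 powr (1 - q / p) \<le> q / p * Sp + (1 - q / p) * 1"
    using q \<open>1 \<le> Sp\<close> by (intro Youngs_inequality_0) auto
  then have "Sp powr (q / p) \<le> Sq" using lin by simp
  then have "(Sp powr (q / p)) powr (1 / q) \<le> Sq powr (1 / q)" using q by (intro powr_mono2) auto
  then show ?thesis using q by (simp add: powr_powr two_point_norm_def Sp_def Sq_def)
qed

lemma two_point_norm_scale:
  assumes "0 \<le> a" "0 \<le> u" "0 \<le> v" "0 < p"
  shows "two_point_norm p (a * u) (a * v) = a * two_point_norm p u v"
proof -
  have "(a * u) powr p + (a * v) powr p = a powr p * (u powr p + v powr p)"
    using assms by (simp add: powr_mult algebra_simps)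
  then have "two_point_norm p (a * u) (a * v) = (a powr p * ((u powr p + v powr p) / 2)) powr (1 / p)"
    by (simp add: two_point_norm_def)
  also have "\<dots> = (a powr p) powr (1 / p) * two_point_norm p u v"
    unfolding two_point_norm_def by (rule powr_mult)
  also have "(a powr p) powr (1 / p) = a" using assms by (simp add: powr_powr)
  finally show ?thesis .
qed

lemma two_point_norm_commute: "two_point_norm p u v = two_point_norm p v u"
  by (simp add: two_point_norm_def add.commute)

text \<open>A pair \<open>v \<le> u\<close> is a multiple of \<open>(1 + x, 1 - x)\<close>. The endpoint \<open>x = 1\<close>, where the series need not
  converge, is a limit.\<close>

lemma two_point_hypercontractive_le_two:
  fixes p q r u v :: real
  assumes q: "1 < q" "q < p" "p \<le> 2" and r: "r = sqrt ((q - 1) / (p - 1))" and uv: "0 \<le> u" "0 \<le> v"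
  shows "two_point_norm p (noise r u v) (noise r v u) \<le> two_point_norm q u v"
proof -
  have r01: "0 \<le> r" "r \<le> 1" using q by (auto simp: r)
  have normalized: "two_point_norm p (1 + r * x) (1 - r * x) \<le> two_point_norm q (1 + x) (1 - x)"
    if x: "0 \<le> x" "x \<le> 1" for x
  proof (cases "x = 1")
    case True
    have cont: "((\<lambda>x. two_point_norm a (1 + c * x) (1 - c * x)) \<longlongrightarrow> two_point_norm a (1 + c * 1) (1 - c * 1)) (at_left 1)"
      if a: "1 < a" and c: "0 \<le> c" "c \<le> 1" for a c :: real
    proof -
      have ev: "eventually (\<lambda>x. x \<in> {0<..<1}) (at_left (1::real))" by (rule eventually_at_left_real) simp
      have nn: "eventually (\<lambda>x. 0 \<le> 1 - c * x) (at_left (1::real))"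
        using ev
      proof eventually_elim
        case (elim x)
        then have "c * x \<le> 1 * 1" using c by (intro mult_mono) auto
        then show ?case by simp
      qed
      have "((\<lambda>x. ((1 + c * x) powr a + (1 - c * x) powr a) / 2) \<longlongrightarrow> ((1 + c * 1) powr a + (1 - c * 1) powr a) / 2) (at_left 1)"
        by (intro tendsto_divide tendsto_add tendsto_powr' tendsto_diff tendsto_mult tendsto_const tendsto_ident_at)
           (use a c nn in auto)
      then show ?thesis
        unfolding two_point_norm_def
        by (intro tendsto_powr tendsto_const) (use c in \<open>auto simp: add_pos_nonneg less_imp_neq[symmetric] add_nonneg_eq_0_iff\<close>)
    qed
    show ?thesis
    proof (rule tendsto_le)
      show "((\<lambda>x. two_point_norm p (1 + r * x) (1 - r * x)) \<longlongrightarrow> two_point_norm p (1 + r * x) (1 - r * x)) (at_left 1)"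
        using cont[of p r] q r01 True by simp
      show "((\<lambda>x. two_point_norm q (1 + x) (1 - x)) \<longlongrightarrow> two_point_norm q (1 + x) (1 - x)) (at_left 1)"
        using cont[of q 1] q True by simp
      have "eventually (\<lambda>x. x \<in> {0<..<1}) (at_left (1::real))" by (rule eventually_at_left_real) simp
      then show "eventually (\<lambda>x. two_point_norm p (1 + r * x) (1 - r * x) \<le> two_point_norm q (1 + x) (1 - x)) (at_left 1)"
        by eventually_elim (use two_point_hypercontractive_normalized[OF q r] in auto)
    qed simp
  qed (use two_point_hypercontractive_normalized[OF q r x(1)] x in auto)
  have ordered: "two_point_norm p (noise r u v) (noise r v u) \<le> two_point_norm q u v"
    if uv: "0 \<le> v" "v \<le> u" for u v
  proof (cases "u = 0")
    case True
    then show ?thesis using uv by (simp add: noise_def two_point_norm_def)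
  next
    case False
    define a x where "a = (u + v) / 2" and "x = (u - v) / (u + v)"
    have a: "0 < a" and x: "0 \<le> x" "x \<le> 1" using False uv by (auto simp: a_def x_def divide_simps)
    have "u + v \<noteq> 0" using False uv by linarith
    then have "(u + v) * x = u - v" by (simp add: x_def)
    then have ax: "a * x = (u - v) / 2" by (simp add: a_def)
    have e: "u = a * (1 + x)" "v = a * (1 - x)" "noise r u v = a * (1 + r * x)" "noise r v u = a * (1 - r * x)"
    proof -
      have "a + a * x = u" "a - a * x = v" unfolding ax by (simp_all add: a_def field_simps)
      then show "u = a * (1 + x)" "v = a * (1 - x)" by (simp_all only: distrib_left right_diff_distrib mult_1_right)
      have "a * (1 + r * x) = a + r * (a * x)" "a * (1 - r * x) = a - r * (a * x)" by (auto simp: algebra_simps)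
      then show "noise r u v = a * (1 + r * x)" "noise r v u = a * (1 - r * x)"
        unfolding ax by (auto simp: a_def noise_def field_simps)
    qed
    have "r * x \<le> 1 * 1" using r01 x by (intro mult_mono) auto
    then have "two_point_norm p (noise r u v) (noise r v u) = a * two_point_norm p (1 + r * x) (1 - r * x)"
      unfolding e(3,4) using a r01 x q by (intro two_point_norm_scale) auto
    also have "\<dots> \<le> a * two_point_norm q (1 + x) (1 - x)"
      using a normalized[OF x] by (intro mult_left_mono) auto
    also have "\<dots> = two_point_norm q u v"
      unfolding e(1,2) using a x q by (intro two_point_norm_scale[symmetric]) auto
    finally show ?thesis .
  qed
  show ?thesis
    using ordered[of v u] ordered[of u v] uv
    by (cases "v \<le> u") (auto simp: two_point_norm_commute)
qed

lemma two_point_Holder: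
  assumes p: "1 < p" "1 < p'" "1 / p + 1 / p' = 1" and nn: "0 \<le> u" "0 \<le> v" "0 \<le> s" "0 \<le> t"
  shows "(u * s + v * t) / 2 \<le> two_point_norm p u v * two_point_norm p' s t"
proof -
  have "(\<Sum>b\<in>UNIV. (if b then u else v) * (if b then s else t))
      \<le> (\<Sum>b\<in>UNIV. (if b then u else v) powr p) powr (1 / p)
        * (\<Sum>b\<in>UNIV. (if b then s else t) powr p') powr (1 / p')"
    by (rule Holder_inequality_sum) (use p nn in auto)
  then have "u * s + v * t \<le> (u powr p + v powr p) powr (1 / p) * (s powr p' + t powr p') powr (1 / p')"
    by (simp add: UNIV_bool add.commute)
  moreover have "two_point_norm p u v * two_point_norm p' s t
      = (u powr p + v powr p) powr (1 / p) * (s powr p' + t powr p') powr (1 / p') / 2"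
  proof -
    have "(2::real) powr (1 / p) * 2 powr (1 / p') = 2" using p by (simp add: powr_add[symmetric])
    then show ?thesis by (simp add: two_point_norm_def powr_divide)
  qed
  ultimately show ?thesis by simp
qed

text \<open>Stated as a bound on the symmetric bilinear form of the noise operator, the inequality for
  \<open>(q, p)\<close> and the one for the pair \<open>(p', q')\<close> of conjugate exponents are literally the same. This gives
  the range above \<open>2\<close>, and factoring the operator through \<open>L\<^sub>2\<close> gives \<open>q < 2 < p\<close>.\<close>

lemma two_point_bilinear:
  fixes p q r p' :: real
  assumes q: "1 < q" "q < p" and p': "1 / p + 1 / p' = 1" and r: "r = sqrt ((q - 1) / (p - 1))"
    and nn: "0 \<le> u" "0 \<le> v" "0 \<le> s" "0 \<le> t"
  shows "(noise r u v * s + noise r v u * t) / 2 \<le> two_point_norm q u v * two_point_norm p' s t"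
proof -
  have noise_nn: "0 \<le> noise r a b" if "0 \<le> r" "r \<le> 1" "0 \<le> a" "0 \<le> b" for r a b
    using that by (simp add: noise_def)
  have conj_gt: "1 < b" if "1 < a" "1 / a + 1 / b = 1" for a b :: real
  proof -
    have "1 / a < 1" "0 < 1 / a" using that by auto
    then have "0 < 1 / b" "1 / b < 1" using that(2) by linarith+
    then show ?thesis by (simp add: zero_less_divide_iff divide_less_eq_1)
  qed
  have low: "(noise r u v * s + noise r v u * t) / 2 \<le> two_point_norm q u v * two_point_norm p' s t"
    if q: "1 < q" "q < p" "p \<le> 2" and p': "1 / p + 1 / p' = 1" and r: "r = sqrt ((q - 1) / (p - 1))"
      and nn: "0 \<le> u" "0 \<le> v" "0 \<le> s" "0 \<le> t" for p q r p' u v s t :: real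
  proof -
    have r01: "0 \<le> r" "r \<le> 1" using q by (auto simp: r)
    have "(noise r u v * s + noise r v u * t) / 2
        \<le> two_point_norm p (noise r u v) (noise r v u) * two_point_norm p' s t"
      using q p' nn r01 conj_gt[of p p'] by (intro two_point_Holder noise_nn) auto
    also have "\<dots> \<le> two_point_norm q u v * two_point_norm p' s t"
      by (intro mult_right_mono two_point_hypercontractive_le_two q r nn) (simp add: two_point_norm_def)
    finally show ?thesis .
  qed
  have p'1: "1 < p'" using conj_gt[of p p'] p' q by simp
  have p'p: "p' = p / (p - 1)" using p' q p'1 by (simp add: field_simps)
  consider "p \<le> 2" | "2 \<le> q" | "q < 2" "2 < p" by linarith
  then show ?thesis
  proof cases
    case 1
    then show ?thesis using low[OF q 1 p' r nn] by simp
  next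
    case 2
    define q' where "q' = q / (q - 1)"
    have q': "p' < q'" "q' \<le> 2" "1 / q' + 1 / q = 1"
      using q 2 by (auto simp: q'_def p'p field_simps)
    have "r = sqrt ((p' - 1) / (q' - 1))" using q by (simp add: r q'_def p'p field_simps)
    from low[OF p'1 q' this nn(3,4,1,2)] show ?thesis
      by (simp add: noise_def algebra_simps)
  next
    case 3
    define r1 r2 where "r1 = sqrt (q - 1)" and "r2 = sqrt (p' - 1)"
    have p'2: "p' < 2" using 3 by (simp add: p'p field_simps)
    have r12: "r = r1 * r2" "0 \<le> r1" "r1 \<le> 1" "0 \<le> r2" "r2 \<le> 1"
      using 3 q p'1 p'2 by (auto simp: r r1_def r2_def p'p real_sqrt_mult[symmetric] field_simps)
    have "noise (r1 * r2) u v * s + noise (r1 * r2) v u * t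
        = noise r1 u v * noise r2 s t + noise r1 v u * noise r2 t s"
      by (simp add: noise_def field_simps)
    then have "(noise r u v * s + noise r v u * t) / 2
        = (noise r1 u v * noise r2 s t + noise r1 v u * noise r2 t s) / 2" by (simp add: r12)
    also have "\<dots> \<le> two_point_norm 2 (noise r1 u v) (noise r1 v u) * two_point_norm 2 (noise r2 s t) (noise r2 t s)"
      using nn r12 by (intro two_point_Holder noise_nn) auto
    also have "\<dots> \<le> two_point_norm q u v * two_point_norm p' s t"
      using 3 q p'1 p'2 nn
      by (intro mult_mono two_point_hypercontractive_le_two) (auto simp: r1_def r2_def two_point_norm_def)
    finally show ?thesis .
  qed
qed

section \<open>Tensorization on the cube\<close>

text \<open>The cube, the norm and the noise form are needed over an arbitrary finite set of coordinates, for an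
  induction that adds one coordinate at a time.\<close>

definition sign_cube :: "nat set \<Rightarrow> (nat \<Rightarrow> real) set" where
  "sign_cube I = I \<rightarrow>\<^sub>E {-1, 1}"

definition cube_norm :: "nat set \<Rightarrow> real \<Rightarrow> ((nat \<Rightarrow> real) \<Rightarrow> real) \<Rightarrow> real" where
  "cube_norm I p F = ((\<Sum>\<epsilon>\<in>sign_cube I. F \<epsilon> powr p) / 2 ^ card I) powr (1 / p)"

definition noise_form :: "nat set \<Rightarrow> real \<Rightarrow> ((nat \<Rightarrow> real) \<Rightarrow> real) \<Rightarrow> ((nat \<Rightarrow> real) \<Rightarrow> real) \<Rightarrow> real" where
  "noise_form I r F G =
    (\<Sum>\<epsilon>\<in>sign_cube I. \<Sum>\<delta>\<in>sign_cube I. (\<Prod>i\<in>I. 1 + r * \<epsilon> i * \<delta> i) * F \<epsilon> * G \<delta>) / 4 ^ card I"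

lemma finite_sign_cube: "finite I \<Longrightarrow> finite (sign_cube I)"
  unfolding sign_cube_def by (intro finite_PiE) auto

lemma sum_sign_cube_insert:
  fixes H :: "(nat \<Rightarrow> real) \<Rightarrow> 'a :: comm_monoid_add"
  assumes "finite I" "a \<notin> I"
  shows "(\<Sum>\<epsilon>\<in>sign_cube (insert a I). H \<epsilon>) = (\<Sum>\<epsilon>\<in>sign_cube I. H (\<epsilon>(a := 1)) + H (\<epsilon>(a := -1)))"
proof -
  have "(\<Sum>\<epsilon>\<in>sign_cube (insert a I). H \<epsilon>) = (\<Sum>(y, \<epsilon>)\<in>{-1, 1} \<times> sign_cube I. H (\<epsilon>(a := y)))"
    unfolding sign_cube_def PiE_insert_eq
    by (subst sum.reindex[OF inj_combinator[OF assms(2)]]) (simp add: case_prod_unfold)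
  also have "\<dots> = (\<Sum>y\<in>{-1, 1}. \<Sum>\<epsilon>\<in>sign_cube I. H (\<epsilon>(a := y)))"
    using assms finite_sign_cube by (subst sum.cartesian_product[symmetric]) auto
  also have "\<dots> = (\<Sum>\<epsilon>\<in>sign_cube I. H (\<epsilon>(a := 1)) + H (\<epsilon>(a := -1)))"
    by (simp add: sum.distrib add.commute)
  finally show ?thesis .
qed

lemma noise_form_insert:
  assumes "finite I" "a \<notin> I"
  shows "noise_form (insert a I) r F G =
    ((1 + r) * (noise_form I r (\<lambda>\<epsilon>. F (\<epsilon>(a := 1))) (\<lambda>\<epsilon>. G (\<epsilon>(a := 1)))
        + noise_form I r (\<lambda>\<epsilon>. F (\<epsilon>(a := -1))) (\<lambda>\<epsilon>. G (\<epsilon>(a := -1))))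
     + (1 - r) * (noise_form I r (\<lambda>\<epsilon>. F (\<epsilon>(a := 1))) (\<lambda>\<epsilon>. G (\<epsilon>(a := -1)))
        + noise_form I r (\<lambda>\<epsilon>. F (\<epsilon>(a := -1))) (\<lambda>\<epsilon>. G (\<epsilon>(a := 1))))) / 4"
proof -
  have k: "(\<Prod>i\<in>insert a I. 1 + r * (\<epsilon>(a := x)) i * (\<delta>(a := y)) i) = (1 + r * x * y) * (\<Prod>i\<in>I. 1 + r * \<epsilon> i * \<delta> i)"
    for \<epsilon> \<delta> x y
  proof -
    have "(\<Prod>i\<in>I. 1 + r * (\<epsilon>(a := x)) i * (\<delta>(a := y)) i) = (\<Prod>i\<in>I. 1 + r * \<epsilon> i * \<delta> i)"
      using assms by (intro prod.cong) auto
    then show ?thesis using assms by simp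
  qed
  define S where "S x y = (\<Sum>\<epsilon>\<in>sign_cube I. \<Sum>\<delta>\<in>sign_cube I.
      (\<Prod>i\<in>I. 1 + r * \<epsilon> i * \<delta> i) * F (\<epsilon>(a := x)) * G (\<delta>(a := y)))" for x y
  have t: "(\<Sum>\<epsilon>\<in>sign_cube I. \<Sum>\<delta>\<in>sign_cube I.
      (1 + r * x * y) * (\<Prod>i\<in>I. 1 + r * \<epsilon> i * \<delta> i) * F (\<epsilon>(a := x)) * G (\<delta>(a := y)))
      = (1 + r * x * y) * S x y" for x y
    by (simp only: S_def sum_distrib_left mult.assoc)
  have nf: "noise_form I r (\<lambda>\<epsilon>. F (\<epsilon>(a := x))) (\<lambda>\<epsilon>. G (\<epsilon>(a := y))) = S x y / 4 ^ card I" for x y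
    by (simp add: noise_form_def S_def)
  have "noise_form (insert a I) r F G = ((1 + r * 1 * 1) * S 1 1 + (1 + r * 1 * -1) * S 1 (-1)
      + ((1 + r * -1 * 1) * S (-1) 1 + (1 + r * -1 * -1) * S (-1) (-1))) / 4 ^ card (insert a I)"
    unfolding noise_form_def sum_sign_cube_insert[OF assms] k sum.distrib t by (simp only: add_ac)
  moreover have "((1 + r * 1 * 1) * a1 + (1 + r * 1 * -1) * a2 + ((1 + r * -1 * 1) * a3 + (1 + r * -1 * -1) * a4)) / (4 * N)
      = ((1 + r) * (a1 / N + a4 / N) + (1 - r) * (a2 / N + a3 / N)) / 4" if "N \<noteq> 0" for a1 a2 a3 a4 N :: real
    using that by (simp add: field_simps)
  ultimately show ?thesis unfolding nf using assms by simp
qed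

lemma cube_norm_insert:
  assumes "finite I" "a \<notin> I" "0 < p" and F: "\<And>\<epsilon>. 0 \<le> F \<epsilon>"
  shows "cube_norm (insert a I) p F =
    two_point_norm p (cube_norm I p (\<lambda>\<epsilon>. F (\<epsilon>(a := 1)))) (cube_norm I p (\<lambda>\<epsilon>. F (\<epsilon>(a := -1))))"
proof -
  have e: "cube_norm I p G powr p = (\<Sum>\<epsilon>\<in>sign_cube I. G \<epsilon> powr p) / 2 ^ card I" for G
    using assms(3) by (simp add: cube_norm_def powr_powr sum_nonneg)
  have "(\<Sum>\<epsilon>\<in>sign_cube (insert a I). F \<epsilon> powr p) / 2 ^ card (insert a I)
      = (cube_norm I p (\<lambda>\<epsilon>. F (\<epsilon>(a := 1))) powr p + cube_norm I p (\<lambda>\<epsilon>. F (\<epsilon>(a := -1))) powr p) / 2"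
    unfolding e sum_sign_cube_insert[OF assms(1,2)] using assms(1,2) by (simp add: sum.distrib field_simps)
  then show ?thesis unfolding cube_norm_def[of "insert a I"] two_point_norm_def by (simp only:)
qed

text \<open>The bilinear form bounds the operator norm and tensorizes without Minkowski's inequality: split off one
  coordinate, apply the induction hypothesis to the four pairs of restrictions, and then the two-point
  inequality to their norms. The first step uses that the kernel \<open>1 \<plusminus> r\<close> is nonnegative.\<close>

lemma noise_form_le:
  fixes p q r p' :: real
  assumes I: "finite I" and q: "1 < q" "q < p" and p': "1 / p + 1 / p' = 1" "0 < p'"
    and r: "r = sqrt ((q - 1) / (p - 1))"
    and nn: "\<And>\<epsilon>. 0 \<le> F \<epsilon>" "\<And>\<epsilon>. 0 \<le> G \<epsilon>"
  shows "noise_form I r F G \<le> cube_norm I q F * cube_norm I p' G"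
  using I nn
proof (induction I arbitrary: F G rule: finite_induct)
  case empty
  then show ?case using q p' by (simp add: noise_form_def cube_norm_def sign_cube_def powr_powr)
next
  case (insert a I)
  have r01: "0 \<le> r" "r \<le> 1" using q by (auto simp: r)
  define A B where "A x = cube_norm I q (\<lambda>\<epsilon>. F (\<epsilon>(a := x)))"
    and "B x = cube_norm I p' (\<lambda>\<epsilon>. G (\<epsilon>(a := x)))" for x
  have nnA: "0 \<le> A x" "0 \<le> B x" for x by (auto simp: A_def B_def cube_norm_def)
  have le: "noise_form I r (\<lambda>\<epsilon>. F (\<epsilon>(a := x))) (\<lambda>\<epsilon>. G (\<epsilon>(a := y))) \<le> A x * B y" for x y
    unfolding A_def B_def using insert.prems by (intro insert.IH) auto
  have "noise_form (insert a I) r F G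
      \<le> ((1 + r) * (A 1 * B 1 + A (-1) * B (-1)) + (1 - r) * (A 1 * B (-1) + A (-1) * B 1)) / 4"
    unfolding noise_form_insert[OF insert.hyps] using r01
    by (intro divide_right_mono add_mono mult_left_mono le) auto
  also have "\<dots> = (noise r (A 1) (A (-1)) * B 1 + noise r (A (-1)) (A 1) * B (-1)) / 2"
    by (simp add: noise_def field_simps)
  also have "\<dots> \<le> two_point_norm q (A 1) (A (-1)) * two_point_norm p' (B 1) (B (-1))"
    by (intro two_point_bilinear[OF q p'(1) r] nnA)
  also have "\<dots> = cube_norm (insert a I) q F * cube_norm (insert a I) p' G"
    using insert q p' by (simp add: cube_norm_insert A_def B_def)
  finally show ?case .
qed

text \<open>The multiplier \<open>T\<^sub>z\<close> that acts as \<open>z\<^bsup>|A|\<^esup>\<close> on \<open>w\<^sub>A\<close>; by the next lemmas its kernel is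
  \<open>\<Prod> (1 + z \<epsilon>\<^sub>i \<delta>\<^sub>i)\<close>, which at \<open>z = 1\<close> gives Fourier inversion.\<close>

definition noise_sum :: "nat \<Rightarrow> ((nat \<Rightarrow> real) \<Rightarrow> complex) \<Rightarrow> complex \<Rightarrow> (nat \<Rightarrow> real) \<Rightarrow> complex" where
  "noise_sum n f z \<epsilon> = (\<Sum>A\<in>Pow {1..n}. z ^ card A * fourier_coeff n f A * of_real (walsh A \<epsilon>))"

lemma cube_eq_sign_cube: "cube n = sign_cube {1..n}"
  by (simp add: cube_def sign_cube_def)

lemma finite_cube: "finite (cube n)"
  by (simp add: cube_eq_sign_cube finite_sign_cube)

lemma noise_sum_kernel:
  "noise_sum n f z \<epsilon> = (\<Sum>\<delta>\<in>cube n. f \<delta> * (\<Prod>i\<in>{1..n}. 1 + z * of_real (\<epsilon> i * \<delta> i))) / 2 ^ n"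
proof -
  have "(\<Prod>i\<in>{1..n}. 1 + z * of_real (\<epsilon> i * \<delta> i))
      = (\<Sum>A\<in>Pow {1..n}. z ^ card A * of_real (walsh A \<delta>) * of_real (walsh A \<epsilon>))" for \<delta>
  proof -
    have "(\<Prod>i\<in>{1..n}. 1 + z * of_real (\<epsilon> i * \<delta> i)) = (\<Prod>i\<in>{1..n}. z * of_real (\<epsilon> i * \<delta> i) + 1)"
      by (simp add: add.commute)
    also have "\<dots> = (\<Sum>A\<in>Pow {1..n}. (\<Prod>i\<in>A. z * of_real (\<epsilon> i * \<delta> i)) * (\<Prod>i\<in>{1..n} - A. 1))"
      by (rule prod_add) simp
    finally show ?thesis by (simp add: prod.distrib walsh_def mult_ac)
  qed
  then have "(\<Sum>\<delta>\<in>cube n. f \<delta> * (\<Prod>i\<in>{1..n}. 1 + z * of_real (\<epsilon> i * \<delta> i)))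
      = (\<Sum>\<delta>\<in>cube n. \<Sum>A\<in>Pow {1..n}. z ^ card A * (f \<delta> * of_real (walsh A \<delta>)) * of_real (walsh A \<epsilon>))"
    by (simp add: sum_distrib_left mult_ac)
  also have "\<dots> = (\<Sum>A\<in>Pow {1..n}. \<Sum>\<delta>\<in>cube n. z ^ card A * (f \<delta> * of_real (walsh A \<delta>)) * of_real (walsh A \<epsilon>))"
    by (rule sum.swap)
  also have "\<dots> = (\<Sum>A\<in>Pow {1..n}. 2 ^ n * (z ^ card A * fourier_coeff n f A * of_real (walsh A \<epsilon>)))"
  proof (rule sum.cong[OF refl])
    fix A
    have "(\<Sum>\<delta>\<in>cube n. z ^ card A * (f \<delta> * of_real (walsh A \<delta>)) * of_real (walsh A \<epsilon>))
        = z ^ card A * (\<Sum>\<delta>\<in>cube n. f \<delta> * of_real (walsh A \<delta>)) * of_real (walsh A \<epsilon>)"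
      by (simp only: sum_distrib_left sum_distrib_right)
    also have "(\<Sum>\<delta>\<in>cube n. f \<delta> * of_real (walsh A \<delta>)) = 2 ^ n * fourier_coeff n f A"
      by (simp add: fourier_coeff_def)
    finally show "(\<Sum>\<delta>\<in>cube n. z ^ card A * (f \<delta> * of_real (walsh A \<delta>)) * of_real (walsh A \<epsilon>))
        = 2 ^ n * (z ^ card A * fourier_coeff n f A * of_real (walsh A \<epsilon>))" by (simp add: mult_ac)
  qed
  also have "\<dots> = 2 ^ n * noise_sum n f z \<epsilon>"
    by (simp only: noise_sum_def sum_distrib_left)
  finally show ?thesis by simp
qed

lemma noise_sum_one:
  assumes "\<epsilon> \<in> cube n"
  shows "noise_sum n f 1 \<epsilon> = f \<epsilon>"
proof -
  have val: "\<delta> i = 1 \<or> \<delta> i = -1" if "\<delta> \<in> cube n" "i \<in> {1..n}" for \<delta> i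
    using that by (auto simp: cube_def PiE_def Pi_def)
  have k: "(\<Prod>i\<in>{1..n}. 1 + 1 * of_real (\<epsilon> i * \<delta> i)) = (if \<delta> = \<epsilon> then 2 ^ n else 0 :: complex)"
    if d: "\<delta> \<in> cube n" for \<delta>
  proof (cases "\<delta> = \<epsilon>")
    case True
    have "(\<Prod>i\<in>{1..n}. 1 + 1 * of_real (\<epsilon> i * \<epsilon> i)) = (\<Prod>i\<in>{1..n}. 2 :: complex)"
      by (rule prod.cong[OF refl]) (use val[OF assms] in force)
    then show ?thesis using True by simp
  next
    case False
    then obtain i where i: "i \<in> {1..n}" "\<delta> i \<noteq> \<epsilon> i"
      using d assms unfolding cube_def by (metis PiE_ext)
    then have "1 + 1 * of_real (\<epsilon> i * \<delta> i) = (0 :: complex)"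
      using val[OF assms i(1)] val[OF d i(1)] by auto
    then show ?thesis using False i by (auto intro!: prod_zero)
  qed
  have "noise_sum n f 1 \<epsilon> = (\<Sum>\<delta>\<in>cube n. f \<delta> * (if \<delta> = \<epsilon> then 2 ^ n else 0)) / 2 ^ n"
    unfolding noise_sum_kernel by (simp only: k cong: sum.cong)
  also have "\<dots> = f \<epsilon>" using assms finite_cube by (simp add: if_distrib sum.delta cong: if_cong)
  finally show ?thesis .
qed

lemma Lp_norm_nonneg: "0 \<le> Lp_norm n p f"
  by (simp add: Lp_norm_def)

lemma Lp_norm_powr:
  assumes "0 < p"
  shows "Lp_norm n p f powr p = (\<Sum>\<epsilon>\<in>cube n. norm (f \<epsilon>) powr p) / 2 ^ n"
  using assms by (simp add: Lp_norm_def powr_powr sum_nonneg)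

lemma Lp_norm_Holder:
  assumes p: "1 < p" "1 < p'" "1 / p + 1 / p' = 1"
  shows "norm ((\<Sum>\<epsilon>\<in>cube n. f \<epsilon> * g \<epsilon>) / 2 ^ n) \<le> Lp_norm n p f * Lp_norm n p' g"
proof -
  have "norm (\<Sum>\<epsilon>\<in>cube n. f \<epsilon> * g \<epsilon>) \<le> (\<Sum>\<epsilon>\<in>cube n. norm (f \<epsilon>) * norm (g \<epsilon>))"
    by (rule order_trans[OF norm_sum]) (simp add: norm_mult)
  also have "\<dots> \<le> (\<Sum>\<epsilon>\<in>cube n. norm (f \<epsilon>) powr p) powr (1 / p) * (\<Sum>\<epsilon>\<in>cube n. norm (g \<epsilon>) powr p') powr (1 / p')"
    by (rule Holder_inequality_sum[OF finite_cube p]) auto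
  also have "\<dots> = Lp_norm n p f * Lp_norm n p' g * 2 ^ n"
  proof -
    have "((2::real) ^ n) powr (1 / p) * (2 ^ n) powr (1 / p') = 2 ^ n" using p by (simp add: powr_add[symmetric])
    then show ?thesis by (simp add: Lp_norm_def powr_divide)
  qed
  finally show ?thesis by (simp add: norm_divide norm_power divide_le_eq)
qed

text \<open>The kernel is nonnegative, so \<open>|T\<^sub>r f| \<le> T\<^sub>r |f|\<close>; testing \<open>T\<^sub>r |f|\<close> against \<open>|T\<^sub>r f|\<^bsup>p-1\<^esup>\<close> in the
  bilinear estimate gives the norm bound.\<close>

lemma noise_sum_hypercontractive:
  assumes q: "1 < q" "q < p" and r: "r = sqrt ((q - 1) / (p - 1))"
  shows "Lp_norm n p (noise_sum n f (of_real r)) \<le> Lp_norm n q f"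
proof -
  define p' where "p' = p / (p - 1)"
  have p': "1 / p + 1 / p' = 1" "1 < p'" "(p - 1) * p' = p" using q by (auto simp: p'_def field_simps)
  have r01: "0 \<le> r" "r \<le> 1" using q by (auto simp: r)
  define h where "h \<epsilon> = noise_sum n f (of_real r) \<epsilon>" for \<epsilon>
  define N where "N = Lp_norm n p h"
  have k0: "0 \<le> (\<Prod>i\<in>{1..n}. 1 + r * \<epsilon> i * \<delta> i)" if "\<epsilon> \<in> cube n" "\<delta> \<in> cube n" for \<epsilon> \<delta>
  proof (rule prod_nonneg)
    fix i assume "i \<in> {1..n}"
    then have "(\<epsilon> i = 1 \<or> \<epsilon> i = -1) \<and> (\<delta> i = 1 \<or> \<delta> i = -1)"
      using that by (auto simp: cube_def PiE_def Pi_def)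
    then show "0 \<le> 1 + r * \<epsilon> i * \<delta> i" using r01 by auto
  qed
  have h_le: "norm (h \<epsilon>) \<le> (\<Sum>\<delta>\<in>cube n. (\<Prod>i\<in>{1..n}. 1 + r * \<epsilon> i * \<delta> i) * norm (f \<delta>)) / 2 ^ n"
    if e: "\<epsilon> \<in> cube n" for \<epsilon>
  proof -
    have "h \<epsilon> = (\<Sum>\<delta>\<in>cube n. f \<delta> * of_real (\<Prod>i\<in>{1..n}. 1 + r * \<epsilon> i * \<delta> i)) / 2 ^ n"
      unfolding h_def noise_sum_kernel by (simp add: mult.assoc)
    then have "norm (h \<epsilon>) = norm (\<Sum>\<delta>\<in>cube n. f \<delta> * of_real (\<Prod>i\<in>{1..n}. 1 + r * \<epsilon> i * \<delta> i)) / 2 ^ n"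
      by (simp add: norm_divide norm_power)
    also have "\<dots> \<le> (\<Sum>\<delta>\<in>cube n. norm (f \<delta> * of_real (\<Prod>i\<in>{1..n}. 1 + r * \<epsilon> i * \<delta> i))) / 2 ^ n"
      by (intro divide_right_mono norm_sum) auto
    also have "\<dots> = (\<Sum>\<delta>\<in>cube n. (\<Prod>i\<in>{1..n}. 1 + r * \<epsilon> i * \<delta> i) * norm (f \<delta>)) / 2 ^ n"
      using k0[OF e] by (simp only: norm_mult norm_of_real abs_of_nonneg mult.commute cong: sum.cong)
    finally show ?thesis .
  qed
  have "N powr p = (\<Sum>\<epsilon>\<in>cube n. norm (h \<epsilon>) * norm (h \<epsilon>) powr (p - 1)) / 2 ^ n"
  proof -
    have "norm (h \<epsilon>) * norm (h \<epsilon>) powr (p - 1) = norm (h \<epsilon>) powr p" for \<epsilon>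
      by (simp add: powr_mult_base)
    then show ?thesis unfolding N_def using q by (simp add: Lp_norm_powr)
  qed
  also have "\<dots> \<le> (\<Sum>\<epsilon>\<in>cube n. (\<Sum>\<delta>\<in>cube n. (\<Prod>i\<in>{1..n}. 1 + r * \<epsilon> i * \<delta> i) * norm (f \<delta>)) / 2 ^ n
      * norm (h \<epsilon>) powr (p - 1)) / 2 ^ n"
    by (intro divide_right_mono sum_mono mult_right_mono h_le) auto
  also have "\<dots> = noise_form {1..n} r (\<lambda>\<delta>. norm (f \<delta>)) (\<lambda>\<epsilon>. norm (h \<epsilon>) powr (p - 1))"
  proof -
    have four: "(4::real) ^ card {1..n} = 2 ^ n * 2 ^ n" by (simp add: power_mult_distrib[symmetric])
    have swap: "(\<Sum>\<epsilon>\<in>cube n. \<Sum>\<delta>\<in>cube n. (\<Prod>i\<in>{1..n}. 1 + r * \<epsilon> i * \<delta> i) * norm (f \<epsilon>) * norm (h \<delta>) powr (p - 1))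
        = (\<Sum>\<epsilon>\<in>cube n. (\<Sum>\<delta>\<in>cube n. (\<Prod>i\<in>{1..n}. 1 + r * \<epsilon> i * \<delta> i) * norm (f \<delta>)) * norm (h \<epsilon>) powr (p - 1))"
      by (subst sum.swap) (simp add: sum_distrib_left sum_distrib_right mult_ac)
    have "(\<Sum>\<epsilon>\<in>cube n. K \<epsilon> / 2 ^ n * g \<epsilon>) / 2 ^ n = (\<Sum>\<epsilon>\<in>cube n. K \<epsilon> * g \<epsilon>) / (2 ^ n * 2 ^ n)"
      for K g :: "(nat \<Rightarrow> real) \<Rightarrow> real"
      by (simp add: sum_divide_distrib)
    then show ?thesis
      unfolding noise_form_def cube_eq_sign_cube[symmetric] four swap .
  qed
  also have "\<dots> \<le> cube_norm {1..n} q (\<lambda>\<delta>. norm (f \<delta>)) * cube_norm {1..n} p' (\<lambda>\<epsilon>. norm (h \<epsilon>) powr (p - 1))"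
    using p' by (intro noise_form_le[OF _ q p'(1) _ r]) auto
  also have "cube_norm {1..n} q (\<lambda>\<delta>. norm (f \<delta>)) = Lp_norm n q f"
    by (simp add: cube_norm_def Lp_norm_def cube_eq_sign_cube)
  also have "cube_norm {1..n} p' (\<lambda>\<epsilon>. norm (h \<epsilon>) powr (p - 1)) = N powr (p - 1)"
  proof -
    have "cube_norm {1..n} p' (\<lambda>\<epsilon>. norm (h \<epsilon>) powr (p - 1)) = (N powr p) powr (1 / p')"
      using q p' by (simp add: cube_norm_def N_def Lp_norm_powr powr_powr cube_eq_sign_cube)
    also have "\<dots> = N powr (p - 1)" using q by (simp add: powr_powr p'_def)
    finally show ?thesis .
  qed
  finally have le: "N powr p \<le> Lp_norm n q f * N powr (p - 1)" .
  have N0: "0 \<le> N" by (simp add: N_def Lp_norm_nonneg)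
  have "N \<le> Lp_norm n q f"
  proof (cases "N = 0")
    case False
    then have "N * N powr (p - 1) \<le> Lp_norm n q f * N powr (p - 1)"
      using le N0 by (simp add: powr_mult_base)
    then show ?thesis using False N0 by simp
  qed (simp add: Lp_norm_nonneg)
  then show ?thesis by (simp add: N_def h_def[abs_def])
qed

lemma walsh_flip:
  assumes "finite A"
  shows "walsh A (\<epsilon>(i := - \<epsilon> i)) = (if i \<in> A then - walsh A \<epsilon> else walsh A \<epsilon>)"
proof (cases "i \<in> A")
  case True
  have "walsh A \<epsilon>' = \<epsilon>' i * (\<Prod>j\<in>A - {i}. \<epsilon>' j)" for \<epsilon>'
    unfolding walsh_def using assms True by (simp add: prod.remove)
  moreover have "(\<Prod>j\<in>A - {i}. (\<epsilon>(i := - \<epsilon> i)) j) = (\<Prod>j\<in>A - {i}. \<epsilon> j)"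
    by (intro prod.cong) auto
  ultimately show ?thesis using True by simp
next
  case False
  then show ?thesis unfolding walsh_def by (auto intro!: prod.cong)
qed

lemma sum_cube_flip:
  fixes H :: "(nat \<Rightarrow> real) \<Rightarrow> real"
  assumes "i \<in> {1..n}"
  shows "2 * (\<Sum>\<epsilon>\<in>cube n. H \<epsilon>) = (\<Sum>\<epsilon>\<in>cube n. H \<epsilon> + H (\<epsilon>(i := - \<epsilon> i)))"
proof -
  have m: "\<epsilon>(i := - \<epsilon> i) \<in> cube n" if "\<epsilon> \<in> cube n" for \<epsilon>
    using that assms by (auto simp: cube_def PiE_def Pi_def extensional_def)
  have "(\<Sum>\<epsilon>\<in>cube n. H (\<epsilon>(i := - \<epsilon> i))) = (\<Sum>\<epsilon>\<in>cube n. H \<epsilon>)"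
    by (rule sum.reindex_bij_witness[of _ "\<lambda>\<epsilon>. \<epsilon>(i := - \<epsilon> i)" "\<lambda>\<epsilon>. \<epsilon>(i := - \<epsilon> i)"]) (auto intro: m)
  then show ?thesis by (simp add: sum.distrib)
qed

text \<open>Flipping the sign of \<open>\<epsilon>\<^sub>i\<close> pairs the points of the cube. On each pair the function takes the values
  \<open>a \<plusminus> b\<close>, where \<open>b\<close> collects the \<open>A\<close> that contain \<open>i\<close>, and the two-point inequality applies.\<close>

lemma Lp_norm_lens_step:
  assumes p: "1 < p" and z: "z \<in> contraction_lens p" and i: "i \<in> {1..n}"
  shows "Lp_norm n p (\<lambda>\<epsilon>. \<Sum>A\<in>Pow {1..n}. (if i \<in> A then z else 1) * c A * of_real (walsh A \<epsilon>))
    \<le> Lp_norm n p (\<lambda>\<epsilon>. \<Sum>A\<in>Pow {1..n}. c A * of_real (walsh A \<epsilon>))"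
proof -
  define a b where "a \<epsilon> = (\<Sum>A\<in>{A\<in>Pow {1..n}. i \<notin> A}. c A * of_real (walsh A \<epsilon>))"
    and "b \<epsilon> = (\<Sum>A\<in>{A\<in>Pow {1..n}. i \<in> A}. c A * of_real (walsh A \<epsilon>))" for \<epsilon>
  have split: "(\<Sum>A\<in>Pow {1..n}. (if i \<in> A then w else 1) * c A * of_real (walsh A \<epsilon>)) = a \<epsilon> + w * b \<epsilon>" for w \<epsilon>
  proof -
    have "Pow {1..n} = {A\<in>Pow {1..n}. i \<notin> A} \<union> {A\<in>Pow {1..n}. i \<in> A}" by auto
    then have "(\<Sum>A\<in>Pow {1..n}. (if i \<in> A then w else 1) * c A * of_real (walsh A \<epsilon>))
      = (\<Sum>A\<in>{A\<in>Pow {1..n}. i \<notin> A}. (if i \<in> A then w else 1) * c A * of_real (walsh A \<epsilon>))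
      + (\<Sum>A\<in>{A\<in>Pow {1..n}. i \<in> A}. (if i \<in> A then w else 1) * c A * of_real (walsh A \<epsilon>))"
      by (metis (no_types, lifting) sum.union_disjoint finite_Pow_iff finite_atLeastAtMost finite_Un
          disjoint_iff mem_Collect_eq)
    then show ?thesis by (simp add: a_def b_def sum_distrib_left mult.assoc)
  qed
  have flip: "a (\<epsilon>(i := - \<epsilon> i)) = a \<epsilon>" "b (\<epsilon>(i := - \<epsilon> i)) = - b \<epsilon>" for \<epsilon>
  proof -
    have fin: "finite A" if "A \<in> Pow {1..n}" for A using that finite_subset by blast
    show "a (\<epsilon>(i := - \<epsilon> i)) = a \<epsilon>" unfolding a_def
      by (intro sum.cong) (auto simp: walsh_flip fin)
    show "b (\<epsilon>(i := - \<epsilon> i)) = - b \<epsilon>" unfolding b_def sum_negf[symmetric]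
      by (intro sum.cong) (auto simp: walsh_flip fin)
  qed
  have "2 * (\<Sum>\<epsilon>\<in>cube n. norm (a \<epsilon> + z * b \<epsilon>) powr p) \<le> 2 * (\<Sum>\<epsilon>\<in>cube n. norm (a \<epsilon> + b \<epsilon>) powr p)"
    unfolding sum_cube_flip[OF i] flip
    by (intro sum_mono) (use two_point_lens[OF p z] in simp)
  then have "(\<Sum>\<epsilon>\<in>cube n. norm (a \<epsilon> + z * b \<epsilon>) powr p) / 2 ^ n \<le> (\<Sum>\<epsilon>\<in>cube n. norm (a \<epsilon> + b \<epsilon>) powr p) / 2 ^ n"
    by (intro divide_right_mono) auto
  then have "Lp_norm n p (\<lambda>\<epsilon>. a \<epsilon> + z * b \<epsilon>) \<le> Lp_norm n p (\<lambda>\<epsilon>. a \<epsilon> + b \<epsilon>)"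
    unfolding Lp_norm_def using p by (intro powr_mono2 divide_nonneg_nonneg sum_nonneg) auto
  moreover have "(\<Sum>A\<in>Pow {1..n}. c A * of_real (walsh A \<epsilon>)) = a \<epsilon> + b \<epsilon>" for \<epsilon>
    using split[of 1 \<epsilon>] by simp
  ultimately show ?thesis unfolding split by simp
qed

lemma Lp_norm_lens:
  assumes p: "1 < p" and z: "z \<in> contraction_lens p"
  shows "Lp_norm n p (\<lambda>\<epsilon>. \<Sum>A\<in>Pow {1..n}. z ^ card A * c A * of_real (walsh A \<epsilon>))
    \<le> Lp_norm n p (\<lambda>\<epsilon>. \<Sum>A\<in>Pow {1..n}. c A * of_real (walsh A \<epsilon>))"
proof -
  have "Lp_norm n p (\<lambda>\<epsilon>. \<Sum>A\<in>Pow {1..n}. z ^ card (A \<inter> J) * c A * of_real (walsh A \<epsilon>))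
    \<le> Lp_norm n p (\<lambda>\<epsilon>. \<Sum>A\<in>Pow {1..n}. c A * of_real (walsh A \<epsilon>))" if "finite J" "J \<subseteq> {1..n}" for J
    using that
  proof (induction J rule: finite_induct)
    case (insert i J)
    have "z ^ card (A \<inter> insert i J) = (if i \<in> A then z else 1) * z ^ card (A \<inter> J)" for A
      using insert.hyps by (auto simp: Int_insert_right)
    then have "Lp_norm n p (\<lambda>\<epsilon>. \<Sum>A\<in>Pow {1..n}. z ^ card (A \<inter> insert i J) * c A * of_real (walsh A \<epsilon>))
      = Lp_norm n p (\<lambda>\<epsilon>. \<Sum>A\<in>Pow {1..n}. (if i \<in> A then z else 1) * (z ^ card (A \<inter> J) * c A) * of_real (walsh A \<epsilon>))"
      by (simp add: mult.assoc)
    also have "\<dots> \<le> Lp_norm n p (\<lambda>\<epsilon>. \<Sum>A\<in>Pow {1..n}. (z ^ card (A \<inter> J) * c A) * of_real (walsh A \<epsilon>))"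
      using insert.prems by (intro Lp_norm_lens_step[OF p z]) auto
    also have "\<dots> \<le> Lp_norm n p (\<lambda>\<epsilon>. \<Sum>A\<in>Pow {1..n}. c A * of_real (walsh A \<epsilon>))"
      using insert by simp
    finally show ?case .
  qed simp
  from this[of "{1..n}"]
  have "Lp_norm n p (\<lambda>\<epsilon>. \<Sum>A\<in>Pow {1..n}. z ^ card (A \<inter> {1..n}) * c A * of_real (walsh A \<epsilon>))
    \<le> Lp_norm n p (\<lambda>\<epsilon>. \<Sum>A\<in>Pow {1..n}. c A * of_real (walsh A \<epsilon>))" by simp
  moreover have "(\<Sum>A\<in>Pow {1..n}. z ^ card (A \<inter> {1..n}) * c A * of_real (walsh A \<epsilon>))
      = (\<Sum>A\<in>Pow {1..n}. z ^ card A * c A * of_real (walsh A \<epsilon>))" for \<epsilon>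
    by (intro sum.cong) (auto simp: Int_absorb2)
  ultimately show ?thesis by simp
qed

section \<open>Growth of polynomials off the lens\<close>

definition exterior_numerator :: "real \<Rightarrow> complex \<Rightarrow> complex" where
  "exterior_numerator \<gamma> u = (1 + u) powr of_real \<gamma> + (1 - u) powr of_real \<gamma>"

definition exterior_denominator :: "real \<Rightarrow> complex \<Rightarrow> complex" where
  "exterior_denominator \<gamma> u = (1 + u) powr of_real \<gamma> - (1 - u) powr of_real \<gamma>"

text \<open>Let \<open>\<zeta> = ((1 + u) / (1 - u))\<^sup>\<gamma>\<close>. Then \<open>z = (\<zeta> + 1) / (\<zeta> - 1)\<close> maps the punctured unit disc to the exterior of
  a lens with angle \<open>(2 - \<gamma>) \<pi>\<close> at \<open>\<plusminus>1\<close>, with \<open>u = 0\<close> going to infinity. The function defined here is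
  \<open>u z\<close>, with its limit at the removable singularity \<open>0\<close>.\<close>

definition exterior_map :: "real \<Rightarrow> complex \<Rightarrow> complex" where
  "exterior_map \<gamma> u = exterior_numerator \<gamma> u / (if u = 0 then of_real (2 * \<gamma>) else exterior_denominator \<gamma> u / u)"

lemma powr_holomorphic_ball:
  "(\<lambda>u. (1 + u) powr of_real \<gamma>) holomorphic_on ball 0 1" "(\<lambda>u. (1 - u) powr of_real \<gamma>) holomorphic_on ball 0 1"
proof -
  have "1 + u \<notin> \<real>\<^sub>\<le>\<^sub>0" "1 - u \<notin> \<real>\<^sub>\<le>\<^sub>0" if "u \<in> ball 0 1" for u :: complex
  proof -
    have "\<bar>Re u\<bar> < 1" using that abs_Re_le_cmod[of u] by simp
    then show "1 + u \<notin> \<real>\<^sub>\<le>\<^sub>0" "1 - u \<notin> \<real>\<^sub>\<le>\<^sub>0" by (auto simp: complex_nonpos_Reals_iff)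
  qed
  then show "(\<lambda>u. (1 + u) powr of_real \<gamma>) holomorphic_on ball 0 1" "(\<lambda>u. (1 - u) powr of_real \<gamma>) holomorphic_on ball 0 1"
    by (auto intro!: holomorphic_intros)
qed

lemma powr_continuous_half_plane:
  assumes "0 < \<gamma>"
  shows "continuous_on {w. 0 \<le> Re w} (\<lambda>w. w powr of_real \<gamma>)"
proof -
  have "isCont (\<lambda>w. w powr of_real \<gamma>) w" if "0 \<le> Re w" for w
  proof (cases "w = 0")
    case True
    have "((\<lambda>w :: complex. norm w powr \<gamma>) \<longlongrightarrow> norm (0 :: complex) powr \<gamma>) (at 0)"
      by (rule tendsto_powr'[OF tendsto_norm[OF tendsto_ident_at] tendsto_const]) (use assms in auto)
    then have "((\<lambda>w. norm (w powr of_real \<gamma>)) \<longlongrightarrow> 0) (at (0 :: complex))"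
      using assms by (simp add: norm_powr_real_powr')
    then show ?thesis unfolding True isCont_def using tendsto_norm_zero_iff[of "\<lambda>w. w powr of_real \<gamma>" "at (0::complex)"] by simp
  next
    case False
    then have "w \<notin> \<real>\<^sub>\<le>\<^sub>0" using that by (auto simp: complex_nonpos_Reals_iff complex_eq_iff)
    then show ?thesis by (intro continuous_intros) auto
  qed
  then show ?thesis by (auto intro: continuous_at_imp_continuous_on)
qed

lemma Re_one_plus_minus_nonneg:
  fixes u :: complex
  assumes "norm u \<le> 1"
  shows "0 \<le> Re (1 + u)" "0 \<le> Re (1 - u)"
  using assms abs_Re_le_cmod[of u] by auto

text \<open>Polar coordinates \<open>(1 + u) / (1 - u) = t cis \<theta>\<close>. The quotient lies in the closed right half-plane, on its
  boundary exactly for \<open>|u| = 1\<close>, and its principal logarithm is the difference of those of \<open>1 + u\<close> and \<open>1 - u\<close>.\<close>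

lemma Arg_half_plane:
  assumes "norm u \<le> 1" "u \<noteq> 1" "u \<noteq> -1"
  obtains t \<theta> where "0 < t" "\<bar>\<theta>\<bar> \<le> pi / 2" "norm u = 1 \<Longrightarrow> \<bar>\<theta>\<bar> = pi / 2"
    "\<theta> = 0 \<Longrightarrow> t = 1 \<Longrightarrow> u = 0"
    "\<And>\<gamma>. (1 + u) powr of_real \<gamma> = (1 - u) powr of_real \<gamma> * (of_real (t powr \<gamma>) * cis (\<gamma> * \<theta>))"
proof -
  have n: "1 + u \<noteq> 0" "1 - u \<noteq> 0" using assms by (auto simp: add_eq_0_iff)
  define w where "w = (1 + u) / (1 - u)"
  have w0: "w \<noteq> 0" using n by (simp add: w_def)
  have Re_w: "Re w = (1 - (norm u)\<^sup>2) / (norm (1 - u))\<^sup>2"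
  proof -
    have "w = (1 + u) * cnj (1 - u) / of_real ((norm (1 - u))\<^sup>2)"
      using n by (simp only: w_def complex_norm_square) simp
    moreover have "Re ((1 + u) * cnj (1 - u)) = 1 - (norm u)\<^sup>2"
      by (simp add: cmod_power2) (simp add: power2_eq_square algebra_simps)
    ultimately show ?thesis by (simp only: Re_divide_of_real)
  qed
  have Re0: "0 \<le> Re w" unfolding Re_w using assms by (simp add: abs_square_le_1)
  have lnw: "Ln w = Ln (1 + u) - Ln (1 - u)"
  proof -
    have a: "\<bar>Im (Ln (1 + u))\<bar> \<le> pi / 2" "\<bar>Im (Ln (1 - u))\<bar> \<le> pi / 2"
      using Re_Ln_pos_le[OF n(1)] Re_Ln_pos_le[OF n(2)] Re_one_plus_minus_nonneg[OF assms(1)] by auto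
    have lt: "\<bar>Im (Ln (1 + u))\<bar> < pi / 2 \<or> \<bar>Im (Ln (1 - u))\<bar> < pi / 2"
    proof (cases "0 < Re (1 + u)")
      case True then show ?thesis using Re_Ln_pos_lt[OF n(1)] by simp
    next
      case False
      then have "0 < Re (1 - u)" by simp
      then show ?thesis using Re_Ln_pos_lt[OF n(2)] by simp
    qed
    have "exp (Ln (1 + u) - Ln (1 - u)) = w" using n by (simp add: exp_diff w_def)
    moreover have "- pi < Im (Ln (1 + u) - Ln (1 - u))" "Im (Ln (1 + u) - Ln (1 - u)) \<le> pi"
      using a lt by (auto simp: abs_if split: if_splits)
    ultimately show ?thesis by (metis Ln_exp)
  qed
  define \<theta> t where "\<theta> = Im (Ln w)" and "t = norm w"
  have t: "0 < t" using w0 by (simp add: t_def)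
  have wt: "w = of_real t * cis \<theta>" and lnw': "Ln w = of_real (ln t) + \<i> * of_real \<theta>"
  proof -
    show l: "Ln w = of_real (ln t) + \<i> * of_real \<theta>"
      using w0 by (simp add: complex_eq_iff \<theta>_def t_def Re_Ln)
    have "w = exp (Ln w)" using w0 by simp
    also have "\<dots> = of_real t * cis \<theta>" unfolding l exp_add using t by (simp add: exp_of_real cis_conv_exp)
    finally show "w = of_real t * cis \<theta>" .
  qed
  show thesis
  proof (rule that[of t \<theta>])
    show "0 < t" by (rule t)
    show "\<bar>\<theta>\<bar> \<le> pi / 2" unfolding \<theta>_def using Re_Ln_pos_le[OF w0] Re0 by simp
    show "\<bar>\<theta>\<bar> = pi / 2" if "norm u = 1"
    proof -
      have "\<not> 0 < Re w" unfolding Re_w that by simp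
      then have "\<not> \<bar>\<theta>\<bar> < pi / 2" unfolding \<theta>_def using Re_Ln_pos_lt[OF w0] by simp
      then show ?thesis using \<open>\<bar>\<theta>\<bar> \<le> pi / 2\<close> by simp
    qed
    show "u = 0" if "\<theta> = 0" "t = 1"
    proof -
      have "w = 1" using wt that by simp
      then have "1 + u = 1 - u" using n by (simp add: w_def divide_eq_1_iff)
      then show ?thesis by simp
    qed
    show "(1 + u) powr of_real \<gamma> = (1 - u) powr of_real \<gamma> * (of_real (t powr \<gamma>) * cis (\<gamma> * \<theta>))" for \<gamma>
    proof -
      have "(1 + u) powr of_real \<gamma> = exp (of_real \<gamma> * (Ln (1 - u) + Ln w))"
        using n lnw by (simp add: powr_def)
      also have "\<dots> = (1 - u) powr of_real \<gamma> * exp (of_real \<gamma> * Ln w)"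
        using n by (simp add: powr_def distrib_left exp_add)
      also have "of_real \<gamma> * Ln w = of_real (\<gamma> * ln t) + \<i> * of_real (\<gamma> * \<theta>)"
        unfolding lnw' by (simp add: algebra_simps)
      also have "exp \<dots> = of_real (t powr \<gamma>) * cis (\<gamma> * \<theta>)"
        unfolding exp_add exp_of_real cis_conv_exp powr_def using t by simp
      finally show ?thesis .
    qed
  qed
qed

text \<open>A zero would mean \<open>t\<^sup>\<gamma> cis (\<gamma>\<theta>) = 1\<close>. As \<open>|\<gamma>\<theta>| < \<pi>\<close>, this forces \<open>t = 1\<close> and \<open>\<theta> = 0\<close>, hence \<open>u = 0\<close>.\<close>

lemma exterior_denominator_nonzero:
  assumes \<gamma>: "0 < \<gamma>" "\<gamma> < 2" and u: "norm u \<le> 1" "u \<noteq> 0"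
  shows "exterior_denominator \<gamma> u \<noteq> 0"
proof (cases "u = 1 \<or> u = -1")
  case True
  then show ?thesis using \<gamma> by (auto simp: exterior_denominator_def)
next
  case False
  then obtain t \<theta> where t: "0 < t" "\<bar>\<theta>\<bar> \<le> pi / 2" "\<theta> = 0 \<Longrightarrow> t = 1 \<Longrightarrow> u = 0"
    and e: "\<And>\<gamma>. (1 + u) powr of_real \<gamma> = (1 - u) powr of_real \<gamma> * (of_real (t powr \<gamma>) * cis (\<gamma> * \<theta>))"
    using Arg_half_plane[OF u(1)] by (metis (full_types))
  have n: "(1 - u) powr of_real \<gamma> \<noteq> 0" using False by simp
  show ?thesis
  proof
    assume "exterior_denominator \<gamma> u = 0"
    then have 1: "of_real (t powr \<gamma>) * cis (\<gamma> * \<theta>) = 1"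
      using n e[of \<gamma>] by (simp add: exterior_denominator_def)
    then have "norm (of_real (t powr \<gamma>) * cis (\<gamma> * \<theta>)) = 1" by simp
    then have t1: "t powr \<gamma> = 1" by (simp add: norm_mult)
    have "t = (t powr \<gamma>) powr (1 / \<gamma>)" using \<gamma> t by (simp add: powr_powr)
    then have "t = 1" by (simp add: t1)
    have "\<bar>\<gamma> * \<theta>\<bar> < pi"
    proof -
      have "\<gamma> * \<bar>\<theta>\<bar> \<le> \<gamma> * (pi / 2)" using \<gamma> t by (intro mult_left_mono) auto
      also have "\<dots> < 2 * (pi / 2)" using \<gamma> by (intro mult_strict_right_mono) auto
      finally show ?thesis using \<gamma> by (simp add: abs_mult)
    qed
    moreover have "cos (\<gamma> * \<theta>) = 1" using 1 t1 by (simp add: complex_eq_iff)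
    ultimately have "\<gamma> * \<theta> = 0"
      by (metis abs_of_nonneg abs_zero cos_abs_real cos_zero cos_inj_pi less_eq_real_def abs_ge_zero pi_ge_zero abs_eq_0)
    then show False using \<gamma> t \<open>t = 1\<close> u by simp
  qed
qed

lemma exterior_map_holomorphic:
  assumes \<gamma>: "0 < \<gamma>" "\<gamma> < 2"
  shows "exterior_map \<gamma> holomorphic_on ball 0 1"
proof -
  have D: "exterior_denominator \<gamma> holomorphic_on ball 0 1" and N: "exterior_numerator \<gamma> holomorphic_on ball 0 1"
    unfolding exterior_denominator_def exterior_numerator_def
    by (intro holomorphic_intros powr_holomorphic_ball)+
  have d: "deriv (exterior_denominator \<gamma>) 0 = of_real (2 * \<gamma>)"
  proof (rule DERIV_imp_deriv)
    show "(exterior_denominator \<gamma> has_field_derivative of_real (2 * \<gamma>)) (at 0)"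
      unfolding exterior_denominator_def
      by (auto intro!: derivative_eq_intros simp: complex_nonpos_Reals_iff)
  qed
  have z: "exterior_denominator \<gamma> 0 = 0" by (simp add: exterior_denominator_def)
  have "(\<lambda>u. if u = 0 then deriv (exterior_denominator \<gamma>) 0 else (exterior_denominator \<gamma> u - exterior_denominator \<gamma> 0) / (u - 0))
      holomorphic_on ball 0 1"
    by (rule pole_lemma_open[OF D]) simp
  then have H: "(\<lambda>u. if u = 0 then of_real (2 * \<gamma>) else exterior_denominator \<gamma> u / u) holomorphic_on ball 0 1"
    by (simp only: d z diff_zero)
  have "(if u = 0 then of_real (2 * \<gamma>) else exterior_denominator \<gamma> u / u) \<noteq> 0" if "u \<in> ball 0 1" for u
    using exterior_denominator_nonzero[OF \<gamma>, of u] that \<gamma> by auto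
  then show ?thesis
    unfolding exterior_map_def[abs_def] by (intro holomorphic_on_divide N H)
qed

lemma exterior_map_continuous:
  assumes \<gamma>: "0 < \<gamma>" "\<gamma> < 2"
  shows "continuous_on (cball 0 1) (exterior_map \<gamma>)"
proof -
  have c1: "continuous_on (cball 0 1) (\<lambda>u::complex. (1 + u) powr of_real \<gamma>)"
    by (rule continuous_on_compose2[OF powr_continuous_half_plane[OF \<gamma>(1)] _ image_subsetI, of _ "\<lambda>u. 1 + u"])
       (use Re_one_plus_minus_nonneg in \<open>auto intro!: continuous_intros\<close>)
  have c2: "continuous_on (cball 0 1) (\<lambda>u::complex. (1 - u) powr of_real \<gamma>)"
    by (rule continuous_on_compose2[OF powr_continuous_half_plane[OF \<gamma>(1)] _ image_subsetI, of _ "\<lambda>u. 1 - u"])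
       (use Re_one_plus_minus_nonneg in \<open>auto intro!: continuous_intros\<close>)
  have D: "continuous_on (cball 0 1) (exterior_denominator \<gamma>)" and N: "continuous_on (cball 0 1) (exterior_numerator \<gamma>)"
    unfolding exterior_denominator_def exterior_numerator_def by (intro continuous_intros c1 c2)+
  have "continuous_on (cball 0 1 - {0}) (exterior_map \<gamma>)"
  proof (rule continuous_on_eq)
    show "continuous_on (cball 0 1 - {0}) (\<lambda>u. exterior_numerator \<gamma> u / (exterior_denominator \<gamma> u / u))"
      using exterior_denominator_nonzero[OF \<gamma>]
      by (intro continuous_on_divide continuous_on_id continuous_on_subset[OF D] continuous_on_subset[OF N]) auto
  qed (simp add: exterior_map_def)
  moreover have "continuous_on (ball 0 1) (exterior_map \<gamma>)"
    using exterior_map_holomorphic[OF \<gamma>] by (rule holomorphic_on_imp_continuous_on)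
  moreover have "cball 0 1 = (cball 0 1 - {0}) \<union> ball (0::complex) 1" by auto
  moreover have "openin (top_of_set (cball 0 1)) (cball 0 1 - {0::complex})"
    by (simp add: openin_delete)
  moreover have "openin (top_of_set (cball 0 1)) (ball (0::complex) 1)"
    by (rule open_subset) auto
  ultimately show ?thesis
    by (metis continuous_on_Un_local_open)
qed

text \<open>For \<open>|u| = 1\<close> the argument of \<open>\<zeta>\<close> is \<open>\<plusminus>\<gamma>\<pi>/2\<close>. Since \<open>1 - z\<^sup>2 = -4\<zeta> / (\<zeta> - 1)\<^sup>2\<close> and
  \<open>1 - |z|\<^sup>2 = -4 Re \<zeta> / |\<zeta> - 1|\<^sup>2\<close>, the inequality defining the lens reads \<open>|p - 2| \<le> -p cos (\<gamma>\<pi>/2)\<close>.\<close>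

lemma exterior_map_boundary:
  assumes \<gamma>: "0 < \<gamma>" "\<gamma> < 2" and p: "\<bar>p - 2\<bar> \<le> - p * cos (\<gamma> * pi / 2)" and u: "norm u = 1"
  shows "exterior_map \<gamma> u / u \<in> contraction_lens p"
proof -
  have u0: "u \<noteq> 0" using u by auto
  have z: "exterior_map \<gamma> u / u = exterior_numerator \<gamma> u / exterior_denominator \<gamma> u"
    using u0 by (simp add: exterior_map_def)
  show ?thesis
  proof (cases "u = 1 \<or> u = -1")
    case True
    then have "exterior_map \<gamma> u / u = 1 \<or> exterior_map \<gamma> u / u = -1"
      unfolding z using \<gamma> by (auto simp: exterior_numerator_def exterior_denominator_def divide_eq_minus_1_iff)
    then show ?thesis by (auto simp: contraction_lens_def)
  next
    case False
    then obtain t \<theta> where t: "0 < t" "\<bar>\<theta>\<bar> = pi / 2"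
      and e: "\<And>\<gamma>. (1 + u) powr of_real \<gamma> = (1 - u) powr of_real \<gamma> * (of_real (t powr \<gamma>) * cis (\<gamma> * \<theta>))"
      using Arg_half_plane[of u] u by (metis (full_types) order_refl)
    define \<zeta> \<tau> where "\<zeta> = of_real (t powr \<gamma>) * cis (\<gamma> * \<theta>)" and "\<tau> = t powr \<gamma>"
    have \<tau>: "0 < \<tau>" using t by (simp add: \<tau>_def)
    have n: "(1 - u) powr of_real \<gamma> \<noteq> 0" using False by simp
    have d0: "exterior_denominator \<gamma> u \<noteq> 0" using exterior_denominator_nonzero[OF \<gamma>, of u] u u0 by simp
    have den: "exterior_denominator \<gamma> u = (1 - u) powr of_real \<gamma> * (\<zeta> - 1)"
      and num: "exterior_numerator \<gamma> u = (1 - u) powr of_real \<gamma> * (\<zeta> + 1)"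
      unfolding exterior_denominator_def exterior_numerator_def e \<zeta>_def by (simp_all add: algebra_simps)
    have \<zeta>1: "\<zeta> - 1 \<noteq> 0" using d0 den by auto
    define z where "z = (\<zeta> + 1) / (\<zeta> - 1)"
    have zz: "exterior_map \<gamma> u / u = z" unfolding z den num z_def using n by simp
    have n\<zeta>: "norm \<zeta> = \<tau>" using \<tau> by (simp add: \<zeta>_def norm_mult \<tau>_def)
    have Re\<zeta>: "Re \<zeta> = \<tau> * cos (\<gamma> * pi / 2)"
    proof -
      have "cos (\<gamma> * \<theta>) = cos \<bar>\<gamma> * \<theta>\<bar>" by simp
      also have "\<bar>\<gamma> * \<theta>\<bar> = \<gamma> * pi / 2" using \<gamma> t(2) by (simp add: abs_mult)
      finally show ?thesis by (simp add: \<zeta>_def \<tau>_def)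
    qed
    define D where "D = (norm (\<zeta> - 1))\<^sup>2"
    have D: "0 < D" using \<zeta>1 by (simp add: D_def)
    have "1 - z\<^sup>2 = - 4 * \<zeta> / (\<zeta> - 1)\<^sup>2"
    proof -
      have "1 - z\<^sup>2 = ((\<zeta> - 1)\<^sup>2 - (\<zeta> + 1)\<^sup>2) / (\<zeta> - 1)\<^sup>2"
        using \<zeta>1 by (simp add: z_def power_divide diff_divide_distrib)
      also have "(\<zeta> - 1)\<^sup>2 - (\<zeta> + 1)\<^sup>2 = - 4 * \<zeta>" by (simp add: power2_eq_square algebra_simps)
      finally show ?thesis .
    qed
    then have A: "norm (1 - z\<^sup>2) = 4 * \<tau> / D"
      by (simp add: norm_divide norm_mult norm_power n\<zeta> D_def)
    have B: "1 - (norm z)\<^sup>2 = - 4 * (\<tau> * cos (\<gamma> * pi / 2)) / D"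
    proof -
      have "(norm (\<zeta> - 1))\<^sup>2 - (norm (\<zeta> + 1))\<^sup>2 = - 4 * Re \<zeta>"
        by (simp add: cmod_power2) (simp add: power2_eq_square algebra_simps)
      moreover have "(norm z)\<^sup>2 = (norm (\<zeta> + 1))\<^sup>2 / D" by (simp add: z_def norm_divide power_divide D_def)
      ultimately show ?thesis using D unfolding Re\<zeta> by (simp add: D_def[symmetric] field_simps)
    qed
    have "\<bar>p - 2\<bar> * (4 * \<tau> / D) \<le> (- p * cos (\<gamma> * pi / 2)) * (4 * \<tau> / D)"
      using p \<tau> D by (intro mult_right_mono) auto
    then have "\<bar>p - 2\<bar> * norm (1 - z\<^sup>2) \<le> p * (1 - (norm z)\<^sup>2)"
      unfolding A B by (simp add: algebra_simps)
    then show ?thesis unfolding zz contraction_lens_def by simp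
  qed
qed

text \<open>A Bernstein-Walsh estimate. Multiplied by \<open>u\<^sup>d\<close>, the polynomial in \<open>z\<close> becomes a polynomial in
  \<open>u\<close> and \<open>u z\<close>, which is holomorphic in the unit disc also at \<open>u = 0\<close>; the maximum principle compares it
  with its values on the unit circle, where \<open>z\<close> lies in the lens.\<close>

lemma polynomial_growth_off_lens:
  fixes c :: "nat \<Rightarrow> complex"
  assumes \<gamma>: "0 < \<gamma>" "\<gamma> < 2" and p: "\<bar>p - 2\<bar> \<le> - p * cos (\<gamma> * pi / 2)"
    and M: "\<And>z. z \<in> contraction_lens p \<Longrightarrow> norm (\<Sum>k\<le>d. c k * z ^ k) \<le> M"
    and u: "norm u < 1" "u \<noteq> 0"
  shows "norm u ^ d * norm (\<Sum>k\<le>d. c k * (exterior_map \<gamma> u / u) ^ k) \<le> M"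
proof -
  define G where "G u = (\<Sum>k\<le>d. c k * exterior_map \<gamma> u ^ k * u ^ (d - k))" for u
  have G: "G u = u ^ d * (\<Sum>k\<le>d. c k * (exterior_map \<gamma> u / u) ^ k)" if "u \<noteq> 0" for u
  proof -
    have "c k * exterior_map \<gamma> u ^ k * u ^ (d - k) = u ^ d * (c k * (exterior_map \<gamma> u / u) ^ k)" if "k \<le> d" for k
    proof -
      have "u ^ d = u ^ k * u ^ (d - k)" using that by (simp add: power_add[symmetric])
      then show ?thesis using \<open>u \<noteq> 0\<close> by (simp add: power_divide)
    qed
    then show ?thesis unfolding G_def sum_distrib_left by (intro sum.cong refl) simp
  qed
  have "norm (G u) \<le> M"
  proof (rule maximum_modulus_frontier[of G "cball 0 1"])
    show "G holomorphic_on interior (cball 0 1)"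
      unfolding G_def using exterior_map_holomorphic[OF \<gamma>] by (auto intro!: holomorphic_intros)
    show "continuous_on (closure (cball 0 1)) G"
      unfolding G_def using exterior_map_continuous[OF \<gamma>] by (auto intro!: continuous_intros)
    show "bounded (cball (0::complex) 1)" by simp
    show "u \<in> cball 0 1" using u by simp
    fix v :: complex assume "v \<in> frontier (cball 0 1)"
    then have v: "norm v = 1" by (simp add: frontier_cball)
    then have "v \<noteq> 0" by auto
    have "exterior_map \<gamma> v / v \<in> contraction_lens p" by (rule exterior_map_boundary[OF \<gamma> p v])
    from M[OF this] show "norm (G v) \<le> M" unfolding G[OF \<open>v \<noteq> 0\<close>] by (simp add: norm_mult norm_power v)
  qed
  then show ?thesis unfolding G[OF u(2)] by (simp add: norm_mult norm_power)
qed

section \<open>Comparison of norms\<close>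

text \<open>The sine of \<open>theta p / 2\<close> is \<open>2 \<surd>(p - 1) / p\<close>, so its cosine is \<open>|p - 2| / p\<close>.\<close>

lemma theta_range:
  assumes "1 < p"
  shows "0 < theta p" "theta p \<le> pi" and "cos (theta p / 2) = \<bar>p - 2\<bar> / p"
proof -
  define x where "x = 2 * sqrt (p - 1) / p"
  have x2: "x\<^sup>2 = 1 - ((p - 2) / p)\<^sup>2"
  proof -
    have "x\<^sup>2 = 4 * (p - 1) / p\<^sup>2" using assms by (simp add: x_def power_divide power_mult_distrib)
    also have "\<dots> = 1 - ((p - 2) / p)\<^sup>2" using assms by (simp add: field_simps power2_eq_square)
    finally show ?thesis .
  qed
  have x0: "0 < x" using assms by (simp add: x_def)
  have "x\<^sup>2 \<le> 1" unfolding x2 by simp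
  then have x1: "x \<le> 1" using x0 by (simp add: abs_square_le_1)
  have th: "theta p = 2 * arcsin x" by (simp add: theta_def x_def)
  show "0 < theta p" using x0 x1 arcsin_less_arcsin[of 0 x] by (simp add: th)
  show "theta p \<le> pi" using x0 x1 arcsin_bounded[of x] by (simp add: th)
  have "cos (theta p / 2) = sqrt (1 - x\<^sup>2)" using x0 x1 by (simp add: th cos_arcsin)
  also have "\<dots> = \<bar>p - 2\<bar> / p" using assms by (simp add: x2 real_sqrt_abs[symmetric] del: real_sqrt_abs) (simp add: abs_divide)
  finally show "cos (theta p / 2) = \<bar>p - 2\<bar> / p" .
qed

lemma sum_by_card:
  fixes e :: "nat set \<Rightarrow> complex"
  assumes "\<And>A. A \<in> Pow {1..n} \<Longrightarrow> d < card A \<Longrightarrow> e A = 0"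
  shows "(\<Sum>A\<in>Pow {1..n}. z ^ card A * e A) = (\<Sum>k\<le>d. (\<Sum>A\<in>{A\<in>Pow {1..n}. card A = k}. e A) * z ^ k)"
proof -
  have "(\<Sum>k\<le>d. (\<Sum>A\<in>{A\<in>Pow {1..n}. card A = k}. e A) * z ^ k)
      = (\<Sum>k\<le>d. \<Sum>A\<in>Pow {1..n}. if card A = k then z ^ k * e A else 0)"
    unfolding sum_distrib_right by (intro sum.cong refl sum.mono_neutral_cong_left) auto
  also have "\<dots> = (\<Sum>A\<in>Pow {1..n}. \<Sum>k\<le>d. if card A = k then z ^ k * e A else 0)"
    by (rule sum.swap)
  also have "\<dots> = (\<Sum>A\<in>Pow {1..n}. z ^ card A * e A)"
    by (intro sum.cong refl) (use assms in \<open>auto simp: sum.delta' not_le\<close>)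
  finally show ?thesis by simp
qed

text \<open>Pairing \<open>F z\<close> with the function that norms \<open>F R\<close> gives a scalar polynomial in \<open>z\<close> of degree at most \<open>d\<close>, which
  by Hoelder's inequality is bounded on the lens.\<close>

lemma Lp_norm_dilate_le:
  fixes c :: "nat set \<Rightarrow> complex" and u :: complex
  assumes p: "1 < p" and \<gamma>: "0 < \<gamma>" "\<gamma> < 2" "\<bar>p - 2\<bar> \<le> - p * cos (\<gamma> * pi / 2)"
    and c: "\<And>A. A \<in> Pow {1..n} \<Longrightarrow> d < card A \<Longrightarrow> c A = 0"
    and u: "norm u < 1" "u \<noteq> 0"
  defines "F \<equiv> \<lambda>z \<epsilon>. \<Sum>A\<in>Pow {1..n}. z ^ card A * c A * of_real (walsh A \<epsilon>)"
  shows "norm u ^ d * Lp_norm n p (F (exterior_map \<gamma> u / u)) \<le> Lp_norm n p (F 1)"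
proof -
  define p' where "p' = p / (p - 1)"
  have p': "1 / p + 1 / p' = 1" "1 < p'" "(p - 1) * p' = p" using p by (auto simp: p'_def field_simps)
  define R where "R = exterior_map \<gamma> u / u"
  define N where "N = Lp_norm n p (F R)"
  have N0: "0 \<le> N" by (simp add: N_def Lp_norm_nonneg)
  define h where "h \<epsilon> = norming p (F R \<epsilon>)" for \<epsilon>
  have hn: "norm (h \<epsilon>) = norm (F R \<epsilon>) powr (p - 1)"
    and hm: "F R \<epsilon> * h \<epsilon> = of_real (norm (F R \<epsilon>) powr p)" for \<epsilon>
    using p by (simp_all add: h_def norm_norming mult_norming)
  have hN: "Lp_norm n p' h = N powr (p - 1)"
  proof -
    have "Lp_norm n p' h = (N powr p) powr (1 / p')"
      using p p' by (simp add: Lp_norm_def[of n p'] hn powr_powr N_def Lp_norm_powr)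
    then show ?thesis using p by (simp add: powr_powr p'_def)
  qed
  define P where "P z = (\<Sum>\<epsilon>\<in>cube n. F z \<epsilon> * h \<epsilon>) / 2 ^ n" for z
  define e where "e A = c A * ((\<Sum>\<epsilon>\<in>cube n. of_real (walsh A \<epsilon>) * h \<epsilon>) / 2 ^ n)" for A
  have "P z = (\<Sum>A\<in>Pow {1..n}. z ^ card A * e A)" for z
  proof -
    have "(\<Sum>\<epsilon>\<in>cube n. F z \<epsilon> * h \<epsilon>) = (\<Sum>\<epsilon>\<in>cube n. \<Sum>A\<in>Pow {1..n}. z ^ card A * c A * (of_real (walsh A \<epsilon>) * h \<epsilon>))"
      by (simp add: F_def sum_distrib_right mult.assoc)
    also have "\<dots> = (\<Sum>A\<in>Pow {1..n}. \<Sum>\<epsilon>\<in>cube n. z ^ card A * c A * (of_real (walsh A \<epsilon>) * h \<epsilon>))"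
      by (rule sum.swap)
    finally have "P z = (\<Sum>A\<in>Pow {1..n}. \<Sum>\<epsilon>\<in>cube n. z ^ card A * c A * (of_real (walsh A \<epsilon>) * h \<epsilon>)) / 2 ^ n"
      by (simp only: P_def)
    then show ?thesis
      by (simp only: e_def sum_divide_distrib sum_distrib_left mult.assoc times_divide_eq_right)
  qed
  then have P: "P z = (\<Sum>k\<le>d. (\<Sum>A\<in>{A\<in>Pow {1..n}. card A = k}. e A) * z ^ k)" for z
    using sum_by_card[of n d e z] c by (simp add: e_def)
  have "norm u ^ d * norm (P R) \<le> Lp_norm n p (F 1) * N powr (p - 1)"
    unfolding P R_def
  proof (rule polynomial_growth_off_lens[OF \<gamma> _ u])
    fix z assume z: "z \<in> contraction_lens p"
    have "norm (P z) \<le> Lp_norm n p (F z) * Lp_norm n p' h"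
      unfolding P_def by (rule Lp_norm_Holder[OF p p'(2,1)])
    also have "\<dots> \<le> Lp_norm n p (F 1) * N powr (p - 1)"
      unfolding hN using Lp_norm_lens[OF p z, of n c] by (intro mult_right_mono) (simp_all add: F_def)
    finally show "norm (\<Sum>k\<le>d. (\<Sum>A\<in>{A\<in>Pow {1..n}. card A = k}. e A) * z ^ k) \<le> Lp_norm n p (F 1) * N powr (p - 1)"
      unfolding P .
  qed
  moreover have "norm (P R) = N powr p"
  proof -
    have "P R = of_real ((\<Sum>\<epsilon>\<in>cube n. norm (F R \<epsilon>) powr p) / 2 ^ n)"
      unfolding P_def hm by simp
    also have "\<dots> = of_real (N powr p)" unfolding N_def using p by (simp only: Lp_norm_powr)
    finally show ?thesis by simp
  qed
  ultimately have le: "norm u ^ d * N powr p \<le> Lp_norm n p (F 1) * N powr (p - 1)" by simp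
  have "norm u ^ d * N \<le> Lp_norm n p (F 1)"
  proof (cases "N = 0")
    case False
    have "N powr p = N * N powr (p - 1)" using N0 by (simp add: powr_mult_base)
    then have "(norm u ^ d * N) * N powr (p - 1) \<le> Lp_norm n p (F 1) * N powr (p - 1)" using le by simp
    then show ?thesis using False N0 by simp
  qed (simp add: Lp_norm_nonneg)
  then show ?thesis by (simp add: N_def R_def)
qed

theorem corollary12:
  fixes p q :: real and n d :: nat and f :: "(nat \<Rightarrow> real) \<Rightarrow> complex"
  assumes "1 < q" and "q < p"
    and "d \<in> {1..n}"
    and "degree_at_most n d f"
  shows "Lp_norm n p f \<le>
    (((sqrt (p - 1) + sqrt (q - 1)) powr (pi / (2 * pi - theta p)) +
      (sqrt (p - 1) - sqrt (q - 1)) powr (pi / (2 * pi - theta p))) /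
     ((sqrt (p - 1) + sqrt (q - 1)) powr (pi / (2 * pi - theta p)) -
      (sqrt (p - 1) - sqrt (q - 1)) powr (pi / (2 * pi - theta p)))) ^ d
    * Lp_norm n q f"
proof -
  have p: "1 < p" using assms by simp
  note \<theta> = theta_range[OF p]
  define \<gamma> where "\<gamma> = 2 - theta p / pi"
  have \<gamma>: "0 < \<gamma>" "\<gamma> < 2" using \<theta> by (simp_all add: \<gamma>_def divide_less_eq)
  have \<kappa>: "pi / (2 * pi - theta p) = 1 / \<gamma>" by (simp add: \<gamma>_def field_simps)
  have lens: "\<bar>p - 2\<bar> \<le> - p * cos (\<gamma> * pi / 2)"
  proof -
    have \<gamma>\<pi>: "\<gamma> * pi / 2 = pi - theta p / 2" by (simp add: \<gamma>_def field_simps)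
    have "cos (\<gamma> * pi / 2) = - cos (theta p / 2)" unfolding \<gamma>\<pi> by (simp add: cos_diff)
    also have "\<dots> = - (\<bar>p - 2\<bar> / p)" unfolding \<theta>(3) ..
    finally show ?thesis using p by simp
  qed
  define a b where "a = sqrt (p - 1)" and "b = sqrt (q - 1)"
  have ab: "0 < b" "b < a" using assms by (auto simp: a_def b_def)
  \<comment> \<open>The conformal map onto the exterior of the lens sends the point \<open>u\<close> below to \<open>a / b = 1 / r\<close>.\<close>
  define X Y where "X = (a + b) powr (1 / \<gamma>)" and "Y = (a - b) powr (1 / \<gamma>)"
  have Y0: "0 < Y" and YX: "Y < X" using ab \<gamma> by (auto simp: X_def Y_def intro!: powr_less_mono2)
  have X\<gamma>: "X powr \<gamma> = a + b" and Y\<gamma>: "Y powr \<gamma> = a - b" using ab \<gamma> by (auto simp: X_def Y_def powr_powr)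
  define u where "u = (X - Y) / (X + Y)"
  have u: "0 < u" "u < 1" using Y0 YX by (auto simp: u_def)
  have R: "exterior_map \<gamma> (of_real u) / of_real u = of_real (a / b)"
  proof -
    define k where "k = 2 / (X + Y)"
    have k: "0 < k" using Y0 YX by (simp add: k_def)
    have "1 + u = k * X" "1 - u = k * Y" using Y0 YX by (auto simp: u_def k_def field_simps)
    then have pw: "(1 + u) powr \<gamma> = k powr \<gamma> * (a + b)" "(1 - u) powr \<gamma> = k powr \<gamma> * (a - b)"
      by (simp_all add: powr_mult X\<gamma> Y\<gamma>)
    have cpw: "(1 + of_real u) powr of_real \<gamma> = (of_real ((1 + u) powr \<gamma>) :: complex)"
      "(1 - of_real u) powr of_real \<gamma> = (of_real ((1 - u) powr \<gamma>) :: complex)"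
      using u powr_of_real[of "1 + u" \<gamma>] powr_of_real[of "1 - u" \<gamma>] by simp_all
    have "exterior_numerator \<gamma> (of_real u) = of_real (2 * k powr \<gamma> * a)"
      "exterior_denominator \<gamma> (of_real u) = of_real (2 * k powr \<gamma> * b)"
      unfolding exterior_numerator_def exterior_denominator_def cpw pw by (simp_all add: algebra_simps)
    then show ?thesis using u k ab by (simp add: exterior_map_def)
  qed
  define r where "r = b / a"
  have r: "r = sqrt ((q - 1) / (p - 1))" by (simp add: r_def a_def b_def real_sqrt_divide)
  \<comment> \<open>The Fourier coefficients of \<open>T\<^sub>r f\<close>.\<close>
  define c where "c A = of_real r ^ card A * fourier_coeff n f A" for A
  have cz: "c A = 0" if "A \<in> Pow {1..n}" "d < card A" for A
    using assms(4) that by (auto simp: c_def degree_at_most_def)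
  have uc: "norm (of_real u :: complex) < 1" "(of_real u :: complex) \<noteq> 0" using u by auto
  have "u ^ d * Lp_norm n p (\<lambda>\<epsilon>. \<Sum>A\<in>Pow {1..n}. of_real (a / b) ^ card A * c A * of_real (walsh A \<epsilon>))
      \<le> Lp_norm n p (\<lambda>\<epsilon>. \<Sum>A\<in>Pow {1..n}. 1 ^ card A * c A * of_real (walsh A \<epsilon>))"
    using Lp_norm_dilate_le[OF p \<gamma> lens cz uc] u unfolding R by simp
  moreover have "Lp_norm n p (\<lambda>\<epsilon>. \<Sum>A\<in>Pow {1..n}. of_real (a / b) ^ card A * c A * of_real (walsh A \<epsilon>)) = Lp_norm n p f"
  proof -
    have "of_real (a / b) ^ card A * c A = 1 ^ card A * fourier_coeff n f A" for A
    proof -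
      have "(of_real (a / b) * of_real r :: complex) = 1" using ab by (simp add: r_def)
      then show ?thesis by (simp add: c_def power_mult_distrib[symmetric] mult.assoc[symmetric] del: of_real_divide)
    qed
    then have "(\<Sum>A\<in>Pow {1..n}. of_real (a / b) ^ card A * c A * of_real (walsh A \<epsilon>)) = f \<epsilon>" if "\<epsilon> \<in> cube n" for \<epsilon>
      using noise_sum_one[OF that, of f] by (simp add: noise_sum_def)
    then show ?thesis unfolding Lp_norm_def by (simp cong: sum.cong)
  qed
  moreover have "Lp_norm n p (\<lambda>\<epsilon>. \<Sum>A\<in>Pow {1..n}. 1 ^ card A * c A * of_real (walsh A \<epsilon>)) \<le> Lp_norm n q f"
  proof -
    have "(\<lambda>\<epsilon>. \<Sum>A\<in>Pow {1..n}. 1 ^ card A * c A * of_real (walsh A \<epsilon>)) = noise_sum n f (of_real r)"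
      by (simp add: noise_sum_def c_def fun_eq_iff)
    then show ?thesis using noise_sum_hypercontractive[OF assms(1,2) r] by simp
  qed
  ultimately have "u ^ d * Lp_norm n p f \<le> Lp_norm n q f" by simp
  then have "Lp_norm n p f \<le> (1 / u) ^ d * Lp_norm n q f"
    using u by (simp add: field_simps power_divide)
  moreover have "1 / u = (X + Y) / (X - Y)" by (simp add: u_def)
  ultimately show ?thesis unfolding \<kappa> X_def Y_def a_def b_def by simp
qed

end
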